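(* Let $k$ be a field, $\mathfrak{g}$ a Lie algebra over $k$, $\mathfrak{h}$ an ideal of $\mathfrak{g}$ and $M$ a $\mathfrak{g}$-module. Let $H^2(\mathfrak{g},M)_1$ be the kernel of the restriction map $H^2(\mathfrak{g},M)\to H^2(\mathfrak{h},M)$. Then the sequence $$H^2(\mathfrak{g},M)_1\xrightarrow{\ \rho\ }H^1(\mathfrak{g}/\mathfrak{h},H^1(\mathfrak{h},M))\xrightarrow{\ \lambda\ }H^3(\mathfrak{g}/\mathfrak{h},M^{\mathfrak{h}})$$ is exact, where $\rho$ and $\lambda$ are the maps described in the context.
   Context: Derivations and $H^1$: for a Lie algebra $\mathfrak{a}$ over $k$ and an $\mathfrak{a}$-module $N$, $\mathrm{Der}(\mathfrak{a},N)$ is the space of $k$-linear maps $d:\mathfrak{a}\to N$ with $d[x,y]=x\cdot d(y)-y\cdot d(x)$; $\delta(n)$ is the inner derivation $x\mapsto x\cdot n$; $H^1(\mathfrak{a},N)=\mathrm{Der}(\mathfrak{a},N)/\mathrm{Inn}(\mathfrak{a},N)$ with $\mathrm{Inn}(\mathfrak{a},N)=\{\delta(n)\}$. $M^{\mathfrak{h}}=\{m: z\cdot m=0\ \forall z\in\mathfrak{h}\}$. $\mathfrak{g}$ acts on $\mathrm{Der}(\mathfrak{h},M)$ by $({}^xd)(z)=x\cdot d(z)-d[x,z]$, inducing a $\mathfrak{g}/\mathfrak{h}$-action on $H^1(\mathfrak{h},M)$. For a module $N$ over $\mathfrak{a}$, $N\rtimes\mathfrak{a}$ has bracket $[(n,x),(n',x')]=(x\cdot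 n'-x'\cdot n,[x,x'])$. $H^2(\mathfrak{a},N)$ is identified with equivalence classes of extensions $0\to N\xrightarrow{i}\mathfrak{e}\to\mathfrak{a}\to0$ of Lie algebras ($N$ abelian) inducing the given action $i(x\cdot n)=[\tilde x,i(n)]$. The map $\rho$: the class of $\underline{e}:0\to M\xrightarrow{i}\mathfrak{e}\xrightarrow{p}\mathfrak{g}\to0$ lies in $H^2(\mathfrak{g},M)_1$ iff there is a Lie algebra homomorphism $s_0:\mathfrak{h}\to\mathfrak{e}$ with $p\circ s_0=\mathrm{id}_{\mathfrak{h}}$. Fix such $s_0$ and for $y\in\mathfrak{e}$ let $d_y\in\mathrm{Der}(\mathfrak{h},M)$, $d_y(z)=i^{-1}([y,s_0(z)]-s_0[p(y),z])$. Then $p(y)+\mathfrak{h}\mapsto[d_y]$ is a well-defined derivation $\mathfrak{g}/\mathfrak{h}\to H^1(\mathfrak{h},M)$ and $\rho[\underline{e}]\in H^1(\mathfrak{g}/\mathfrak{h},H^1(\mathfrak{h},M))$ is its class (independent of choices). Crossed modules: a crossed module is a Lie algebra homomorphism $\partial:\mathfrak{m}\to\mathfrak{n}$ with an action of $\mathfrak{n}$ on $\mathfrak{m}$ by derivations such that $\partial({}^nm)=[n,\partial(m)]$ and ${}^{\partial(m)}m'=[m,m']$. A morphism $(\mathfrak{m}\to\mathfrak{n})\to(\mathfrak{m}'\to\mathfrak{n}')$ is a pair of Lie algebra maps commuting with the structure maps and compatible with the actions. A crossed extension of $\mathfrak{q}$ by a $\mathfrak{q}$-module $N$ is an exact sequence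 of Lie algebras $0\to N\xrightarrow{i}\mathfrak{m}\xrightarrow{\partial}\mathfrak{n}\xrightarrow{\pi}\mathfrak{q}\to0$ with $N$ abelian, $\partial$ a crossed module, and induced $\mathfrak{q}$-action on $N$ equal to the given one. Two crossed extensions are equivalent if they are related by the equivalence relation generated by existence of a crossed module morphism inducing the identity on $N$ and $\mathfrak{q}$. $H^3(\mathfrak{q},N)$ is identified with the set of equivalence classes: the class of the crossed extension $0\to N\xrightarrow{i}\mathfrak{m}\xrightarrow{\partial}\mathfrak{n}\xrightarrow{\pi}\mathfrak{q}\to0$ corresponds to that of the 3-cocycle $c$ obtained by choosing a linear section $\sigma$ of $\pi$, a bilinear alternating lift $\tilde f:\mathfrak{q}\times\mathfrak{q}\to\mathfrak{m}$ of $f(x,y)=[\sigma(x),\sigma(y)]-\sigma[x,y]$ through $\partial$, and putting $i\,c(x,y,z)={}^{\sigma(x)}\tilde f(y,z)-{}^{\sigma(y)}\tilde f(x,z)+{}^{\sigma(z)}\tilde f(x,y)-\tilde f([x,y],z)+\tilde f([x,z],y)-\tilde f([y,z],x)$. The zero class is that of $0\to N=N\xrightarrow{0}\mathfrak{q}=\mathfrak{q}\to0$. The map $\lambda$: let $\gamma:M\rtimes\mathfrak{h}\to\mathrm{Der}(\mathfrak{h},M)\rtimes\mathfrak{g}$, $\gamma(m,z)=(-\delta(m),z)$, a crossed module with action ${}^{(d,x)}(m,z)=(x\cdot m+d(z),[x,z])$. For a derivation $D:\mathfrak{g}/\mathfrak{h}\to H^1(\mathfrak{h},M)$ put $\mathfrak{p}=\{(d,x)\in\mathrm{Der}(\mathfrak{h},M)\rtimes\mathfrak{g}:[d]=D(x+\mathfrak{h})\}$.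 Then $\underline{e}_D:0\to M^{\mathfrak{h}}\to M\rtimes\mathfrak{h}\xrightarrow{\gamma}\mathfrak{p}\to\mathfrak{g}/\mathfrak{h}\to0$ (first map $m\mapsto(m,0)$, last map $(d,x)\mapsto x+\mathfrak{h}$) is a crossed extension, and $\lambda[D]:=[\underline{e}_D]\in H^3(\mathfrak{g}/\mathfrak{h},M^{\mathfrak{h}})$, which depends only on the class $[D]$. *)

theory Defs
  imports "HOL-Algebra.Module" "HOL-Algebra.AbelCoset"
begin

section \<open>Vector spaces\<close>

text \<open>
  A vector space over \<open>K\<close> is a \<open>module K V\<close> with \<open>field K\<close>. The fields \<open>mult\<close> and \<open>one\<close> of the
  record are not used by the locale \<open>module\<close>, so they are left undefined in the constructions
  below.

  Functions between carriers that are elements of some space (derivations, cochains) are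
  extensional, so that equality of elements is equality in HOL.

  Whenever a coset or an equivalence class is described by means of choices (representatives,
  sections, lifts), it is defined as the union over all choices, in the style of the quotient
  constructions of HOL-Algebra. Since distinct classes are disjoint and nonempty, such a union is
  a class iff there is at least one choice and all choices give the same class.
\<close>

definition lin_hom ::
    "('k, 'c) ring_scheme \<Rightarrow> ('k, 'a, 'd) module_scheme \<Rightarrow> ('k, 'b, 'e) module_scheme \<Rightarrow> ('a \<Rightarrow> 'b) set"
  where "lin_hom K V W = {f \<in> carrier V \<rightarrow> carrier W.
    (\<forall>x\<in>carrier V. \<forall>y\<in>carrier V. f (x \<oplus>\<^bsub>V\<^esub> y) = f x \<oplus>\<^bsub>W\<^esub> f y) \<and>
    (\<forall>a\<in>carrier K. \<forall>x\<in>carrier V. f (a \<odot>\<^bsub>V\<^esub> x) = a \<odot>\<^bsub>W\<^esub> f x)}"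

definition quot_module :: "('k, 'a, 'c) module_scheme \<Rightarrow> 'a set \<Rightarrow> ('k, 'a set) module"
  where "quot_module V U = \<lparr>carrier = a_rcosets\<^bsub>V\<^esub> U, mult = undefined, one = undefined,
    zero = U, add = set_add V, smult = (\<lambda>a X. \<Union>x\<in>X. U +>\<^bsub>V\<^esub> (a \<odot>\<^bsub>V\<^esub> x))\<rparr>"

definition fun_module :: "'s set \<Rightarrow> ('k, 'a, 'c) module_scheme \<Rightarrow> ('k, 's \<Rightarrow> 'a) module"
  where "fun_module S V = \<lparr>carrier = S \<rightarrow>\<^sub>E carrier V, mult = undefined, one = undefined,
    zero = (\<lambda>s\<in>S. \<zero>\<^bsub>V\<^esub>), add = (\<lambda>f g. \<lambda>s\<in>S. f s \<oplus>\<^bsub>V\<^esub> g s),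
    smult = (\<lambda>a f. \<lambda>s\<in>S. a \<odot>\<^bsub>V\<^esub> f s)\<rparr>"


section \<open>Lie algebras and their modules\<close>

record ('k, 'a) lie_algebra = "('k, 'a) module" +
  lie_bracket :: "'a \<Rightarrow> 'a \<Rightarrow> 'a" (\<open>\<lblot>_,/ _\<rblot>\<index>\<close>)

locale lie_algebra = field K + module K L
  for K :: "('k, 'c) ring_scheme" and L :: "('k, 'a, 'd) lie_algebra_scheme" +
  assumes bracket_closed:
      "\<lbrakk>x \<in> carrier L; y \<in> carrier L\<rbrakk> \<Longrightarrow> \<lblot>x, y\<rblot>\<^bsub>L\<^esub> \<in> carrier L"
    and bracket_add_left:
      "\<lbrakk>x \<in> carrier L; y \<in> carrier L; z \<in> carrier L\<rbrakk> \<Longrightarrow>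
        \<lblot>x \<oplus>\<^bsub>L\<^esub> y, z\<rblot>\<^bsub>L\<^esub> = \<lblot>x, z\<rblot>\<^bsub>L\<^esub> \<oplus>\<^bsub>L\<^esub> \<lblot>y, z\<rblot>\<^bsub>L\<^esub>"
    and bracket_add_right:
      "\<lbrakk>x \<in> carrier L; y \<in> carrier L; z \<in> carrier L\<rbrakk> \<Longrightarrow>
        \<lblot>x, y \<oplus>\<^bsub>L\<^esub> z\<rblot>\<^bsub>L\<^esub> = \<lblot>x, y\<rblot>\<^bsub>L\<^esub> \<oplus>\<^bsub>L\<^esub> \<lblot>x, z\<rblot>\<^bsub>L\<^esub>"
    and bracket_smult_left:
      "\<lbrakk>a \<in> carrier K; x \<in> carrier L; y \<in> carrier L\<rbrakk> \<Longrightarrow>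
        \<lblot>a \<odot>\<^bsub>L\<^esub> x, y\<rblot>\<^bsub>L\<^esub> = a \<odot>\<^bsub>L\<^esub> \<lblot>x, y\<rblot>\<^bsub>L\<^esub>"
    and bracket_smult_right:
      "\<lbrakk>a \<in> carrier K; x \<in> carrier L; y \<in> carrier L\<rbrakk> \<Longrightarrow>
        \<lblot>x, a \<odot>\<^bsub>L\<^esub> y\<rblot>\<^bsub>L\<^esub> = a \<odot>\<^bsub>L\<^esub> \<lblot>x, y\<rblot>\<^bsub>L\<^esub>"
    and bracket_alternating: "x \<in> carrier L \<Longrightarrow> \<lblot>x, x\<rblot>\<^bsub>L\<^esub> = \<zero>\<^bsub>L\<^esub>"
    and jacobi:
      "\<lbrakk>x \<in> carrier L; y \<in> carrier L; z \<in> carrier L\<rbrakk> \<Longrightarrow>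
        \<lblot>x, \<lblot>y, z\<rblot>\<^bsub>L\<^esub>\<rblot>\<^bsub>L\<^esub> \<oplus>\<^bsub>L\<^esub> \<lblot>y, \<lblot>z, x\<rblot>\<^bsub>L\<^esub>\<rblot>\<^bsub>L\<^esub> \<oplus>\<^bsub>L\<^esub> \<lblot>z, \<lblot>x, y\<rblot>\<^bsub>L\<^esub>\<rblot>\<^bsub>L\<^esub> = \<zero>\<^bsub>L\<^esub>"

definition lie_hom ::
    "('k, 'c) ring_scheme \<Rightarrow> ('k, 'a, 'd) lie_algebra_scheme \<Rightarrow> ('k, 'b, 'e) lie_algebra_scheme \<Rightarrow> ('a \<Rightarrow> 'b) set"
  where "lie_hom K L L' = {f \<in> lin_hom K L L'.
    \<forall>x\<in>carrier L. \<forall>y\<in>carrier L. f \<lblot>x, y\<rblot>\<^bsub>L\<^esub> = \<lblot>f x, f y\<rblot>\<^bsub>L'\<^esub>}"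

definition lie_ideal :: "('k, 'c) ring_scheme \<Rightarrow> ('k, 'a, 'd) lie_algebra_scheme \<Rightarrow> 'a set \<Rightarrow> bool"
  where "lie_ideal K L I \<longleftrightarrow>
    submodule I K L \<and> (\<forall>x\<in>carrier L. \<forall>z\<in>I. \<lblot>x, z\<rblot>\<^bsub>L\<^esub> \<in> I)"

definition quot_lie :: "('k, 'a, 'd) lie_algebra_scheme \<Rightarrow> 'a set \<Rightarrow> ('k, 'a set) lie_algebra"
  where "quot_lie L I = \<lparr>carrier = a_rcosets\<^bsub>L\<^esub> I, mult = undefined, one = undefined,
    zero = I, add = set_add L, smult = (\<lambda>a X. \<Union>x\<in>X. I +>\<^bsub>L\<^esub> (a \<odot>\<^bsub>L\<^esub> x)),
    lie_bracket = (\<lambda>X Y. \<Union>x\<in>X. \<Union>y\<in>Y. I +>\<^bsub>L\<^esub> \<lblot>x, y\<rblot>\<^bsub>L\<^esub>)\<rparr>"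

locale lie_module = lie_algebra K L + N: module K N
  for K :: "('k, 'c) ring_scheme" and L :: "('k, 'a, 'd) lie_algebra_scheme"
    and N :: "('k, 'n, 'e) module_scheme" +
  fixes act :: "'a \<Rightarrow> 'n \<Rightarrow> 'n"
  assumes act_closed:
      "\<lbrakk>x \<in> carrier L; n \<in> carrier N\<rbrakk> \<Longrightarrow> act x n \<in> carrier N"
    and act_add_left:
      "\<lbrakk>x \<in> carrier L; y \<in> carrier L; n \<in> carrier N\<rbrakk> \<Longrightarrow>
        act (x \<oplus>\<^bsub>L\<^esub> y) n = act x n \<oplus>\<^bsub>N\<^esub> act y n"
    and act_add_right:
      "\<lbrakk>x \<in> carrier L; n \<in> carrier N; n' \<in> carrier N\<rbrakk> \<Longrightarrow>
        act x (n \<oplus>\<^bsub>N\<^esub> n') = act x n \<oplus>\<^bsub>N\<^esub> act x n'"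
    and act_smult_left:
      "\<lbrakk>a \<in> carrier K; x \<in> carrier L; n \<in> carrier N\<rbrakk> \<Longrightarrow>
        act (a \<odot>\<^bsub>L\<^esub> x) n = a \<odot>\<^bsub>N\<^esub> act x n"
    and act_smult_right:
      "\<lbrakk>a \<in> carrier K; x \<in> carrier L; n \<in> carrier N\<rbrakk> \<Longrightarrow>
        act x (a \<odot>\<^bsub>N\<^esub> n) = a \<odot>\<^bsub>N\<^esub> act x n"
    and act_bracket:
      "\<lbrakk>x \<in> carrier L; y \<in> carrier L; n \<in> carrier N\<rbrakk> \<Longrightarrow>
        act \<lblot>x, y\<rblot>\<^bsub>L\<^esub> n = act x (act y n) \<ominus>\<^bsub>N\<^esub> act y (act x n)"

definition invariants :: "('k, 'n, 'e) module_scheme \<Rightarrow> ('a \<Rightarrow> 'n \<Rightarrow> 'n) \<Rightarrow> 'a set \<Rightarrow> 'n set"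
  where "invariants M act H = {m \<in> carrier M. \<forall>z\<in>H. act z m = \<zero>\<^bsub>M\<^esub>}"

text \<open>The action of a coset on the invariants, through any representative.\<close>

definition inv_action :: "('a \<Rightarrow> 'n \<Rightarrow> 'n) \<Rightarrow> 'a set \<Rightarrow> 'n \<Rightarrow> 'n"
  where "inv_action act X m = the_elem ((\<lambda>x. act x m) ` X)"

definition semidirect ::
    "('k, 'n, 'e) module_scheme \<Rightarrow> ('k, 'a, 'd) lie_algebra_scheme \<Rightarrow> ('a \<Rightarrow> 'n \<Rightarrow> 'n) \<Rightarrow>
      ('k, 'n \<times> 'a) lie_algebra"
  where "semidirect N L act = \<lparr>carrier = carrier N \<times> carrier L, mult = undefined, one = undefined,
    zero = (\<zero>\<^bsub>N\<^esub>, \<zero>\<^bsub>L\<^esub>),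
    add = (\<lambda>(n, x) (n', x'). (n \<oplus>\<^bsub>N\<^esub> n', x \<oplus>\<^bsub>L\<^esub> x')),
    smult = (\<lambda>a (n, x). (a \<odot>\<^bsub>N\<^esub> n, a \<odot>\<^bsub>L\<^esub> x)),
    lie_bracket = (\<lambda>(n, x) (n', x'). (act x n' \<ominus>\<^bsub>N\<^esub> act x' n, \<lblot>x, x'\<rblot>\<^bsub>L\<^esub>))\<rparr>"


section \<open>First cohomology\<close>

definition derivations ::
    "('k, 'c) ring_scheme \<Rightarrow> ('k, 'a, 'd) lie_algebra_scheme \<Rightarrow> ('k, 'n, 'e) module_scheme \<Rightarrow>
      ('a \<Rightarrow> 'n \<Rightarrow> 'n) \<Rightarrow> ('a \<Rightarrow> 'n) set"
  where "derivations K L N act = {d \<in> carrier L \<rightarrow>\<^sub>E carrier N. d \<in> lin_hom K L N \<and>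
    (\<forall>x\<in>carrier L. \<forall>y\<in>carrier L. d \<lblot>x, y\<rblot>\<^bsub>L\<^esub> = act x (d y) \<ominus>\<^bsub>N\<^esub> act y (d x))}"

definition Der ::
    "('k, 'c) ring_scheme \<Rightarrow> ('k, 'a, 'd) lie_algebra_scheme \<Rightarrow> ('k, 'n, 'e) module_scheme \<Rightarrow>
      ('a \<Rightarrow> 'n \<Rightarrow> 'n) \<Rightarrow> ('k, 'a \<Rightarrow> 'n) module"
  where "Der K L N act = fun_module (carrier L) N \<lparr>carrier := derivations K L N act\<rparr>"

definition inner_der :: "('k, 'a, 'd) lie_algebra_scheme \<Rightarrow> ('a \<Rightarrow> 'n \<Rightarrow> 'n) \<Rightarrow> 'n \<Rightarrow> 'a \<Rightarrow> 'n"
  where "inner_der L act n = (\<lambda>x\<in>carrier L. act x n)"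

definition Inn ::
    "('k, 'a, 'd) lie_algebra_scheme \<Rightarrow> ('k, 'n, 'e) module_scheme \<Rightarrow> ('a \<Rightarrow> 'n \<Rightarrow> 'n) \<Rightarrow> ('a \<Rightarrow> 'n) set"
  where "Inn L N act = inner_der L act ` carrier N"

definition H1 ::
    "('k, 'c) ring_scheme \<Rightarrow> ('k, 'a, 'd) lie_algebra_scheme \<Rightarrow> ('k, 'n, 'e) module_scheme \<Rightarrow>
      ('a \<Rightarrow> 'n \<Rightarrow> 'n) \<Rightarrow> ('k, ('a \<Rightarrow> 'n) set) module"
  where "H1 K L N act = quot_module (Der K L N act) (Inn L N act)"

definition H1_class ::
    "('k, 'c) ring_scheme \<Rightarrow> ('k, 'a, 'd) lie_algebra_scheme \<Rightarrow> ('k, 'n, 'e) module_scheme \<Rightarrow>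
      ('a \<Rightarrow> 'n \<Rightarrow> 'n) \<Rightarrow> ('a \<Rightarrow> 'n) \<Rightarrow> ('a \<Rightarrow> 'n) set"
  where "H1_class K L N act d = Inn L N act +>\<^bsub>Der K L N act\<^esub> d"

text \<open>The action of a Lie algebra on the derivations from an ideal \<open>H\<close>, and the action of the
  quotient by \<open>H\<close> that it induces on cohomology.\<close>

definition der_action ::
    "('k, 'a, 'd) lie_algebra_scheme \<Rightarrow> 'a set \<Rightarrow> ('k, 'n, 'e) module_scheme \<Rightarrow> ('a \<Rightarrow> 'n \<Rightarrow> 'n) \<Rightarrow>
      'a \<Rightarrow> ('a \<Rightarrow> 'n) \<Rightarrow> 'a \<Rightarrow> 'n"
  where "der_action G H M act x d = (\<lambda>z\<in>H. act x (d z) \<ominus>\<^bsub>M\<^esub> d \<lblot>x, z\<rblot>\<^bsub>G\<^esub>)"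

definition H1_action ::
    "('k, 'c) ring_scheme \<Rightarrow> ('k, 'a, 'd) lie_algebra_scheme \<Rightarrow> 'a set \<Rightarrow> ('k, 'n, 'e) module_scheme \<Rightarrow>
      ('a \<Rightarrow> 'n \<Rightarrow> 'n) \<Rightarrow> 'a set \<Rightarrow> ('a \<Rightarrow> 'n) set \<Rightarrow> ('a \<Rightarrow> 'n) set"
  where "H1_action K G H M act X C =
    (\<Union>x\<in>X. \<Union>d\<in>C. H1_class K (G\<lparr>carrier := H\<rparr>) M act (der_action G H M act x d))"

abbreviation H1_H1 ::
    "('k, 'c) ring_scheme \<Rightarrow> ('k, 'a, 'd) lie_algebra_scheme \<Rightarrow> 'a set \<Rightarrow> ('k, 'n, 'e) module_scheme \<Rightarrow>
      ('a \<Rightarrow> 'n \<Rightarrow> 'n) \<Rightarrow> ('k, ('a set \<Rightarrow> ('a \<Rightarrow> 'n) set) set) module"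
  where "H1_H1 K G H M act \<equiv>
    H1 K (quot_lie G H) (H1 K (G\<lparr>carrier := H\<rparr>) M act) (H1_action K G H M act)"


section \<open>Second cohomology, by extensions\<close>

record ('k, 'n, 'e, 'a) lie_ext =
  ext_alg :: "('k, 'e) lie_algebra"
  ext_incl :: "'n \<Rightarrow> 'e"
  ext_proj :: "'e \<Rightarrow> 'a"

definition lie_extension ::
    "('k, 'c) ring_scheme \<Rightarrow> ('k, 'a, 'd) lie_algebra_scheme \<Rightarrow> ('k, 'n, 'f) module_scheme \<Rightarrow>
      ('a \<Rightarrow> 'n \<Rightarrow> 'n) \<Rightarrow> ('k, 'n, 'e, 'a) lie_ext \<Rightarrow> bool"
  where "lie_extension K L N act E \<longleftrightarrow>
    lie_algebra K (ext_alg E) \<and>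
    ext_incl E \<in> lin_hom K N (ext_alg E) \<and>
    (\<forall>n\<in>carrier N. \<forall>n'\<in>carrier N. \<lblot>ext_incl E n, ext_incl E n'\<rblot>\<^bsub>ext_alg E\<^esub> = \<zero>\<^bsub>ext_alg E\<^esub>) \<and>
    ext_proj E \<in> lie_hom K (ext_alg E) L \<and>
    inj_on (ext_incl E) (carrier N) \<and>
    ext_incl E ` carrier N = a_kernel (ext_alg E) L (ext_proj E) \<and>
    ext_proj E ` carrier (ext_alg E) = carrier L \<and>
    (\<forall>y\<in>carrier (ext_alg E). \<forall>n\<in>carrier N.
      ext_incl E (act (ext_proj E y) n) = \<lblot>y, ext_incl E n\<rblot>\<^bsub>ext_alg E\<^esub>)"

definition ext_equiv ::
    "('k, 'c) ring_scheme \<Rightarrow> ('k, 'a, 'd) lie_algebra_scheme \<Rightarrow> ('k, 'n, 'f) module_scheme \<Rightarrow>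
      ('a \<Rightarrow> 'n \<Rightarrow> 'n) \<Rightarrow> ('k, 'n, 'e, 'a) lie_ext rel"
  where "ext_equiv K L N act =
    {(E, E'). lie_extension K L N act E \<and> lie_extension K L N act E' \<and>
      (\<exists>\<phi>\<in>lie_hom K (ext_alg E) (ext_alg E').
        (\<forall>n\<in>carrier N. \<phi> (ext_incl E n) = ext_incl E' n) \<and>
        (\<forall>y\<in>carrier (ext_alg E). ext_proj E' (\<phi> y) = ext_proj E y))}"

text \<open>
  Every extension splits as an extension of vector spaces, hence is equivalent to one whose
  underlying set is the product of the carriers. So it loses no class to require the elements of
  the extensions to be of type \<open>'n \<times> 'a\<close>; their carriers and operations are arbitrary.
\<close>

definition H2 ::
    "('k, 'c) ring_scheme \<Rightarrow> ('k, 'a, 'd) lie_algebra_scheme \<Rightarrow> ('k, 'n, 'f) module_scheme \<Rightarrow>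
      ('a \<Rightarrow> 'n \<Rightarrow> 'n) \<Rightarrow> ('k, 'n, 'n \<times> 'a, 'a) lie_ext set set"
  where "H2 K L N act = {E. lie_extension K L N act E} // ext_equiv K L N act"

definition split_ext ::
    "('k, 'a, 'd) lie_algebra_scheme \<Rightarrow> ('k, 'n, 'f) module_scheme \<Rightarrow> ('a \<Rightarrow> 'n \<Rightarrow> 'n) \<Rightarrow>
      ('k, 'n, 'n \<times> 'a, 'a) lie_ext"
  where "split_ext L N act =
    \<lparr>ext_alg = semidirect N L act, ext_incl = (\<lambda>n. (n, \<zero>\<^bsub>L\<^esub>)), ext_proj = snd\<rparr>"

definition restrict_ext :: "'a set \<Rightarrow> ('k, 'n, 'e, 'a) lie_ext \<Rightarrow> ('k, 'n, 'e, 'a) lie_ext"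
  where "restrict_ext H E = E\<lparr>ext_alg :=
    (ext_alg E)\<lparr>carrier := {y \<in> carrier (ext_alg E). ext_proj E y \<in> H}\<rparr>\<rparr>"

definition H2_res ::
    "('k, 'c) ring_scheme \<Rightarrow> ('k, 'a, 'd) lie_algebra_scheme \<Rightarrow> 'a set \<Rightarrow> ('k, 'n, 'f) module_scheme \<Rightarrow>
      ('a \<Rightarrow> 'n \<Rightarrow> 'n) \<Rightarrow> ('k, 'n, 'n \<times> 'a, 'a) lie_ext set \<Rightarrow> ('k, 'n, 'n \<times> 'a, 'a) lie_ext set"
  where "H2_res K G H M act X =
    (\<Union>E\<in>X. ext_equiv K (G\<lparr>carrier := H\<rparr>) M act `` {restrict_ext H E})"

text \<open>The kernel of the restriction to \<open>H\<close>: the zero class is that of the split extension.\<close>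

definition H2_1 ::
    "('k, 'c) ring_scheme \<Rightarrow> ('k, 'a, 'd) lie_algebra_scheme \<Rightarrow> 'a set \<Rightarrow> ('k, 'n, 'f) module_scheme \<Rightarrow>
      ('a \<Rightarrow> 'n \<Rightarrow> 'n) \<Rightarrow> ('k, 'n, 'n \<times> 'a, 'a) lie_ext set set"
  where "H2_1 K G H M act = {X \<in> H2 K G M act. H2_res K G H M act X =
    ext_equiv K (G\<lparr>carrier := H\<rparr>) M act `` {split_ext (G\<lparr>carrier := H\<rparr>) M act}}"


section \<open>The map \<open>\<rho>\<close>\<close>

definition rho_der ::
    "('k, 'a, 'd) lie_algebra_scheme \<Rightarrow> 'a set \<Rightarrow> ('k, 'n, 'f) module_scheme \<Rightarrow>
      ('k, 'n, 'e, 'a) lie_ext \<Rightarrow> ('a \<Rightarrow> 'e) \<Rightarrow> 'e \<Rightarrow> 'a \<Rightarrow> 'n"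
  where "rho_der G H M E s y = (\<lambda>z\<in>H. the_inv_into (carrier M) (ext_incl E)
    (\<lblot>y, s z\<rblot>\<^bsub>ext_alg E\<^esub> \<ominus>\<^bsub>ext_alg E\<^esub> s \<lblot>ext_proj E y, z\<rblot>\<^bsub>G\<^esub>))"

definition rho_derivation ::
    "('k, 'c) ring_scheme \<Rightarrow> ('k, 'a, 'd) lie_algebra_scheme \<Rightarrow> 'a set \<Rightarrow> ('k, 'n, 'f) module_scheme \<Rightarrow>
      ('a \<Rightarrow> 'n \<Rightarrow> 'n) \<Rightarrow> ('k, 'n, 'e, 'a) lie_ext \<Rightarrow> ('a \<Rightarrow> 'e) \<Rightarrow> 'a set \<Rightarrow> ('a \<Rightarrow> 'n) set"
  where "rho_derivation K G H M act E s = (\<lambda>Y\<in>carrier (quot_lie G H).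
    \<Union>y\<in>{y \<in> carrier (ext_alg E). H +>\<^bsub>G\<^esub> ext_proj E y = Y}.
      H1_class K (G\<lparr>carrier := H\<rparr>) M act (rho_der G H M E s y))"

definition rho ::
    "('k, 'c) ring_scheme \<Rightarrow> ('k, 'a, 'd) lie_algebra_scheme \<Rightarrow> 'a set \<Rightarrow> ('k, 'n, 'f) module_scheme \<Rightarrow>
      ('a \<Rightarrow> 'n \<Rightarrow> 'n) \<Rightarrow> ('k, 'n, 'n \<times> 'a, 'a) lie_ext set \<Rightarrow> ('a set \<Rightarrow> ('a \<Rightarrow> 'n) set) set"
  where "rho K G H M act X =
    (\<Union>E\<in>X. \<Union>s\<in>{s \<in> lie_hom K (G\<lparr>carrier := H\<rparr>) (ext_alg E). \<forall>z\<in>H. ext_proj E (s z) = z}.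
      H1_class K (quot_lie G H) (H1 K (G\<lparr>carrier := H\<rparr>) M act) (H1_action K G H M act)
        (rho_derivation K G H M act E s))"


section \<open>Third cohomology, by cocycles\<close>

definition alt_bilinear ::
    "('k, 'c) ring_scheme \<Rightarrow> ('k, 'a, 'd) module_scheme \<Rightarrow> ('k, 'n, 'e) module_scheme \<Rightarrow>
      ('a \<times> 'a \<Rightarrow> 'n) set"
  where "alt_bilinear K L N = {b \<in> carrier L \<times> carrier L \<rightarrow>\<^sub>E carrier N.
    (\<forall>x\<in>carrier L. (\<lambda>y. b (x, y)) \<in> lin_hom K L N \<and> (\<lambda>y. b (y, x)) \<in> lin_hom K L N \<and>
      b (x, x) = \<zero>\<^bsub>N\<^esub>)}"

definition alt_trilinear ::
    "('k, 'c) ring_scheme \<Rightarrow> ('k, 'a, 'd) module_scheme \<Rightarrow> ('k, 'n, 'e) module_scheme \<Rightarrow>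
      ('a \<times> 'a \<times> 'a \<Rightarrow> 'n) set"
  where "alt_trilinear K L N = {c \<in> carrier L \<times> carrier L \<times> carrier L \<rightarrow>\<^sub>E carrier N.
    (\<forall>x\<in>carrier L. \<forall>y\<in>carrier L.
      (\<lambda>z. c (x, y, z)) \<in> lin_hom K L N \<and> (\<lambda>z. c (x, z, y)) \<in> lin_hom K L N \<and>
      (\<lambda>z. c (z, x, y)) \<in> lin_hom K L N \<and>
      c (x, x, y) = \<zero>\<^bsub>N\<^esub> \<and> c (x, y, x) = \<zero>\<^bsub>N\<^esub> \<and> c (y, x, x) = \<zero>\<^bsub>N\<^esub>)}"

text \<open>The Chevalley--Eilenberg differential in degrees 2 and 3. The first one is stated for a
  function \<open>act\<close> and a map \<open>b\<close> with values in an arbitrary module, because it is also the formula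
  for the 3-cocycle of a crossed extension.\<close>

definition ce_diff2 ::
    "('k, 'a, 'd) lie_algebra_scheme \<Rightarrow> ('k, 'n, 'e) module_scheme \<Rightarrow> ('a \<Rightarrow> 'n \<Rightarrow> 'n) \<Rightarrow>
      ('a \<times> 'a \<Rightarrow> 'n) \<Rightarrow> 'a \<times> 'a \<times> 'a \<Rightarrow> 'n"
  where "ce_diff2 L N act b = (\<lambda>(x, y, z)\<in>carrier L \<times> carrier L \<times> carrier L.
    act x (b (y, z)) \<ominus>\<^bsub>N\<^esub> act y (b (x, z)) \<oplus>\<^bsub>N\<^esub> act z (b (x, y))
    \<ominus>\<^bsub>N\<^esub> b (\<lblot>x, y\<rblot>\<^bsub>L\<^esub>, z) \<oplus>\<^bsub>N\<^esub> b (\<lblot>x, z\<rblot>\<^bsub>L\<^esub>, y) \<ominus>\<^bsub>N\<^esub> b (\<lblot>y, z\<rblot>\<^bsub>L\<^esub>, x))"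

definition ce_diff3 ::
    "('k, 'a, 'd) lie_algebra_scheme \<Rightarrow> ('k, 'n, 'e) module_scheme \<Rightarrow> ('a \<Rightarrow> 'n \<Rightarrow> 'n) \<Rightarrow>
      ('a \<times> 'a \<times> 'a \<Rightarrow> 'n) \<Rightarrow> 'a \<times> 'a \<times> 'a \<times> 'a \<Rightarrow> 'n"
  where "ce_diff3 L N act c = (\<lambda>(x, y, z, w)\<in>carrier L \<times> carrier L \<times> carrier L \<times> carrier L.
    act x (c (y, z, w)) \<ominus>\<^bsub>N\<^esub> act y (c (x, z, w)) \<oplus>\<^bsub>N\<^esub> act z (c (x, y, w)) \<ominus>\<^bsub>N\<^esub> act w (c (x, y, z))
    \<ominus>\<^bsub>N\<^esub> c (\<lblot>x, y\<rblot>\<^bsub>L\<^esub>, z, w) \<oplus>\<^bsub>N\<^esub> c (\<lblot>x, z\<rblot>\<^bsub>L\<^esub>, y, w) \<ominus>\<^bsub>N\<^esub> c (\<lblot>x, w\<rblot>\<^bsub>L\<^esub>, y, z)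
    \<ominus>\<^bsub>N\<^esub> c (\<lblot>y, z\<rblot>\<^bsub>L\<^esub>, x, w) \<oplus>\<^bsub>N\<^esub> c (\<lblot>y, w\<rblot>\<^bsub>L\<^esub>, x, z) \<ominus>\<^bsub>N\<^esub> c (\<lblot>z, w\<rblot>\<^bsub>L\<^esub>, x, y))"

definition Z3 ::
    "('k, 'c) ring_scheme \<Rightarrow> ('k, 'a, 'd) lie_algebra_scheme \<Rightarrow> ('k, 'n, 'e) module_scheme \<Rightarrow>
      ('a \<Rightarrow> 'n \<Rightarrow> 'n) \<Rightarrow> ('k, 'a \<times> 'a \<times> 'a \<Rightarrow> 'n) module"
  where "Z3 K L N act = fun_module (carrier L \<times> carrier L \<times> carrier L) N
    \<lparr>carrier := {c \<in> alt_trilinear K L N. ce_diff3 L N act c =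
      (\<lambda>_\<in>carrier L \<times> carrier L \<times> carrier L \<times> carrier L. \<zero>\<^bsub>N\<^esub>)}\<rparr>"

definition B3 ::
    "('k, 'c) ring_scheme \<Rightarrow> ('k, 'a, 'd) lie_algebra_scheme \<Rightarrow> ('k, 'n, 'e) module_scheme \<Rightarrow>
      ('a \<Rightarrow> 'n \<Rightarrow> 'n) \<Rightarrow> ('a \<times> 'a \<times> 'a \<Rightarrow> 'n) set"
  where "B3 K L N act = ce_diff2 L N act ` alt_bilinear K L N"

definition H3 ::
    "('k, 'c) ring_scheme \<Rightarrow> ('k, 'a, 'd) lie_algebra_scheme \<Rightarrow> ('k, 'n, 'e) module_scheme \<Rightarrow>
      ('a \<Rightarrow> 'n \<Rightarrow> 'n) \<Rightarrow> ('k, ('a \<times> 'a \<times> 'a \<Rightarrow> 'n) set) module"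
  where "H3 K L N act = quot_module (Z3 K L N act) (B3 K L N act)"

definition H3_class ::
    "('k, 'c) ring_scheme \<Rightarrow> ('k, 'a, 'd) lie_algebra_scheme \<Rightarrow> ('k, 'n, 'e) module_scheme \<Rightarrow>
      ('a \<Rightarrow> 'n \<Rightarrow> 'n) \<Rightarrow> ('a \<times> 'a \<times> 'a \<Rightarrow> 'n) \<Rightarrow> ('a \<times> 'a \<times> 'a \<Rightarrow> 'n) set"
  where "H3_class K L N act c = B3 K L N act +>\<^bsub>Z3 K L N act\<^esub> c"


section \<open>Crossed extensions\<close>

definition crossed_module ::
    "('k, 'c) ring_scheme \<Rightarrow> ('k, 'm, 'd) lie_algebra_scheme \<Rightarrow> ('k, 'p, 'e) lie_algebra_scheme \<Rightarrow>
      ('p \<Rightarrow> 'm \<Rightarrow> 'm) \<Rightarrow> ('m \<Rightarrow> 'p) \<Rightarrow> bool"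
  where "crossed_module K A P act bnd \<longleftrightarrow>
    lie_algebra K A \<and> lie_algebra K P \<and> bnd \<in> lie_hom K A P \<and>
    lie_module K P A act \<and>
    (\<forall>p\<in>carrier P. \<forall>a\<in>carrier A. \<forall>a'\<in>carrier A.
      act p \<lblot>a, a'\<rblot>\<^bsub>A\<^esub> = \<lblot>act p a, a'\<rblot>\<^bsub>A\<^esub> \<oplus>\<^bsub>A\<^esub> \<lblot>a, act p a'\<rblot>\<^bsub>A\<^esub>) \<and>
    (\<forall>p\<in>carrier P. \<forall>a\<in>carrier A. bnd (act p a) = \<lblot>p, bnd a\<rblot>\<^bsub>P\<^esub>) \<and>
    (\<forall>a\<in>carrier A. \<forall>a'\<in>carrier A. act (bnd a) a' = \<lblot>a, a'\<rblot>\<^bsub>A\<^esub>)"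

record ('k, 'n, 'm, 'p, 'q) crossed_ext =
  x_src :: "('k, 'm) lie_algebra"
  x_tgt :: "('k, 'p) lie_algebra"
  x_act :: "'p \<Rightarrow> 'm \<Rightarrow> 'm"
  x_incl :: "'n \<Rightarrow> 'm"
  x_bnd :: "'m \<Rightarrow> 'p"
  x_proj :: "'p \<Rightarrow> 'q"

definition crossed_extension ::
    "('k, 'c) ring_scheme \<Rightarrow> ('k, 'q, 'd) lie_algebra_scheme \<Rightarrow> ('k, 'n, 'e) module_scheme \<Rightarrow>
      ('q \<Rightarrow> 'n \<Rightarrow> 'n) \<Rightarrow> ('k, 'n, 'm, 'p, 'q) crossed_ext \<Rightarrow> bool"
  where "crossed_extension K Q N act E \<longleftrightarrow>
    crossed_module K (x_src E) (x_tgt E) (x_act E) (x_bnd E) \<and>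
    x_incl E \<in> lin_hom K N (x_src E) \<and>
    (\<forall>n\<in>carrier N. \<forall>n'\<in>carrier N. \<lblot>x_incl E n, x_incl E n'\<rblot>\<^bsub>x_src E\<^esub> = \<zero>\<^bsub>x_src E\<^esub>) \<and>
    x_proj E \<in> lie_hom K (x_tgt E) Q \<and>
    inj_on (x_incl E) (carrier N) \<and>
    x_incl E ` carrier N = a_kernel (x_src E) (x_tgt E) (x_bnd E) \<and>
    x_bnd E ` carrier (x_src E) = a_kernel (x_tgt E) Q (x_proj E) \<and>
    x_proj E ` carrier (x_tgt E) = carrier Q \<and>
    (\<forall>p\<in>carrier (x_tgt E). \<forall>n\<in>carrier N.
      x_incl E (act (x_proj E p) n) = x_act E p (x_incl E n))"

text \<open>
  \<open>c\<close> is a 3-cocycle of the crossed extension \<open>E\<close>: for some linear section \<open>\<sigma>\<close> and some alternating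
  bilinear lift \<open>f\<close> of its curvature, \<open>i c(x,y,z)\<close> is the alternating sum \<open>ce_diff2\<close>, in which
  \<open>x\<close> operates on the source of the crossed module as \<open>\<sigma> x\<close>.
\<close>

definition crossed_cocycle ::
    "('k, 'c) ring_scheme \<Rightarrow> ('k, 'q, 'd) lie_algebra_scheme \<Rightarrow> ('k, 'n, 'e) module_scheme \<Rightarrow>
      ('q \<Rightarrow> 'n \<Rightarrow> 'n) \<Rightarrow> ('k, 'n, 'm, 'p, 'q) crossed_ext \<Rightarrow> ('q \<times> 'q \<times> 'q \<Rightarrow> 'n) \<Rightarrow> bool"
  where "crossed_cocycle K Q N act E c \<longleftrightarrow>
    crossed_extension K Q N act E \<and>
    c \<in> carrier Q \<times> carrier Q \<times> carrier Q \<rightarrow>\<^sub>E carrier N \<and>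
    (\<exists>\<sigma>\<in>lin_hom K Q (x_tgt E). \<exists>f\<in>alt_bilinear K Q (x_src E).
      (\<forall>x\<in>carrier Q. x_proj E (\<sigma> x) = x) \<and>
      (\<forall>x\<in>carrier Q. \<forall>y\<in>carrier Q.
        x_bnd E (f (x, y)) = \<lblot>\<sigma> x, \<sigma> y\<rblot>\<^bsub>x_tgt E\<^esub> \<ominus>\<^bsub>x_tgt E\<^esub> \<sigma> \<lblot>x, y\<rblot>\<^bsub>Q\<^esub>) \<and>
      (\<forall>t\<in>carrier Q \<times> carrier Q \<times> carrier Q.
        x_incl E (c t) = ce_diff2 Q (x_src E) (\<lambda>x. x_act E (\<sigma> x)) f t))"

definition crossed_class ::
    "('k, 'c) ring_scheme \<Rightarrow> ('k, 'q, 'd) lie_algebra_scheme \<Rightarrow> ('k, 'n, 'e) module_scheme \<Rightarrow>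
      ('q \<Rightarrow> 'n \<Rightarrow> 'n) \<Rightarrow> ('k, 'n, 'm, 'p, 'q) crossed_ext \<Rightarrow> ('q \<times> 'q \<times> 'q \<Rightarrow> 'n) set"
  where "crossed_class K Q N act E =
    (\<Union>c\<in>{c. crossed_cocycle K Q N act E c}. H3_class K Q N act c)"


section \<open>The map \<open>\<lambda>\<close>\<close>

abbreviation H3_inv ::
    "('k, 'c) ring_scheme \<Rightarrow> ('k, 'a, 'd) lie_algebra_scheme \<Rightarrow> 'a set \<Rightarrow> ('k, 'n, 'e) module_scheme \<Rightarrow>
      ('a \<Rightarrow> 'n \<Rightarrow> 'n) \<Rightarrow> ('k, ('a set \<times> 'a set \<times> 'a set \<Rightarrow> 'n) set) module"
  where "H3_inv K G H M act \<equiv>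
    H3 K (quot_lie G H) (M\<lparr>carrier := invariants M act H\<rparr>) (inv_action act)"

definition lam_alg ::
    "('k, 'c) ring_scheme \<Rightarrow> ('k, 'a, 'd) lie_algebra_scheme \<Rightarrow> 'a set \<Rightarrow> ('k, 'n, 'e) module_scheme \<Rightarrow>
      ('a \<Rightarrow> 'n \<Rightarrow> 'n) \<Rightarrow> ('a set \<Rightarrow> ('a \<Rightarrow> 'n) set) \<Rightarrow> ('k, ('a \<Rightarrow> 'n) \<times> 'a) lie_algebra"
  where "lam_alg K G H M act D =
    (semidirect (Der K (G\<lparr>carrier := H\<rparr>) M act) G (der_action G H M act))
      \<lparr>carrier := {(d, x) \<in> derivations K (G\<lparr>carrier := H\<rparr>) M act \<times> carrier G.
        H1_class K (G\<lparr>carrier := H\<rparr>) M act d = D (H +>\<^bsub>G\<^esub> x)}\<rparr>"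

definition lam_ext ::
    "('k, 'c) ring_scheme \<Rightarrow> ('k, 'a, 'd) lie_algebra_scheme \<Rightarrow> 'a set \<Rightarrow> ('k, 'n, 'e) module_scheme \<Rightarrow>
      ('a \<Rightarrow> 'n \<Rightarrow> 'n) \<Rightarrow> ('a set \<Rightarrow> ('a \<Rightarrow> 'n) set) \<Rightarrow>
      ('k, 'n, 'n \<times> 'a, ('a \<Rightarrow> 'n) \<times> 'a, 'a set) crossed_ext"
  where "lam_ext K G H M act D =
    \<lparr>x_src = semidirect M (G\<lparr>carrier := H\<rparr>) act,
     x_tgt = lam_alg K G H M act D,
     x_act = (\<lambda>(d, x) (m, z). (act x m \<oplus>\<^bsub>M\<^esub> d z, \<lblot>x, z\<rblot>\<^bsub>G\<^esub>)),
     x_incl = (\<lambda>m. (m, \<zero>\<^bsub>G\<^esub>)),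
     x_bnd = (\<lambda>(m, z). (\<ominus>\<^bsub>Der K (G\<lparr>carrier := H\<rparr>) M act\<^esub> inner_der (G\<lparr>carrier := H\<rparr>) act m, z)),
     x_proj = (\<lambda>(d, x). H +>\<^bsub>G\<^esub> x)\<rparr>"

definition lam ::
    "('k, 'c) ring_scheme \<Rightarrow> ('k, 'a, 'd) lie_algebra_scheme \<Rightarrow> 'a set \<Rightarrow> ('k, 'n, 'e) module_scheme \<Rightarrow>
      ('a \<Rightarrow> 'n \<Rightarrow> 'n) \<Rightarrow> ('a set \<Rightarrow> ('a \<Rightarrow> 'n) set) set \<Rightarrow>
      ('a set \<times> 'a set \<times> 'a set \<Rightarrow> 'n) set"
  where "lam K G H M act X = (\<Union>D\<in>X.
    crossed_class K (quot_lie G H) (M\<lparr>carrier := invariants M act H\<rparr>) (inv_action act)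
      (lam_ext K G H M act D))"

end

theory Submission
  imports Defs "HOL-Algebra.Free_Abelian_Groups"
begin

text \<open>The 3-cocycle of a crossed extension is the covariant derivative of the curvature of a linear
  section \<open>\<sigma>\<close>, lifted through the boundary map. If \<open>D\<close> comes from an extension \<open>e\<close> of \<open>G\<close> that splits
  over \<open>H\<close>, the boundary map of the crossed extension of \<open>D\<close> factors through \<open>e\<close>, where this derivative
  vanishes by the Bianchi identity. Conversely, if the class of the cocycle is zero, the lift \<open>f\<close> of
  the curvature can be corrected by a cochain with values in the invariants so that the cocycle itself
  vanishes. Then \<open>(\<sigma>, f)\<close> defines an extension of \<open>G/H\<close> by \<open>M \<rtimes> H\<close>. It is also an extension of
  \<open>G\<close> by \<open>M\<close> which splits over \<open>H\<close> and has \<open>\<rho> = D\<close>.\<close>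

section \<open>Abelian groups and vector spaces\<close>

text \<open>Both maps are unions over choices, so much of the work is to show that each union is a
  single class: for \<open>rho\<close> over the extensions in a class and their splittings, for
  \<open>lam\<close> over the representatives \<open>D\<close>, the linear sections and the lifts of
  the curvature. Linear sections over an arbitrary field come from Zorn's lemma; composing with them
  keeps a lift bilinear and alternating. Two lifts of one curvature differ by a cochain with values
  in the kernel of the boundary map, which is the module of invariants. Hence a change of lift moves
  the cocycle by an ordinary coboundary, and a cocycle of class zero can be made zero without
  touching the curvature. The characteristic is arbitrary, so alternation is checked on repeated
  arguments and not deduced from antisymmetry. The extensions in \<open>H2\<close> have elements of
  type \<open>'n \<times> 'a\<close>, while the algebra found in the converse direction lives on
  triples from \<open>M\<close>, \<open>H\<close> and \<open>G/H\<close>. It is moved to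
  \<open>M \<times> G\<close> by the linear section \<open>t\<close> of the quotient map contained
  in \<open>\<sigma>\<close>, which is why it finally appears as an explicit 2-cocycle of
  \<open>G\<close>.\<close>

definition formal_sum :: "('a, 'c) ring_scheme \<Rightarrow> 'a \<Rightarrow> ('a \<Rightarrow>\<^sub>0 int) \<Rightarrow> bool"
  where "formal_sum A x X \<longleftrightarrow> x \<in> carrier A \<and> Poly_Mapping.keys X \<subseteq> carrier A \<and>
    (\<forall>h\<in>hom (free_Abelian_group (carrier A)) (add_monoid A).
      (\<forall>a\<in>carrier A. h (frag_of a) = a) \<longrightarrow> h X = x)"

context abelian_group
begin

lemma formal_sum_atom: "a \<in> carrier G \<Longrightarrow> formal_sum G a (frag_of a)"
  by (simp add: formal_sum_def)

lemma formal_sum_zero: "formal_sum G \<zero> 0"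
proof -
  have "h 0 = \<zero>" if "h \<in> hom (free_Abelian_group (carrier G)) (add_monoid G)" for h
    using hom_one[OF that group_free_Abelian_group a_group] by simp
  then show ?thesis by (simp add: formal_sum_def)
qed

lemma formal_sum_add:
  assumes "formal_sum G x X" "formal_sum G y Y"
  shows "formal_sum G (x \<oplus> y) (X + Y)"
proof -
  have k: "Poly_Mapping.keys X \<subseteq> carrier G" "Poly_Mapping.keys Y \<subseteq> carrier G"
    using assms by (auto simp: formal_sum_def)
  have "h (X + Y) = h X \<oplus> h Y" if "h \<in> hom (free_Abelian_group (carrier G)) (add_monoid G)" for h
    using hom_mult[OF that, of X Y] k by simp
  then show ?thesis
    using assms k keys_add[of X Y] by (auto simp: formal_sum_def)
qed

lemma formal_sum_uminus:
  assumes "formal_sum G x X"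
  shows "formal_sum G (\<ominus> x) (- X)"
proof -
  have k: "Poly_Mapping.keys X \<subseteq> carrier G"
    using assms by (auto simp: formal_sum_def)
  have "h (- X) = \<ominus> h X" if "h \<in> hom (free_Abelian_group (carrier G)) (add_monoid G)" for h
  proof -
    interpret h: group_hom "free_Abelian_group (carrier G)" "add_monoid G" h
      by (simp add: a_group group_hom.intro group_hom_axioms.intro that)
    show ?thesis using h.hom_inv[of X] k by (simp add: a_inv_def)
  qed
  then show ?thesis
    using assms k by (auto simp: formal_sum_def)
qed

lemma formal_sum_minus:
  "formal_sum G x X \<Longrightarrow> formal_sum G y Y \<Longrightarrow> formal_sum G (x \<ominus> y) (X - Y)"
  unfolding a_minus_def diff_conv_add_uminus[of X Y]
  by (intro formal_sum_add formal_sum_uminus)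

text \<open>Syntax-directed in the first argument: from a goal with known \<open>x\<close> and
  schematic \<open>X\<close>, resolution with these rules, and with \<open>formal_sum_atom\<close>
  as fallback, builds the formal sum.\<close>

lemmas formal_sum_intros = formal_sum_add formal_sum_minus formal_sum_uminus formal_sum_zero

text \<open>Reduces an identity between signed sums in \<open>G\<close> to the same identity in the free abelian group
  on the carrier, a type of class \<open>ab_group_add\<close> where \<open>algebra_simps\<close> decides it.\<close>

lemma formal_sum_eqI:
  assumes "formal_sum G x X" "formal_sum G y Y" "X = Y"
  shows "x = y"
proof -
  \<comment> \<open>Only here is an evaluation map needed. The definition quantifies over all of
    them, so the closure rules never have to produce one.\<close>
  obtain h where "h \<in> hom (free_Abelian_group (carrier G)) (add_monoid G)"
    "\<And>a. a \<in> carrier G \<Longrightarrow> h (frag_of a) = a"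
    using comm_group.free_Abelian_group_universal[OF a_comm_group, of "\<lambda>a. a" "carrier G"] by auto
  then show ?thesis using assms by (auto simp: formal_sum_def)
qed

lemma minus_eq_zero_iff: "x \<in> carrier G \<Longrightarrow> y \<in> carrier G \<Longrightarrow> x \<ominus> y = \<zero> \<longleftrightarrow> x = y"
  by (metis minus_equality minus_minus a_minus_def r_neg a_inv_closed)

lemma eq_minus_iff: "x \<in> carrier G \<Longrightarrow> y \<in> carrier G \<Longrightarrow> z \<in> carrier G \<Longrightarrow> x = y \<ominus> z \<longleftrightarrow> x \<oplus> z = y"
  by (metis (no_types, opaque_lifting) a_assoc a_inv_closed a_minus_def l_neg r_neg r_zero)

lemma a_inv_zero [simp]: "\<ominus> \<zero> = \<zero>"
  by (simp add: minus_equality)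

lemma minus_zero_right [simp]: "x \<in> carrier G \<Longrightarrow> x \<ominus> \<zero> = x"
  by (simp add: a_minus_def)

lemma minus_self [simp]: "x \<in> carrier G \<Longrightarrow> x \<ominus> x = \<zero>"
  by (simp add: minus_eq_zero_iff)

end

text \<open>\<open>a_inv\<close> depends on the whole record, its carrier included, so the inverse
  in a substructure is a priori a different function; uniqueness of inverses identifies the
  two.\<close>

lemma abelian_group_a_inv_cong:
  assumes "abelian_group A" "abelian_group B" "carrier B \<subseteq> carrier A"
    "add B = add A" "\<zero>\<^bsub>B\<^esub> = \<zero>\<^bsub>A\<^esub>" "x \<in> carrier B"
  shows "\<ominus>\<^bsub>B\<^esub> x = \<ominus>\<^bsub>A\<^esub> x"
proof -
  interpret A: abelian_group A by fact
  interpret B: abelian_group B by fact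
  have "\<ominus>\<^bsub>B\<^esub> x \<oplus>\<^bsub>A\<^esub> x = \<zero>\<^bsub>A\<^esub>"
    using B.l_neg assms by metis
  then show ?thesis
    using A.minus_equality assms B.a_inv_closed by (metis subsetD)
qed

lemma a_minus_cong:
  assumes "abelian_group A" "abelian_group B" "carrier B \<subseteq> carrier A"
    "add B = add A" "\<zero>\<^bsub>B\<^esub> = \<zero>\<^bsub>A\<^esub>" "y \<in> carrier B"
  shows "x \<ominus>\<^bsub>B\<^esub> y = x \<ominus>\<^bsub>A\<^esub> y"
  using abelian_group_a_inv_cong[OF assms] assms(4) by (simp add: a_minus_def)

section \<open>Linear maps, their sections and lifts\<close>

lemma lin_homD:
  assumes "f \<in> lin_hom K V W"
  shows "\<And>x. x \<in> carrier V \<Longrightarrow> f x \<in> carrier W"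
    "\<And>x y. x \<in> carrier V \<Longrightarrow> y \<in> carrier V \<Longrightarrow> f (x \<oplus>\<^bsub>V\<^esub> y) = f x \<oplus>\<^bsub>W\<^esub> f y"
    "\<And>a x. a \<in> carrier K \<Longrightarrow> x \<in> carrier V \<Longrightarrow> f (a \<odot>\<^bsub>V\<^esub> x) = a \<odot>\<^bsub>W\<^esub> f x"
  using assms by (auto simp: lin_hom_def)

lemma lin_homI:
  assumes "\<And>x. x \<in> carrier V \<Longrightarrow> f x \<in> carrier W"
    "\<And>x y. x \<in> carrier V \<Longrightarrow> y \<in> carrier V \<Longrightarrow> f (x \<oplus>\<^bsub>V\<^esub> y) = f x \<oplus>\<^bsub>W\<^esub> f y"
    "\<And>a x. a \<in> carrier K \<Longrightarrow> x \<in> carrier V \<Longrightarrow> f (a \<odot>\<^bsub>V\<^esub> x) = a \<odot>\<^bsub>W\<^esub> f x"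
  shows "f \<in> lin_hom K V W"
  using assms by (auto simp: lin_hom_def)

text \<open>Meant for brackets and actions with one argument fixed, which are additive without being
  presented as elements of \<open>lin_hom\<close>.\<close>

lemma additive_map:
  assumes "abelian_group V" "abelian_group W"
    and f: "\<And>x. x \<in> carrier V \<Longrightarrow> f x \<in> carrier W"
    "\<And>x y. x \<in> carrier V \<Longrightarrow> y \<in> carrier V \<Longrightarrow> f (x \<oplus>\<^bsub>V\<^esub> y) = f x \<oplus>\<^bsub>W\<^esub> f y"
  shows "f \<zero>\<^bsub>V\<^esub> = \<zero>\<^bsub>W\<^esub>"
    "x \<in> carrier V \<Longrightarrow> f (\<ominus>\<^bsub>V\<^esub> x) = \<ominus>\<^bsub>W\<^esub> f x"
    "x \<in> carrier V \<Longrightarrow> y \<in> carrier V \<Longrightarrow> f (x \<ominus>\<^bsub>V\<^esub> y) = f x \<ominus>\<^bsub>W\<^esub> f y"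
proof -
  interpret V: abelian_group V by fact
  interpret W: abelian_group W by fact
  interpret group_hom "add_monoid V" "add_monoid W" f
    by unfold_locales (auto simp: hom_def f)
  show zero: "f \<zero>\<^bsub>V\<^esub> = \<zero>\<^bsub>W\<^esub>" using hom_one by simp
  show neg: "f (\<ominus>\<^bsub>V\<^esub> x) = \<ominus>\<^bsub>W\<^esub> f x" if "x \<in> carrier V" for x
    using hom_inv[of x] that by (simp add: a_inv_def)
  show "f (x \<ominus>\<^bsub>V\<^esub> y) = f x \<ominus>\<^bsub>W\<^esub> f y" if "x \<in> carrier V" "y \<in> carrier V"
    using that by (simp add: a_minus_def f neg)
qed

lemma lin_hom_additive:
  assumes "module K V" "module K W" "f \<in> lin_hom K V W"
  shows "f \<zero>\<^bsub>V\<^esub> = \<zero>\<^bsub>W\<^esub>"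
    "x \<in> carrier V \<Longrightarrow> f (\<ominus>\<^bsub>V\<^esub> x) = \<ominus>\<^bsub>W\<^esub> f x"
    "x \<in> carrier V \<Longrightarrow> y \<in> carrier V \<Longrightarrow> f (x \<ominus>\<^bsub>V\<^esub> y) = f x \<ominus>\<^bsub>W\<^esub> f y"
  using additive_map[OF module.axioms(2)[OF assms(1)] module.axioms(2)[OF assms(2)], of f]
    lin_homD[OF assms(3)] by auto

lemma lin_hom_comp:
  "f \<in> lin_hom K V W \<Longrightarrow> g \<in> lin_hom K W U \<Longrightarrow> (\<lambda>x. g (f x)) \<in> lin_hom K V U"
  by (auto simp: lin_hom_def Pi_iff)

lemma (in module) a_kernelI: "a_kernel M W f = {x \<in> carrier M. f x = \<zero>\<^bsub>W\<^esub>}"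
  by (simp add: a_kernel_def kernel_def)

lemma (in module) lin_hom_minus_closed:
  assumes "module R V" "f \<in> lin_hom R V M" "g \<in> lin_hom R V M"
  shows "(\<lambda>x. f x \<ominus>\<^bsub>M\<^esub> g x) \<in> lin_hom R V M"
proof (rule lin_homI)
  interpret V: module R V by fact
  note [simp] = lin_homD[OF assms(2)] lin_homD[OF assms(3)]
  show "f (x \<oplus>\<^bsub>V\<^esub> y) \<ominus>\<^bsub>M\<^esub> g (x \<oplus>\<^bsub>V\<^esub> y) = f x \<ominus>\<^bsub>M\<^esub> g x \<oplus>\<^bsub>M\<^esub> (f y \<ominus>\<^bsub>M\<^esub> g y)"
    if "x \<in> carrier V" "y \<in> carrier V" for x y
    apply (insert that, simp)
    by (rule M.formal_sum_eqI, (rule M.formal_sum_intros | (rule M.formal_sum_atom, simp))+, simp add: algebra_simps)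
  show "f (a \<odot>\<^bsub>V\<^esub> x) \<ominus>\<^bsub>M\<^esub> g (a \<odot>\<^bsub>V\<^esub> x) = a \<odot>\<^bsub>M\<^esub> (f x \<ominus>\<^bsub>M\<^esub> g x)" if "a \<in> carrier R" "x \<in> carrier V" for a x
    using that by (simp add: a_minus_def smult_r_distr smult_r_minus)
  show "\<And>x. x \<in> carrier V \<Longrightarrow> f x \<ominus>\<^bsub>M\<^esub> g x \<in> carrier M" by simp
qed

lemma (in module) submodule_is_module: "submodule U R M \<Longrightarrow> module R (M\<lparr>carrier := U\<rparr>)"
  by (simp add: submodule.submodule_is_module module_axioms)

text \<open>By Zorn's lemma there is a subspace \<open>C\<close> of \<open>V\<close> that is maximal
  among those meeting the kernel of \<open>p\<close> only in zero. It is a complement of the kernel: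
  \<open>p\<close> maps \<open>C\<close> bijectively onto the image of \<open>p\<close>, and the
  inverse is the section.\<close>

lemma linear_section:
  assumes "field K" "module K V" "module K W" and p: "p \<in> lin_hom K V W"
  obtains s where "s \<in> lin_hom K (W\<lparr>carrier := p ` carrier V\<rparr>) V"
    "\<And>w. w \<in> p ` carrier V \<Longrightarrow> p (s w) = w"
proof -
  interpret K: field K by fact
  interpret V: module K V by fact
  interpret W: module K W by fact
  note p_hom = lin_homD[OF p] lin_hom_additive[OF assms(2,3) p]
  define \<A> where "\<A> = {C. submodule C K V \<and> (\<forall>c\<in>C. p c = \<zero>\<^bsub>W\<^esub> \<longrightarrow> c = \<zero>\<^bsub>V\<^esub>)}"
  have "\<A> \<noteq> {}"
  proof -
    have "submodule {\<zero>\<^bsub>V\<^esub>} K V" by (rule V.submoduleI) auto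
    then show ?thesis by (auto simp: \<A>_def)
  qed
  moreover have "\<Union>\<C> \<in> \<A>" if ch: "\<C> \<noteq> {}" "subset.chain \<A> \<C>" for \<C>
  proof -
    have sub: "\<And>C. C \<in> \<C> \<Longrightarrow> submodule C K V"
      using ch by (auto simp: subset.chain_def \<A>_def)
    have "submodule (\<Union>\<C>) K V"
    proof (rule V.submoduleI)
      show "\<Union>\<C> \<subseteq> carrier V" using V.submoduleE(1)[OF sub] by blast
      obtain C where C: "C \<in> \<C>" using ch(1) by blast
      show "\<zero>\<^bsub>V\<^esub> \<in> \<Union>\<C>"
        using C subgroup.one_closed[OF submodule.axioms(1)[OF sub[OF C]]] by auto
      show "\<ominus>\<^bsub>V\<^esub> a \<in> \<Union>\<C>" if "a \<in> \<Union>\<C>" for a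
        using that V.submoduleE(3)[OF sub] by blast
      show "a \<oplus>\<^bsub>V\<^esub> b \<in> \<Union>\<C>" if ab: "a \<in> \<Union>\<C>" "b \<in> \<Union>\<C>" for a b
      proof -
        obtain A B where "A \<in> \<C>" "B \<in> \<C>" "a \<in> A" "b \<in> B" using ab by blast
        moreover have "A \<subseteq> B \<or> B \<subseteq> A"
          using ch(2) calculation by (auto simp: subset.chain_def)
        ultimately show ?thesis using V.submoduleE(5)[OF sub] by blast
      qed
      show "a \<odot>\<^bsub>V\<^esub> x \<in> \<Union>\<C>" if "a \<in> carrier K" "x \<in> \<Union>\<C>" for a x
        using that V.submoduleE(4)[OF sub] by blast
    qed
    then show ?thesis using ch by (auto simp: \<A>_def subset.chain_def)
  qed
  ultimately obtain C where C: "C \<in> \<A>" and max: "\<And>X. X \<in> \<A> \<Longrightarrow> C \<subseteq> X \<Longrightarrow> X = C"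
    using subset_Zorn_nonempty[of \<A>] by blast
  have sub: "submodule C K V" and ker: "\<And>c. c \<in> C \<Longrightarrow> p c = \<zero>\<^bsub>W\<^esub> \<Longrightarrow> c = \<zero>\<^bsub>V\<^esub>"
    using C by (auto simp: \<A>_def)
  note C_closed = V.submoduleE(3-5)[OF sub]
  have C_V [simp]: "c \<in> carrier V" if "c \<in> C" for c using V.submoduleE(1)[OF sub] that by blast
  have C_zero: "\<zero>\<^bsub>V\<^esub> \<in> C" using subgroup.one_closed[OF submodule.axioms(1)[OF sub]] by simp
  have onto: "\<exists>c\<in>C. p c = p v" if v: "v \<in> carrier V" for v
  proof (rule ccontr)
    assume neg: "\<not> (\<exists>c\<in>C. p c = p v)"
    \<comment> \<open>If \<open>p v\<close> had no preimage in \<open>C\<close>, the span of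
      \<open>C\<close> and \<open>v\<close> would still meet the kernel only in zero, against
      maximality.\<close>
    define C' where "C' = {c \<oplus>\<^bsub>V\<^esub> a \<odot>\<^bsub>V\<^esub> v | c a. c \<in> C \<and> a \<in> carrier K}"
    have "submodule C' K V"
    proof (rule V.submoduleI)
      show "C' \<subseteq> carrier V" using v by (auto simp: C'_def)
      have "\<zero>\<^bsub>V\<^esub> = \<zero>\<^bsub>V\<^esub> \<oplus>\<^bsub>V\<^esub> \<zero>\<^bsub>K\<^esub> \<odot>\<^bsub>V\<^esub> v" using v by simp
      then show "\<zero>\<^bsub>V\<^esub> \<in> C'" using C_zero unfolding C'_def by blast
      fix x assume "x \<in> C'"
      then obtain c a where x: "x = c \<oplus>\<^bsub>V\<^esub> a \<odot>\<^bsub>V\<^esub> v" "c \<in> C" "a \<in> carrier K"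
        by (auto simp: C'_def)
      have "\<ominus>\<^bsub>V\<^esub> x = (\<ominus>\<^bsub>V\<^esub> c) \<oplus>\<^bsub>V\<^esub> (\<ominus>\<^bsub>K\<^esub> a) \<odot>\<^bsub>V\<^esub> v"
        using x v by (simp add: V.minus_add V.smult_l_minus)
      then show "\<ominus>\<^bsub>V\<^esub> x \<in> C'"
        using C_closed(1) x unfolding C'_def by blast
      show "k \<odot>\<^bsub>V\<^esub> x \<in> C'" if k: "k \<in> carrier K" for k
      proof -
        have "k \<odot>\<^bsub>V\<^esub> x = k \<odot>\<^bsub>V\<^esub> c \<oplus>\<^bsub>V\<^esub> (k \<otimes>\<^bsub>K\<^esub> a) \<odot>\<^bsub>V\<^esub> v"
          using x v k by (simp add: V.smult_r_distr V.smult_assoc1)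
        then show ?thesis using C_closed(2) x k unfolding C'_def by blast
      qed
      show "x \<oplus>\<^bsub>V\<^esub> y \<in> C'" if y': "y \<in> C'" for y
      proof -
        obtain d b where y: "y = d \<oplus>\<^bsub>V\<^esub> b \<odot>\<^bsub>V\<^esub> v" "d \<in> C" "b \<in> carrier K"
          using y' by (auto simp: C'_def)
        have "x \<oplus>\<^bsub>V\<^esub> y = (c \<oplus>\<^bsub>V\<^esub> d) \<oplus>\<^bsub>V\<^esub> (a \<oplus>\<^bsub>K\<^esub> b) \<odot>\<^bsub>V\<^esub> v"
          using x y v by (simp add: V.smult_l_distr V.M.a_ac)
        then show ?thesis using C_closed(3) x y unfolding C'_def by blast
      qed
    qed
    moreover have "x = \<zero>\<^bsub>V\<^esub>" if x': "x \<in> C'" "p x = \<zero>\<^bsub>W\<^esub>" for x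
    proof -
      obtain c a where x: "x = c \<oplus>\<^bsub>V\<^esub> a \<odot>\<^bsub>V\<^esub> v" "c \<in> C" "a \<in> carrier K"
        using x'(1) by (auto simp: C'_def)
      have eq: "p c \<oplus>\<^bsub>W\<^esub> a \<odot>\<^bsub>W\<^esub> p v = \<zero>\<^bsub>W\<^esub>" using x'(2) x v by (simp add: p_hom)
      show ?thesis
      proof (cases "a = \<zero>\<^bsub>K\<^esub>")
        case True
        then show ?thesis using eq x v ker[of c] by (simp add: p_hom)
      next
        case False
        \<comment> \<open>An element \<open>c + a v\<close> of the kernel with \<open>a\<close>
          nonzero would make \<open>b (- c)\<close> a preimage of \<open>p v\<close> in
          \<open>C\<close>.\<close>
        define b where "b = inv\<^bsub>K\<^esub> a"
        have b: "b \<in> carrier K" "b \<otimes>\<^bsub>K\<^esub> a = \<one>\<^bsub>K\<^esub>"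
          using K.field_Units x(3) False K.Units_inv_closed[of a] K.Units_l_inv[of a]
          by (auto simp: b_def)
        have "a \<odot>\<^bsub>W\<^esub> p v = \<ominus>\<^bsub>W\<^esub> p c"
          using eq x v by (metis C_V W.minus_equality W.minus_minus W.smult_closed p_hom(1))
        then have "(b \<otimes>\<^bsub>K\<^esub> a) \<odot>\<^bsub>W\<^esub> p v = b \<odot>\<^bsub>W\<^esub> (\<ominus>\<^bsub>W\<^esub> p c)"
          using b(1) x v by (simp add: W.smult_assoc1 p_hom)
        moreover have "(b \<otimes>\<^bsub>K\<^esub> a) \<odot>\<^bsub>W\<^esub> p v = p v" using b v by (simp add: p_hom)
        moreover have "b \<odot>\<^bsub>W\<^esub> (\<ominus>\<^bsub>W\<^esub> p c) = p (b \<odot>\<^bsub>V\<^esub> (\<ominus>\<^bsub>V\<^esub> c))" using b x by (simp add: p_hom)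
        ultimately have "p v = p (b \<odot>\<^bsub>V\<^esub> (\<ominus>\<^bsub>V\<^esub> c))" by simp
        then show ?thesis using neg C_closed b x by metis
      qed
    qed
    ultimately have "C' \<in> \<A>" by (auto simp: \<A>_def)
    moreover have "C \<subseteq> C'"
    proof
      fix c assume c: "c \<in> C"
      then have "c = c \<oplus>\<^bsub>V\<^esub> \<zero>\<^bsub>K\<^esub> \<odot>\<^bsub>V\<^esub> v" using v by simp
      then show "c \<in> C'" using c unfolding C'_def by blast
    qed
    ultimately have "C' = C" by (rule max)
    moreover have "v = \<zero>\<^bsub>V\<^esub> \<oplus>\<^bsub>V\<^esub> \<one>\<^bsub>K\<^esub> \<odot>\<^bsub>V\<^esub> v" using v by simp
    then have "v \<in> C'" using C_zero unfolding C'_def by blast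
    ultimately show False using neg by blast
  qed
  have inj: "c = d" if "c \<in> C" "d \<in> C" "p c = p d" for c d
  proof -
    have "c \<ominus>\<^bsub>V\<^esub> d = \<zero>\<^bsub>V\<^esub>"
      using that by (intro ker) (auto simp: a_minus_def C_closed p_hom W.r_neg)
    then show ?thesis using that by (simp add: V.minus_eq_zero_iff)
  qed
  define s where "s w = (SOME c. c \<in> C \<and> p c = w)" for w
  have s: "s w \<in> C" "p (s w) = w" if "w \<in> p ` carrier V" for w
  proof -
    have "\<exists>c. c \<in> C \<and> p c = w" using onto that by auto
    then have "s w \<in> C \<and> p (s w) = w" unfolding s_def by (rule someI_ex)
    then show "s w \<in> C" "p (s w) = w" by auto
  qed
  have add: "w \<oplus>\<^bsub>W\<^esub> w' \<in> p ` carrier V" if "w \<in> p ` carrier V" "w' \<in> p ` carrier V" for w w'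
    using that by (auto simp: p_hom(2)[symmetric])
  have smult: "a \<odot>\<^bsub>W\<^esub> w \<in> p ` carrier V" if "w \<in> p ` carrier V" "a \<in> carrier K" for w a
    using that by (auto simp: p_hom(3)[symmetric])
  have "s \<in> lin_hom K (W\<lparr>carrier := p ` carrier V\<rparr>) V"
  proof (rule lin_homI)
    fix x y a
    assume x: "x \<in> carrier (W\<lparr>carrier := p ` carrier V\<rparr>)"
    then show "s x \<in> carrier V" using s by simp
    show "s (x \<oplus>\<^bsub>W\<lparr>carrier := p ` carrier V\<rparr>\<^esub> y) = s x \<oplus>\<^bsub>V\<^esub> s y"
      if "y \<in> carrier (W\<lparr>carrier := p ` carrier V\<rparr>)"
      using that x add[of x y] by simp (rule inj, auto simp: s C_closed p_hom)
    show "s (a \<odot>\<^bsub>W\<lparr>carrier := p ` carrier V\<rparr>\<^esub> x) = a \<odot>\<^bsub>V\<^esub> s x" if "a \<in> carrier K"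
      using that x smult[of x a] by simp (rule inj, auto simp: s C_closed p_hom)
  qed
  then show thesis using that s(2) by blast
qed

lemma linear_lift:
  assumes "field K" "module K V" "module K W" "p \<in> lin_hom K V W"
    and g: "g \<in> lin_hom K U W" "g ` carrier U \<subseteq> p ` carrier V"
  obtains h where "h \<in> lin_hom K U V" "\<And>u. u \<in> carrier U \<Longrightarrow> p (h u) = g u"
proof -
  obtain s where s: "s \<in> lin_hom K (W\<lparr>carrier := p ` carrier V\<rparr>) V"
    "\<And>w. w \<in> p ` carrier V \<Longrightarrow> p (s w) = w"
    using linear_section[OF assms(1-4)] by blast
  have "g \<in> lin_hom K U (W\<lparr>carrier := p ` carrier V\<rparr>)"
    using g by (auto simp: lin_hom_def)
  then have "(\<lambda>u. s (g u)) \<in> lin_hom K U V" using s(1) by (rule lin_hom_comp)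
  then show thesis using that s(2) g(2) by blast
qed

section \<open>Alternating bilinear maps\<close>

lemma alt_bilinearD:
  assumes "b \<in> alt_bilinear K L N"
  shows "\<And>x y. x \<in> carrier L \<Longrightarrow> y \<in> carrier L \<Longrightarrow> b (x, y) \<in> carrier N"
    "\<And>x y z. x \<in> carrier L \<Longrightarrow> y \<in> carrier L \<Longrightarrow> z \<in> carrier L \<Longrightarrow>
      b (x \<oplus>\<^bsub>L\<^esub> y, z) = b (x, z) \<oplus>\<^bsub>N\<^esub> b (y, z)"
    "\<And>x y z. x \<in> carrier L \<Longrightarrow> y \<in> carrier L \<Longrightarrow> z \<in> carrier L \<Longrightarrow>
      b (x, y \<oplus>\<^bsub>L\<^esub> z) = b (x, y) \<oplus>\<^bsub>N\<^esub> b (x, z)"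
    "\<And>a x y. a \<in> carrier K \<Longrightarrow> x \<in> carrier L \<Longrightarrow> y \<in> carrier L \<Longrightarrow>
      b (a \<odot>\<^bsub>L\<^esub> x, y) = a \<odot>\<^bsub>N\<^esub> b (x, y)"
    "\<And>a x y. a \<in> carrier K \<Longrightarrow> x \<in> carrier L \<Longrightarrow> y \<in> carrier L \<Longrightarrow>
      b (x, a \<odot>\<^bsub>L\<^esub> y) = a \<odot>\<^bsub>N\<^esub> b (x, y)"
    "\<And>x. x \<in> carrier L \<Longrightarrow> b (x, x) = \<zero>\<^bsub>N\<^esub>"
  using assms by (auto simp: alt_bilinear_def lin_hom_def)

lemma alt_bilinearI:
  assumes "b \<in> extensional (carrier L \<times> carrier L)"
    "\<And>x y. x \<in> carrier L \<Longrightarrow> y \<in> carrier L \<Longrightarrow> b (x, y) \<in> carrier N"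
    "\<And>x y z. x \<in> carrier L \<Longrightarrow> y \<in> carrier L \<Longrightarrow> z \<in> carrier L \<Longrightarrow>
      b (x \<oplus>\<^bsub>L\<^esub> y, z) = b (x, z) \<oplus>\<^bsub>N\<^esub> b (y, z)"
    "\<And>x y z. x \<in> carrier L \<Longrightarrow> y \<in> carrier L \<Longrightarrow> z \<in> carrier L \<Longrightarrow>
      b (x, y \<oplus>\<^bsub>L\<^esub> z) = b (x, y) \<oplus>\<^bsub>N\<^esub> b (x, z)"
    "\<And>a x y. a \<in> carrier K \<Longrightarrow> x \<in> carrier L \<Longrightarrow> y \<in> carrier L \<Longrightarrow>
      b (a \<odot>\<^bsub>L\<^esub> x, y) = a \<odot>\<^bsub>N\<^esub> b (x, y)"
    "\<And>a x y. a \<in> carrier K \<Longrightarrow> x \<in> carrier L \<Longrightarrow> y \<in> carrier L \<Longrightarrow>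
      b (x, a \<odot>\<^bsub>L\<^esub> y) = a \<odot>\<^bsub>N\<^esub> b (x, y)"
    "\<And>x. x \<in> carrier L \<Longrightarrow> b (x, x) = \<zero>\<^bsub>N\<^esub>"
  shows "b \<in> alt_bilinear K L N"
  using assms by (auto simp: alt_bilinear_def lin_hom_def PiE_def)

lemma alt_bilinear_antisym:
  assumes "module K L" "module K N" "b \<in> alt_bilinear K L N" "x \<in> carrier L" "y \<in> carrier L"
  shows "b (x, y) = \<ominus>\<^bsub>N\<^esub> b (y, x)"
proof -
  interpret L: module K L by fact
  interpret N: module K N by fact
  note b = alt_bilinearD[OF assms(3)]
  have "b (x \<oplus>\<^bsub>L\<^esub> y, x \<oplus>\<^bsub>L\<^esub> y) = \<zero>\<^bsub>N\<^esub>" using assms by (simp add: b)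
  then have "b (x, y) \<oplus>\<^bsub>N\<^esub> b (y, x) = \<zero>\<^bsub>N\<^esub>"
    using assms(4,5) by (simp add: b(1-5)) (simp add: b N.M.a_comm)
  then show ?thesis using assms(4,5) by (simp add: b N.minus_equality N.M.a_comm)
qed

lemma alt_bilinear_additive:
  assumes "module K L" "module K N" "b \<in> alt_bilinear K L N" "x \<in> carrier L"
  shows "b (\<zero>\<^bsub>L\<^esub>, x) = \<zero>\<^bsub>N\<^esub>" "b (x, \<zero>\<^bsub>L\<^esub>) = \<zero>\<^bsub>N\<^esub>"
    "y \<in> carrier L \<Longrightarrow> b (\<ominus>\<^bsub>L\<^esub> y, x) = \<ominus>\<^bsub>N\<^esub> b (y, x)"
    "y \<in> carrier L \<Longrightarrow> b (x, \<ominus>\<^bsub>L\<^esub> y) = \<ominus>\<^bsub>N\<^esub> b (x, y)"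
    "y \<in> carrier L \<Longrightarrow> z \<in> carrier L \<Longrightarrow> b (y \<ominus>\<^bsub>L\<^esub> z, x) = b (y, x) \<ominus>\<^bsub>N\<^esub> b (z, x)"
    "y \<in> carrier L \<Longrightarrow> z \<in> carrier L \<Longrightarrow> b (x, y \<ominus>\<^bsub>L\<^esub> z) = b (x, y) \<ominus>\<^bsub>N\<^esub> b (x, z)"
proof -
  have "(\<lambda>y. b (x, y)) \<in> lin_hom K L N" "(\<lambda>y. b (y, x)) \<in> lin_hom K L N"
    using assms(3,4) by (auto simp: alt_bilinear_def)
  note lin_hom_additive[OF assms(1,2) this(1)] lin_hom_additive[OF assms(1,2) this(2)]
  then show "b (\<zero>\<^bsub>L\<^esub>, x) = \<zero>\<^bsub>N\<^esub>" "b (x, \<zero>\<^bsub>L\<^esub>) = \<zero>\<^bsub>N\<^esub>"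
    "y \<in> carrier L \<Longrightarrow> b (\<ominus>\<^bsub>L\<^esub> y, x) = \<ominus>\<^bsub>N\<^esub> b (y, x)"
    "y \<in> carrier L \<Longrightarrow> b (x, \<ominus>\<^bsub>L\<^esub> y) = \<ominus>\<^bsub>N\<^esub> b (x, y)"
    "y \<in> carrier L \<Longrightarrow> z \<in> carrier L \<Longrightarrow> b (y \<ominus>\<^bsub>L\<^esub> z, x) = b (y, x) \<ominus>\<^bsub>N\<^esub> b (z, x)"
    "y \<in> carrier L \<Longrightarrow> z \<in> carrier L \<Longrightarrow> b (x, y \<ominus>\<^bsub>L\<^esub> z) = b (x, y) \<ominus>\<^bsub>N\<^esub> b (x, z)"
    by auto
qed

text \<open>Values of \<open>f\<close> chosen pointwise would not be bilinear; composing
  \<open>b\<close> with one linear section of \<open>p\<close> keeps bilinearity and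
  alternation.\<close>

lemma alt_bilinear_lift:
  assumes "field K" "module K V" "module K W" "p \<in> lin_hom K V W"
    and L: "module K L"
    and b: "b \<in> alt_bilinear K L W" "b ` (carrier L \<times> carrier L) \<subseteq> p ` carrier V"
  obtains f where "f \<in> alt_bilinear K L V"
    "\<And>x y. x \<in> carrier L \<Longrightarrow> y \<in> carrier L \<Longrightarrow> p (f (x, y)) = b (x, y)"
proof -
  interpret L: module K L by fact
  interpret V: module K V by fact
  interpret W: module K W by fact
  obtain s where s: "s \<in> lin_hom K (W\<lparr>carrier := p ` carrier V\<rparr>) V"
    "\<And>w. w \<in> p ` carrier V \<Longrightarrow> p (s w) = w"
    using linear_section[OF assms(1-4)] by blast
  have s_hom: "w \<in> p ` carrier V \<Longrightarrow> s w \<in> carrier V"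
    "w \<in> p ` carrier V \<Longrightarrow> w' \<in> p ` carrier V \<Longrightarrow> s (w \<oplus>\<^bsub>W\<^esub> w') = s w \<oplus>\<^bsub>V\<^esub> s w'"
    "a \<in> carrier K \<Longrightarrow> w \<in> p ` carrier V \<Longrightarrow> s (a \<odot>\<^bsub>W\<^esub> w) = a \<odot>\<^bsub>V\<^esub> s w" for w w' a
    using lin_homD[OF s(1)] by auto
  \<comment> \<open>The image of \<open>p\<close> with the operations of \<open>W\<close> has not
    been established as a module, so the value at zero is cancelled out of additivity.\<close>
  have s_zero: "s \<zero>\<^bsub>W\<^esub> = \<zero>\<^bsub>V\<^esub>"
  proof -
    have z: "\<zero>\<^bsub>W\<^esub> \<in> p ` carrier V"
      using lin_hom_additive(1)[OF assms(2-4)] V.M.zero_closed by force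
    then have "s (\<zero>\<^bsub>W\<^esub> \<oplus>\<^bsub>W\<^esub> \<zero>\<^bsub>W\<^esub>) = s \<zero>\<^bsub>W\<^esub> \<oplus>\<^bsub>V\<^esub> s \<zero>\<^bsub>W\<^esub>" by (intro s_hom)
    then show ?thesis using s_hom(1)[OF z] by (metis V.M.add.r_cancel_one' W.M.l_zero W.M.zero_closed)
  qed
  note bD = alt_bilinearD[OF b(1)]
  have im [simp]: "b (x, y) \<in> p ` carrier V" if "x \<in> carrier L" "y \<in> carrier L" for x y
    using b(2) that by blast
  define f where "f = (\<lambda>t\<in>carrier L \<times> carrier L. s (b t))"
  have "f \<in> alt_bilinear K L V"
    by (rule alt_bilinearI) (auto simp: f_def bD s_hom s_zero)
  then show thesis using that s(2) by (auto simp: f_def)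
qed

section \<open>Quotients and function spaces\<close>

locale quotient_space = module K V for K (structure) and V (structure) +
  fixes U and W
  assumes sub: "submodule U K V"
    and carrier_quot: "carrier W = a_rcosets\<^bsub>V\<^esub> U"
    and zero_quot: "\<zero>\<^bsub>W\<^esub> = U"
    and add_quot: "add W = set_add V"
    and smult_quot: "smult W = (\<lambda>a X. \<Union>x\<in>X. U +>\<^bsub>V\<^esub> (a \<odot>\<^bsub>V\<^esub> x))"
begin

sublocale U: abelian_subgroup U V
  using sub by (intro abelian_subgroupI3 additive_subgroupI abelian_group_axioms)
    (simp add: submodule_def)

lemma U_closed [simp]:
  "\<And>x. x \<in> U \<Longrightarrow> x \<in> carrier V" "\<zero>\<^bsub>V\<^esub> \<in> U"
  "\<And>x y. x \<in> U \<Longrightarrow> y \<in> U \<Longrightarrow> x \<oplus>\<^bsub>V\<^esub> y \<in> U"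
  "\<And>x. x \<in> U \<Longrightarrow> \<ominus>\<^bsub>V\<^esub> x \<in> U" "\<And>a x. a \<in> carrier K \<Longrightarrow> x \<in> U \<Longrightarrow> a \<odot>\<^bsub>V\<^esub> x \<in> U"
  using U.a_subset sub by (auto simp: submodule.smult_closed)

lemma coset_def': "U +>\<^bsub>V\<^esub> x = {u \<oplus>\<^bsub>V\<^esub> x | u. u \<in> U}"
  by (auto simp: a_r_coset_def r_coset_def)

lemma coset_eqI: "u \<in> U \<Longrightarrow> x \<in> carrier V \<Longrightarrow> U +>\<^bsub>V\<^esub> (u \<oplus>\<^bsub>V\<^esub> x) = U +>\<^bsub>V\<^esub> x"
  using U.a_repr_independence'[of "u \<oplus>\<^bsub>V\<^esub> x" x] by (auto simp: coset_def')

lemma coset_eq_iff: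
  assumes "x \<in> carrier V" "y \<in> carrier V"
  shows "U +>\<^bsub>V\<^esub> x = U +>\<^bsub>V\<^esub> y \<longleftrightarrow> x \<ominus>\<^bsub>V\<^esub> y \<in> U"
proof
  assume "U +>\<^bsub>V\<^esub> x = U +>\<^bsub>V\<^esub> y"
  then have "x \<in> U +>\<^bsub>V\<^esub> y" using U.a_rcos_self assms by blast
  then show "x \<ominus>\<^bsub>V\<^esub> y \<in> U" using U.a_rcos_module_imp assms by (simp add: a_minus_def)
next
  assume "x \<ominus>\<^bsub>V\<^esub> y \<in> U"
  moreover have "x = (x \<ominus>\<^bsub>V\<^esub> y) \<oplus>\<^bsub>V\<^esub> y"
    using assms by (simp add: a_minus_def M.a_assoc M.l_neg)
  ultimately show "U +>\<^bsub>V\<^esub> x = U +>\<^bsub>V\<^esub> y" using coset_eqI[of "x \<ominus>\<^bsub>V\<^esub> y" y] assms by simp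
qed

lemma coset_eq_zero_iff: "x \<in> carrier V \<Longrightarrow> U +>\<^bsub>V\<^esub> x = U \<longleftrightarrow> x \<in> U"
  using M.a_coset_join1 M.a_coset_join2 U.a_subgroup by blast

text \<open>Evaluates the unions over representatives that define operations on a quotient:
  invariance under translation by \<open>U\<close> makes such a union collapse to its value at one
  representative.\<close>

lemma coset_UN:
  assumes "x \<in> carrier V" "\<And>u. u \<in> U \<Longrightarrow> g (u \<oplus>\<^bsub>V\<^esub> x) = g x"
  shows "(\<Union>y\<in>U +>\<^bsub>V\<^esub> x. g y) = g x"
proof -
  have "x = \<zero>\<^bsub>V\<^esub> \<oplus>\<^bsub>V\<^esub> x" using assms(1) by simp
  then have "x \<in> U +>\<^bsub>V\<^esub> x" using U_closed(2) unfolding coset_def' by blast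
  then show ?thesis using assms(2) by (auto simp: coset_def')
qed

lemma quot_cases:
  assumes "X \<in> carrier W"
  obtains x where "x \<in> carrier V" "X = U +>\<^bsub>V\<^esub> x"
  using assms by (auto simp: carrier_quot A_RCOSETS_def RCOSETS_def a_r_coset_def)

lemma coset_closed [simp]: "x \<in> carrier V \<Longrightarrow> U +>\<^bsub>V\<^esub> x \<in> carrier W"
  by (simp add: carrier_quot M.a_rcosetsI U.a_subset)

lemma coset_add: "x \<in> carrier V \<Longrightarrow> y \<in> carrier V \<Longrightarrow>
    (U +>\<^bsub>V\<^esub> x) \<oplus>\<^bsub>W\<^esub> (U +>\<^bsub>V\<^esub> y) = U +>\<^bsub>V\<^esub> (x \<oplus>\<^bsub>V\<^esub> y)"
  by (simp add: add_quot U.a_rcos_sum)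

lemma coset_smult:
  assumes "a \<in> carrier K" "x \<in> carrier V"
  shows "a \<odot>\<^bsub>W\<^esub> (U +>\<^bsub>V\<^esub> x) = U +>\<^bsub>V\<^esub> (a \<odot>\<^bsub>V\<^esub> x)"
  unfolding smult_quot
  by (rule coset_UN) (use assms in \<open>auto simp: smult_r_distr coset_eqI\<close>)

lemma coset_zero: "U +>\<^bsub>V\<^esub> \<zero>\<^bsub>V\<^esub> = \<zero>\<^bsub>W\<^esub>"
  by (simp add: zero_quot coset_eq_zero_iff)

lemma module_quot: "module K W"
proof (rule moduleI)
  show "cring K" by (rule R.is_cring)
  show "abelian_group W"
  proof (rule abelian_groupI)
    show "\<zero>\<^bsub>W\<^esub> \<in> carrier W" using coset_closed[of "\<zero>\<^bsub>V\<^esub>"] by (simp add: coset_zero del: coset_closed)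
    fix X assume "X \<in> carrier W"
    then obtain x where x: "x \<in> carrier V" "X = U +>\<^bsub>V\<^esub> x" by (rule quot_cases)
    show "\<zero>\<^bsub>W\<^esub> \<oplus>\<^bsub>W\<^esub> X = X" using coset_add[of "\<zero>\<^bsub>V\<^esub>" x] x by (simp add: coset_zero)
    show "\<exists>Y\<in>carrier W. Y \<oplus>\<^bsub>W\<^esub> X = \<zero>\<^bsub>W\<^esub>"
      by (rule bexI[of _ "U +>\<^bsub>V\<^esub> (\<ominus>\<^bsub>V\<^esub> x)"]) (use x in \<open>simp_all add: coset_add M.l_neg coset_zero\<close>)
    fix Y assume "Y \<in> carrier W"
    then obtain y where y: "y \<in> carrier V" "Y = U +>\<^bsub>V\<^esub> y" by (rule quot_cases)
    show "X \<oplus>\<^bsub>W\<^esub> Y \<in> carrier W" using x y by (simp add: coset_add)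
    show "X \<oplus>\<^bsub>W\<^esub> Y = Y \<oplus>\<^bsub>W\<^esub> X" using x y by (simp add: coset_add M.a_comm)
    fix Z assume "Z \<in> carrier W"
    then obtain z where z: "z \<in> carrier V" "Z = U +>\<^bsub>V\<^esub> z" by (rule quot_cases)
    show "X \<oplus>\<^bsub>W\<^esub> Y \<oplus>\<^bsub>W\<^esub> Z = X \<oplus>\<^bsub>W\<^esub> (Y \<oplus>\<^bsub>W\<^esub> Z)" using x y z by (simp add: coset_add M.a_assoc)
  qed
qed (auto elim!: quot_cases simp: coset_add coset_smult smult_l_distr smult_r_distr smult_assoc1)

sublocale W: module K W by (rule module_quot)

lemma coset_lin_hom: "(\<lambda>x. U +>\<^bsub>V\<^esub> x) \<in> lin_hom K V W"
  by (rule lin_homI) (auto simp: coset_add coset_smult)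

lemma coset_uminus: "x \<in> carrier V \<Longrightarrow> \<ominus>\<^bsub>W\<^esub> (U +>\<^bsub>V\<^esub> x) = U +>\<^bsub>V\<^esub> (\<ominus>\<^bsub>V\<^esub> x)"
  using lin_hom_additive(2)[OF module_axioms module_quot coset_lin_hom] by simp

lemma coset_minus: "x \<in> carrier V \<Longrightarrow> y \<in> carrier V \<Longrightarrow>
    (U +>\<^bsub>V\<^esub> x) \<ominus>\<^bsub>W\<^esub> (U +>\<^bsub>V\<^esub> y) = U +>\<^bsub>V\<^esub> (x \<ominus>\<^bsub>V\<^esub> y)"
  using lin_hom_additive(3)[OF module_axioms module_quot coset_lin_hom] by simp

end

text \<open>The locale fixes only the fields that \<open>quot_module\<close> and
  \<open>quot_lie\<close> have in common, so one set of coset rules serves cohomology spaces and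
  quotient algebras alike.\<close>

lemma quotient_space_quot_module:
  assumes "module K V" "submodule U K V"
  shows "quotient_space K V U (quot_module V U)"
  by (intro quotient_space.intro quotient_space_axioms.intro assms) (simp_all add: quot_module_def)

lemma quotient_space_quot_lie:
  assumes "module K V" "submodule U K V"
  shows "quotient_space K V U (quot_lie V U)"
  by (intro quotient_space.intro quotient_space_axioms.intro assms) (simp_all add: quot_lie_def)

lemma module_fun_module:
  assumes "module K V"
  shows "module K (fun_module S V)"
proof -
  interpret module K V by fact
  show ?thesis
  proof (rule moduleI)
    show "abelian_group (fun_module S V)"
    proof (rule abelian_groupI)
      fix f assume f: "f \<in> carrier (fun_module S V)"
      show "\<exists>g\<in>carrier (fun_module S V). g \<oplus>\<^bsub>fun_module S V\<^esub> f = \<zero>\<^bsub>fun_module S V\<^esub>"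
        by (rule bexI[of _ "\<lambda>s\<in>S. \<ominus>\<^bsub>V\<^esub> f s"]) (use f in \<open>auto simp: fun_module_def M.l_neg PiE_iff fun_eq_iff\<close>)
    qed (auto simp: fun_module_def fun_eq_iff M.a_ac PiE_iff extensional_def)
  qed (auto simp: fun_module_def fun_eq_iff smult_l_distr smult_r_distr smult_assoc1 R.is_cring
      PiE_iff extensional_def)
qed

lemma fun_module_uminus:
  assumes "module K V" "f \<in> S \<rightarrow>\<^sub>E carrier V"
  shows "\<ominus>\<^bsub>fun_module S V\<^esub> f = (\<lambda>s\<in>S. \<ominus>\<^bsub>V\<^esub> f s)"
proof -
  interpret V: module K V by fact
  interpret module K "fun_module S V" by (rule module_fun_module) fact
  show ?thesis
    by (rule M.minus_equality) (use assms(2) in \<open>auto simp: fun_module_def V.M.l_neg PiE_iff fun_eq_iff\<close>)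
qed

section \<open>Lie algebras and modules\<close>

context lie_algebra
begin

declare bracket_closed [simp]

lemma bracket_additive:
  assumes "x \<in> carrier L"
  shows "\<lblot>\<zero>\<^bsub>L\<^esub>, x\<rblot>\<^bsub>L\<^esub> = \<zero>\<^bsub>L\<^esub>" "\<lblot>x, \<zero>\<^bsub>L\<^esub>\<rblot>\<^bsub>L\<^esub> = \<zero>\<^bsub>L\<^esub>"
    "y \<in> carrier L \<Longrightarrow> \<lblot>\<ominus>\<^bsub>L\<^esub> y, x\<rblot>\<^bsub>L\<^esub> = \<ominus>\<^bsub>L\<^esub> \<lblot>y, x\<rblot>\<^bsub>L\<^esub>"
    "y \<in> carrier L \<Longrightarrow> \<lblot>x, \<ominus>\<^bsub>L\<^esub> y\<rblot>\<^bsub>L\<^esub> = \<ominus>\<^bsub>L\<^esub> \<lblot>x, y\<rblot>\<^bsub>L\<^esub>"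
    "y \<in> carrier L \<Longrightarrow> z \<in> carrier L \<Longrightarrow> \<lblot>y \<ominus>\<^bsub>L\<^esub> z, x\<rblot>\<^bsub>L\<^esub> = \<lblot>y, x\<rblot>\<^bsub>L\<^esub> \<ominus>\<^bsub>L\<^esub> \<lblot>z, x\<rblot>\<^bsub>L\<^esub>"
    "y \<in> carrier L \<Longrightarrow> z \<in> carrier L \<Longrightarrow> \<lblot>x, y \<ominus>\<^bsub>L\<^esub> z\<rblot>\<^bsub>L\<^esub> = \<lblot>x, y\<rblot>\<^bsub>L\<^esub> \<ominus>\<^bsub>L\<^esub> \<lblot>x, z\<rblot>\<^bsub>L\<^esub>"
  using additive_map[OF M.abelian_group_axioms M.abelian_group_axioms, of "\<lambda>y. \<lblot>y, x\<rblot>\<^bsub>L\<^esub>"]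
    additive_map[OF M.abelian_group_axioms M.abelian_group_axioms, of "\<lambda>y. \<lblot>x, y\<rblot>\<^bsub>L\<^esub>"] assms
  by (auto simp: bracket_add_left bracket_add_right)

lemma bracket_antisym:
  assumes "x \<in> carrier L" "y \<in> carrier L"
  shows "\<lblot>x, y\<rblot>\<^bsub>L\<^esub> = \<ominus>\<^bsub>L\<^esub> \<lblot>y, x\<rblot>\<^bsub>L\<^esub>"
proof -
  have "\<lblot>x \<oplus>\<^bsub>L\<^esub> y, x \<oplus>\<^bsub>L\<^esub> y\<rblot>\<^bsub>L\<^esub> = \<zero>\<^bsub>L\<^esub>"
    using assms by (simp add: bracket_alternating)
  then have "\<lblot>x, y\<rblot>\<^bsub>L\<^esub> \<oplus>\<^bsub>L\<^esub> \<lblot>y, x\<rblot>\<^bsub>L\<^esub> = \<zero>\<^bsub>L\<^esub>"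
    using assms by (simp add: bracket_add_left bracket_add_right)
      (simp add: bracket_alternating M.a_comm)
  then show ?thesis using assms by (simp add: M.minus_equality)
qed

text \<open>The Jacobi identity oriented as a rewrite rule to right-nested brackets.\<close>

lemma jacobi_left:
  assumes "x \<in> carrier L" "y \<in> carrier L" "z \<in> carrier L"
  shows "\<lblot>\<lblot>x, y\<rblot>\<^bsub>L\<^esub>, z\<rblot>\<^bsub>L\<^esub> = \<lblot>x, \<lblot>y, z\<rblot>\<^bsub>L\<^esub>\<rblot>\<^bsub>L\<^esub> \<ominus>\<^bsub>L\<^esub> \<lblot>y, \<lblot>x, z\<rblot>\<^bsub>L\<^esub>\<rblot>\<^bsub>L\<^esub>"
proof -
  have "\<lblot>x, \<lblot>y, z\<rblot>\<^bsub>L\<^esub>\<rblot>\<^bsub>L\<^esub> \<oplus>\<^bsub>L\<^esub> \<lblot>y, \<lblot>z, x\<rblot>\<^bsub>L\<^esub>\<rblot>\<^bsub>L\<^esub> \<oplus>\<^bsub>L\<^esub> \<lblot>z, \<lblot>x, y\<rblot>\<^bsub>L\<^esub>\<rblot>\<^bsub>L\<^esub> = \<zero>\<^bsub>L\<^esub>"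
    using assms by (rule jacobi)
  moreover have "\<lblot>y, \<lblot>z, x\<rblot>\<^bsub>L\<^esub>\<rblot>\<^bsub>L\<^esub> = \<ominus>\<^bsub>L\<^esub> \<lblot>y, \<lblot>x, z\<rblot>\<^bsub>L\<^esub>\<rblot>\<^bsub>L\<^esub>"
    using assms bracket_antisym[of z x] by (simp add: bracket_additive)
  moreover have "\<lblot>z, \<lblot>x, y\<rblot>\<^bsub>L\<^esub>\<rblot>\<^bsub>L\<^esub> = \<ominus>\<^bsub>L\<^esub> \<lblot>\<lblot>x, y\<rblot>\<^bsub>L\<^esub>, z\<rblot>\<^bsub>L\<^esub>"
    using assms bracket_antisym[of z "\<lblot>x, y\<rblot>\<^bsub>L\<^esub>"] by simp
  ultimately have "(\<lblot>x, \<lblot>y, z\<rblot>\<^bsub>L\<^esub>\<rblot>\<^bsub>L\<^esub> \<ominus>\<^bsub>L\<^esub> \<lblot>y, \<lblot>x, z\<rblot>\<^bsub>L\<^esub>\<rblot>\<^bsub>L\<^esub>) \<ominus>\<^bsub>L\<^esub> \<lblot>\<lblot>x, y\<rblot>\<^bsub>L\<^esub>, z\<rblot>\<^bsub>L\<^esub> = \<zero>\<^bsub>L\<^esub>"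
    by (simp add: a_minus_def)
  then show ?thesis using assms by (simp add: M.minus_eq_zero_iff)
qed

lemma lie_subalgebra:
  assumes "submodule H K L" "\<And>x y. x \<in> H \<Longrightarrow> y \<in> H \<Longrightarrow> \<lblot>x, y\<rblot>\<^bsub>L\<^esub> \<in> H"
  shows "lie_algebra K (L\<lparr>carrier := H\<rparr>)"
proof -
  have [simp]: "x \<in> carrier L" if "x \<in> H" for x using submoduleE(1)[OF assms(1)] that by blast
  show ?thesis
    by (intro lie_algebra.intro lie_algebra_axioms.intro field_axioms submodule_is_module assms(1))
      (simp_all add: assms(2) bracket_add_left bracket_add_right bracket_smult_left
        bracket_smult_right bracket_alternating jacobi)
qed

end

lemma lie_homD:
  assumes "f \<in> lie_hom K L L'"
  shows "f \<in> lin_hom K L L'"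
    "\<And>x y. x \<in> carrier L \<Longrightarrow> y \<in> carrier L \<Longrightarrow> f \<lblot>x, y\<rblot>\<^bsub>L\<^esub> = \<lblot>f x, f y\<rblot>\<^bsub>L'\<^esub>"
  using assms by (auto simp: lie_hom_def)

section \<open>Modules over a Lie algebra and semidirect products\<close>

context lie_module
begin

declare act_closed [simp]

lemma act_zero:
  "n \<in> carrier N \<Longrightarrow> act \<zero>\<^bsub>L\<^esub> n = \<zero>\<^bsub>N\<^esub>" "x \<in> carrier L \<Longrightarrow> act x \<zero>\<^bsub>N\<^esub> = \<zero>\<^bsub>N\<^esub>"
  using additive_map[OF M.abelian_group_axioms N.M.abelian_group_axioms, of "\<lambda>x. act x n"]
    additive_map[OF N.M.abelian_group_axioms N.M.abelian_group_axioms, of "act x"]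
  by (auto simp: act_add_left act_add_right)

lemma act_additive:
  assumes "x \<in> carrier L" "n \<in> carrier N"
  shows "act (\<ominus>\<^bsub>L\<^esub> x) n = \<ominus>\<^bsub>N\<^esub> act x n" "act x (\<ominus>\<^bsub>N\<^esub> n) = \<ominus>\<^bsub>N\<^esub> act x n"
    "y \<in> carrier L \<Longrightarrow> act (x \<ominus>\<^bsub>L\<^esub> y) n = act x n \<ominus>\<^bsub>N\<^esub> act y n"
    "n' \<in> carrier N \<Longrightarrow> act x (n \<ominus>\<^bsub>N\<^esub> n') = act x n \<ominus>\<^bsub>N\<^esub> act x n'"
  using additive_map[OF M.abelian_group_axioms N.M.abelian_group_axioms, of "\<lambda>x. act x n"]
    additive_map[OF N.M.abelian_group_axioms N.M.abelian_group_axioms, of "act x"] assms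
  by (auto simp: act_add_left act_add_right)

lemmas act_rules = act_add_left act_add_right act_zero act_additive act_smult_left act_smult_right

lemma lie_module_subalgebra:
  assumes "submodule H K L" "\<And>x y. x \<in> H \<Longrightarrow> y \<in> H \<Longrightarrow> \<lblot>x, y\<rblot>\<^bsub>L\<^esub> \<in> H"
  shows "lie_module K (L\<lparr>carrier := H\<rparr>) N act"
proof -
  have [simp]: "x \<in> carrier L" if "x \<in> H" for x using submoduleE(1)[OF assms(1)] that by blast
  show ?thesis
    by (intro lie_module.intro lie_module_axioms.intro lie_subalgebra assms N.module_axioms)
      (simp_all add: assms(2) act_rules act_bracket)
qed

lemma lie_module_submodule:
  assumes U: "submodule U K N" and closed: "\<And>x n. x \<in> carrier L \<Longrightarrow> n \<in> U \<Longrightarrow> act x n \<in> U"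
  shows "lie_module K L (N\<lparr>carrier := U\<rparr>) act"
proof -
  interpret U: module K "N\<lparr>carrier := U\<rparr>" by (rule N.submodule_is_module) fact
  have sub: "U \<subseteq> carrier N" by (rule N.submoduleE(1)[OF U])
  have [simp]: "n \<in> carrier N" if "n \<in> U" for n using sub that by blast
  \<comment> \<open>\<open>act_bracket\<close> subtracts in the record of the submodule, whose
    \<open>a_inv\<close> has to be identified with that of \<open>N\<close>.\<close>
  have "n \<ominus>\<^bsub>N\<lparr>carrier := U\<rparr>\<^esub> n' = n \<ominus>\<^bsub>N\<^esub> n'" if "n' \<in> U" for n n'
    by (rule a_minus_cong) (simp_all add: N.M.abelian_group_axioms U.M.abelian_group_axioms sub that)
  then show ?thesis
    by (intro lie_module.intro lie_module_axioms.intro lie_algebra_axioms U.module_axioms)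
      (simp_all add: closed act_rules act_bracket)
qed

lemma module_semidirect: "module K (semidirect N L act)"
proof (rule moduleI)
  show "abelian_group (semidirect N L act)"
  proof (rule abelian_groupI)
    fix u assume u: "u \<in> carrier (semidirect N L act)"
    show "\<exists>v\<in>carrier (semidirect N L act). v \<oplus>\<^bsub>semidirect N L act\<^esub> u = \<zero>\<^bsub>semidirect N L act\<^esub>"
      by (rule bexI[of _ "(\<ominus>\<^bsub>N\<^esub> fst u, \<ominus>\<^bsub>L\<^esub> snd u)"])
        (use u in \<open>auto simp: semidirect_def M.l_neg N.M.l_neg\<close>)
  qed (auto simp: semidirect_def M.a_ac N.M.a_ac)
qed (auto simp: semidirect_def is_cring smult_l_distr smult_r_distr smult_assoc1
    N.smult_l_distr N.smult_r_distr N.smult_assoc1)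

lemma semidirect_simps [simp]:
  "carrier (semidirect N L act) = carrier N \<times> carrier L"
  "\<zero>\<^bsub>semidirect N L act\<^esub> = (\<zero>\<^bsub>N\<^esub>, \<zero>\<^bsub>L\<^esub>)"
  "(n, x) \<oplus>\<^bsub>semidirect N L act\<^esub> (n', x') = (n \<oplus>\<^bsub>N\<^esub> n', x \<oplus>\<^bsub>L\<^esub> x')"
  "a \<odot>\<^bsub>semidirect N L act\<^esub> (n, x) = (a \<odot>\<^bsub>N\<^esub> n, a \<odot>\<^bsub>L\<^esub> x)"
  "\<lblot>(n, x), (n', x')\<rblot>\<^bsub>semidirect N L act\<^esub> = (act x n' \<ominus>\<^bsub>N\<^esub> act x' n, \<lblot>x, x'\<rblot>\<^bsub>L\<^esub>)"
  by (simp_all add: semidirect_def)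

lemma semidirect_uminus [simp]:
  assumes "n \<in> carrier N" "x \<in> carrier L"
  shows "\<ominus>\<^bsub>semidirect N L act\<^esub> (n, x) = (\<ominus>\<^bsub>N\<^esub> n, \<ominus>\<^bsub>L\<^esub> x)"
proof -
  interpret S: module K "semidirect N L act" by (rule module_semidirect)
  show ?thesis by (rule S.M.minus_equality) (use assms in \<open>auto simp: M.l_neg N.M.l_neg\<close>)
qed

lemma semidirect_minus [simp]:
  "n' \<in> carrier N \<Longrightarrow> x' \<in> carrier L \<Longrightarrow>
    (n, x) \<ominus>\<^bsub>semidirect N L act\<^esub> (n', x') = (n \<ominus>\<^bsub>N\<^esub> n', x \<ominus>\<^bsub>L\<^esub> x')"
  by (simp add: a_minus_def)

lemma lie_algebra_semidirect: "lie_algebra K (semidirect N L act)"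
proof (intro lie_algebra.intro lie_algebra_axioms.intro field_axioms module_semidirect)
  fix u v w a
  assume u: "u \<in> carrier (semidirect N L act)"
  obtain n x where [simp]: "u = (n, x)" by (cases u)
  have [simp]: "n \<in> carrier N" "x \<in> carrier L" using u by auto
  show "\<lblot>u, u\<rblot>\<^bsub>semidirect N L act\<^esub> = \<zero>\<^bsub>semidirect N L act\<^esub>"
    by (simp add: bracket_alternating N.M.minus_eq_zero_iff)
  assume v: "v \<in> carrier (semidirect N L act)"
  obtain n' x' where [simp]: "v = (n', x')" by (cases v)
  have [simp]: "n' \<in> carrier N" "x' \<in> carrier L" using v by auto
  show "\<lblot>u, v\<rblot>\<^bsub>semidirect N L act\<^esub> \<in> carrier (semidirect N L act)" by simp
  show "\<lblot>a \<odot>\<^bsub>semidirect N L act\<^esub> u, v\<rblot>\<^bsub>semidirect N L act\<^esub> =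
      a \<odot>\<^bsub>semidirect N L act\<^esub> \<lblot>u, v\<rblot>\<^bsub>semidirect N L act\<^esub>" if "a \<in> carrier K"
    using that by (simp add: act_rules bracket_smult_left a_minus_def N.smult_r_distr N.smult_r_minus)
  show "\<lblot>u, a \<odot>\<^bsub>semidirect N L act\<^esub> v\<rblot>\<^bsub>semidirect N L act\<^esub> =
      a \<odot>\<^bsub>semidirect N L act\<^esub> \<lblot>u, v\<rblot>\<^bsub>semidirect N L act\<^esub>" if "a \<in> carrier K"
    using that by (simp add: act_rules bracket_smult_right a_minus_def N.smult_r_distr N.smult_r_minus)
  assume w: "w \<in> carrier (semidirect N L act)"
  obtain n'' x'' where [simp]: "w = (n'', x'')" by (cases w)
  have [simp]: "n'' \<in> carrier N" "x'' \<in> carrier L" using w by auto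
  show "\<lblot>u \<oplus>\<^bsub>semidirect N L act\<^esub> v, w\<rblot>\<^bsub>semidirect N L act\<^esub> =
      \<lblot>u, w\<rblot>\<^bsub>semidirect N L act\<^esub> \<oplus>\<^bsub>semidirect N L act\<^esub> \<lblot>v, w\<rblot>\<^bsub>semidirect N L act\<^esub>"
    apply (simp add: act_rules bracket_add_left)
    by (rule N.M.formal_sum_eqI, (rule N.M.formal_sum_intros | (rule N.M.formal_sum_atom, simp))+, simp add: algebra_simps)
  show "\<lblot>u, v \<oplus>\<^bsub>semidirect N L act\<^esub> w\<rblot>\<^bsub>semidirect N L act\<^esub> =
      \<lblot>u, v\<rblot>\<^bsub>semidirect N L act\<^esub> \<oplus>\<^bsub>semidirect N L act\<^esub> \<lblot>u, w\<rblot>\<^bsub>semidirect N L act\<^esub>"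
    apply (simp add: act_rules bracket_add_right)
    by (rule N.M.formal_sum_eqI, (rule N.M.formal_sum_intros | (rule N.M.formal_sum_atom, simp))+, simp add: algebra_simps)
  show "\<lblot>u, \<lblot>v, w\<rblot>\<^bsub>semidirect N L act\<^esub>\<rblot>\<^bsub>semidirect N L act\<^esub> \<oplus>\<^bsub>semidirect N L act\<^esub>
      \<lblot>v, \<lblot>w, u\<rblot>\<^bsub>semidirect N L act\<^esub>\<rblot>\<^bsub>semidirect N L act\<^esub> \<oplus>\<^bsub>semidirect N L act\<^esub>
      \<lblot>w, \<lblot>u, v\<rblot>\<^bsub>semidirect N L act\<^esub>\<rblot>\<^bsub>semidirect N L act\<^esub> = \<zero>\<^bsub>semidirect N L act\<^esub>"
    apply (simp add: act_rules act_bracket jacobi)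
    by (rule N.M.formal_sum_eqI, (rule N.M.formal_sum_intros | (rule N.M.formal_sum_atom, simp))+, simp add: algebra_simps)
qed

section \<open>Derivations and first cohomology\<close>

lemma module_Fun: "module K (fun_module (carrier L) N)"
  by (rule module_fun_module) (rule N.module_axioms)

lemma derivationsD:
  assumes "d \<in> derivations K L N act"
  shows "d \<in> lin_hom K L N" "d \<in> carrier L \<rightarrow>\<^sub>E carrier N"
    "x \<in> carrier L \<Longrightarrow> y \<in> carrier L \<Longrightarrow> d \<lblot>x, y\<rblot>\<^bsub>L\<^esub> = act x (d y) \<ominus>\<^bsub>N\<^esub> act y (d x)"
  using assms by (auto simp: derivations_def)

lemma derivation_rules:
  assumes "d \<in> derivations K L N act"
  shows "x \<in> carrier L \<Longrightarrow> d x \<in> carrier N"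
    "x \<in> carrier L \<Longrightarrow> y \<in> carrier L \<Longrightarrow> d (x \<oplus>\<^bsub>L\<^esub> y) = d x \<oplus>\<^bsub>N\<^esub> d y"
    "a \<in> carrier K \<Longrightarrow> x \<in> carrier L \<Longrightarrow> d (a \<odot>\<^bsub>L\<^esub> x) = a \<odot>\<^bsub>N\<^esub> d x"
    "d \<zero>\<^bsub>L\<^esub> = \<zero>\<^bsub>N\<^esub>"
    "x \<in> carrier L \<Longrightarrow> d (\<ominus>\<^bsub>L\<^esub> x) = \<ominus>\<^bsub>N\<^esub> d x"
    "x \<in> carrier L \<Longrightarrow> y \<in> carrier L \<Longrightarrow> d (x \<ominus>\<^bsub>L\<^esub> y) = d x \<ominus>\<^bsub>N\<^esub> d y"
  using lin_homD[OF derivationsD(1)[OF assms]]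
    lin_hom_additive[OF module_axioms N.module_axioms derivationsD(1)[OF assms]] by auto

lemma derivationsI:
  assumes "d \<in> extensional (carrier L)" "d \<in> lin_hom K L N"
    "\<And>x y. x \<in> carrier L \<Longrightarrow> y \<in> carrier L \<Longrightarrow> d \<lblot>x, y\<rblot>\<^bsub>L\<^esub> = act x (d y) \<ominus>\<^bsub>N\<^esub> act y (d x)"
  shows "d \<in> derivations K L N act"
  using assms by (auto simp: derivations_def lin_hom_def PiE_def)

lemma submodule_derivations: "submodule (derivations K L N act) K (fun_module (carrier L) N)"
proof -
  interpret F: module K "fun_module (carrier L) N" by (rule module_Fun)
  show ?thesis
  proof (rule F.submoduleI)
    show "derivations K L N act \<subseteq> carrier (fun_module (carrier L) N)"
      by (auto simp: derivations_def fun_module_def)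
    show "\<zero>\<^bsub>fun_module (carrier L) N\<^esub> \<in> derivations K L N act"
      by (auto simp: fun_module_def act_rules N.M.minus_eq_zero_iff intro!: derivationsI lin_homI)
    fix d assume d: "d \<in> derivations K L N act"
    note d' [simp] = derivation_rules[OF d]
    show "\<ominus>\<^bsub>fun_module (carrier L) N\<^esub> d \<in> derivations K L N act"
      unfolding fun_module_uminus[OF N.module_axioms derivationsD(2)[OF d]]
    proof (rule derivationsI)
      show "(\<lambda>s\<in>carrier L. \<ominus>\<^bsub>N\<^esub> d s) \<in> lin_hom K L N"
        by (rule lin_homI) (simp_all add: N.M.minus_add N.smult_r_minus)
      fix x y assume [simp]: "x \<in> carrier L" "y \<in> carrier L"
      show "(\<lambda>s\<in>carrier L. \<ominus>\<^bsub>N\<^esub> d s) \<lblot>x, y\<rblot>\<^bsub>L\<^esub> =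
          act x ((\<lambda>s\<in>carrier L. \<ominus>\<^bsub>N\<^esub> d s) y) \<ominus>\<^bsub>N\<^esub> act y ((\<lambda>s\<in>carrier L. \<ominus>\<^bsub>N\<^esub> d s) x)"
        apply (simp add: act_rules derivationsD(3)[OF d])
        by (rule N.M.formal_sum_eqI, (rule N.M.formal_sum_intros | (rule N.M.formal_sum_atom, simp))+, simp add: algebra_simps)
    qed simp
    show "a \<odot>\<^bsub>fun_module (carrier L) N\<^esub> d \<in> derivations K L N act" if [simp]: "a \<in> carrier K" for a
    proof (rule derivationsI)
      show "a \<odot>\<^bsub>fun_module (carrier L) N\<^esub> d \<in> lin_hom K L N"
        by (rule lin_homI)
          (simp_all add: fun_module_def N.smult_r_distr N.smult_assoc1[symmetric] m_comm)
      show "(a \<odot>\<^bsub>fun_module (carrier L) N\<^esub> d) \<lblot>x, y\<rblot>\<^bsub>L\<^esub> =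
          act x ((a \<odot>\<^bsub>fun_module (carrier L) N\<^esub> d) y) \<ominus>\<^bsub>N\<^esub> act y ((a \<odot>\<^bsub>fun_module (carrier L) N\<^esub> d) x)"
        if "x \<in> carrier L" "y \<in> carrier L" for x y
        using that by (simp add: fun_module_def act_rules derivationsD(3)[OF d] a_minus_def
            N.smult_r_distr N.smult_r_minus)
    qed (simp add: fun_module_def)
    fix e assume e: "e \<in> derivations K L N act"
    note e' [simp] = derivation_rules[OF e]
    show "d \<oplus>\<^bsub>fun_module (carrier L) N\<^esub> e \<in> derivations K L N act"
    proof (rule derivationsI)
      show "d \<oplus>\<^bsub>fun_module (carrier L) N\<^esub> e \<in> lin_hom K L N"
      proof (rule lin_homI)
        fix x y assume [simp]: "x \<in> carrier L" "y \<in> carrier L"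
        show "(d \<oplus>\<^bsub>fun_module (carrier L) N\<^esub> e) (x \<oplus>\<^bsub>L\<^esub> y) =
            (d \<oplus>\<^bsub>fun_module (carrier L) N\<^esub> e) x \<oplus>\<^bsub>N\<^esub> (d \<oplus>\<^bsub>fun_module (carrier L) N\<^esub> e) y"
          apply (simp add: fun_module_def)
          by (rule N.M.formal_sum_eqI, (rule N.M.formal_sum_intros | (rule N.M.formal_sum_atom, simp))+, simp add: algebra_simps)
      qed (simp_all add: fun_module_def N.smult_r_distr)
      fix x y assume [simp]: "x \<in> carrier L" "y \<in> carrier L"
      show "(d \<oplus>\<^bsub>fun_module (carrier L) N\<^esub> e) \<lblot>x, y\<rblot>\<^bsub>L\<^esub> =
          act x ((d \<oplus>\<^bsub>fun_module (carrier L) N\<^esub> e) y) \<ominus>\<^bsub>N\<^esub> act y ((d \<oplus>\<^bsub>fun_module (carrier L) N\<^esub> e) x)"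
        apply (simp add: fun_module_def act_rules derivationsD(3)[OF d] derivationsD(3)[OF e])
        by (rule N.M.formal_sum_eqI, (rule N.M.formal_sum_intros | (rule N.M.formal_sum_atom, simp))+, simp add: algebra_simps)
    qed (simp add: fun_module_def)
  qed
qed

lemma module_Der: "module K (Der K L N act)"
  unfolding Der_def
  by (rule module.submodule_is_module[OF module_Fun submodule_derivations])

lemma Der_simps [simp]:
  "carrier (Der K L N act) = derivations K L N act"
  "\<zero>\<^bsub>Der K L N act\<^esub> = (\<lambda>x\<in>carrier L. \<zero>\<^bsub>N\<^esub>)"
  "d \<oplus>\<^bsub>Der K L N act\<^esub> e = (\<lambda>x\<in>carrier L. d x \<oplus>\<^bsub>N\<^esub> e x)"
  "a \<odot>\<^bsub>Der K L N act\<^esub> d = (\<lambda>x\<in>carrier L. a \<odot>\<^bsub>N\<^esub> d x)"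
  by (simp_all add: Der_def fun_module_def)

lemma Der_uminus:
  assumes "d \<in> derivations K L N act"
  shows "\<ominus>\<^bsub>Der K L N act\<^esub> d = (\<lambda>x\<in>carrier L. \<ominus>\<^bsub>N\<^esub> d x)"
proof -
  interpret D: module K "Der K L N act" by (rule module_Der)
  interpret F: module K "fun_module (carrier L) N" by (rule module_Fun)
  have "\<ominus>\<^bsub>Der K L N act\<^esub> d = \<ominus>\<^bsub>fun_module (carrier L) N\<^esub> d"
    by (rule abelian_group_a_inv_cong[OF F.M.abelian_group_axioms D.M.abelian_group_axioms])
      (use assms derivationsD(2) in \<open>auto simp: fun_module_def Der_def\<close>)
  then show ?thesis
    using fun_module_uminus[OF N.module_axioms derivationsD(2)[OF assms]] by simp
qed

lemma Der_minus:
  assumes "e \<in> derivations K L N act"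
  shows "d \<ominus>\<^bsub>Der K L N act\<^esub> e = (\<lambda>x\<in>carrier L. d x \<ominus>\<^bsub>N\<^esub> e x)"
  unfolding a_minus_def Der_uminus[OF assms] by (auto simp: a_minus_def fun_eq_iff)

lemma inner_der_derivation: "n \<in> carrier N \<Longrightarrow> inner_der L act n \<in> derivations K L N act"
  by (rule derivationsI) (auto simp: inner_der_def act_rules act_bracket intro!: lin_homI)

lemma inner_der_lin_hom: "inner_der L act \<in> lin_hom K N (Der K L N act)"
  by (rule lin_homI, simp_all add: inner_der_derivation) (auto simp: inner_der_def act_rules fun_eq_iff)

lemma submodule_Inn: "submodule (Inn L N act) K (Der K L N act)"
proof -
  interpret D: module K "Der K L N act" by (rule module_Der)
  note i = lin_homD[OF inner_der_lin_hom] lin_hom_additive[OF N.module_axioms module_Der inner_der_lin_hom]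
  show ?thesis
    unfolding Inn_def
  proof (rule D.submoduleI)
    show "inner_der L act ` carrier N \<subseteq> carrier (Der K L N act)" using i(1) by auto
    show "\<zero>\<^bsub>Der K L N act\<^esub> \<in> inner_der L act ` carrier N" using i(4) N.M.zero_closed by (metis imageI)
    fix u assume "u \<in> inner_der L act ` carrier N"
    then obtain n where n: "n \<in> carrier N" "u = inner_der L act n" by auto
    show "\<ominus>\<^bsub>Der K L N act\<^esub> u \<in> inner_der L act ` carrier N"
      using n i(5)[of n] N.M.a_inv_closed by (metis imageI)
    show "a \<odot>\<^bsub>Der K L N act\<^esub> u \<in> inner_der L act ` carrier N" if "a \<in> carrier K" for a
      using n i(3)[of a n] that N.smult_closed by (metis imageI)
    fix v assume "v \<in> inner_der L act ` carrier N"
    then obtain n' where n': "n' \<in> carrier N" "v = inner_der L act n'" by auto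
    have "u \<oplus>\<^bsub>Der K L N act\<^esub> v = inner_der L act (n \<oplus>\<^bsub>N\<^esub> n')"
      using n n' i(2)[of n n'] by simp
    then show "u \<oplus>\<^bsub>Der K L N act\<^esub> v \<in> inner_der L act ` carrier N" using n n' by simp
  qed
qed

lemma quotient_space_H1:
  "quotient_space K (Der K L N act) (Inn L N act) (H1 K L N act)"
  unfolding H1_def
  by (rule quotient_space_quot_module[OF module_Der submodule_Inn])

text \<open>As a sublocale of \<open>lie_module\<close>, the coset rules become available at both
  levels of the theorem: for \<open>H^1(H, M)\<close> and for the first cohomology of the quotient
  with coefficients in it.\<close>

sublocale H1: quotient_space K "Der K L N act" "Inn L N act" "H1 K L N act"
  by (rule quotient_space_H1)

end

section \<open>Ideals, quotient algebras and descent of actions\<close>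

lemma lie_idealD:
  assumes "lie_algebra K L" "lie_ideal K L I"
  shows "submodule I K L" "\<And>x z. x \<in> carrier L \<Longrightarrow> z \<in> I \<Longrightarrow> \<lblot>x, z\<rblot>\<^bsub>L\<^esub> \<in> I"
    "\<And>x z. x \<in> carrier L \<Longrightarrow> z \<in> I \<Longrightarrow> \<lblot>z, x\<rblot>\<^bsub>L\<^esub> \<in> I"
    "\<And>z. z \<in> I \<Longrightarrow> z \<in> carrier L"
proof -
  interpret lie_algebra K L by fact
  show sub: "submodule I K L" and br: "\<And>x z. x \<in> carrier L \<Longrightarrow> z \<in> I \<Longrightarrow> \<lblot>x, z\<rblot>\<^bsub>L\<^esub> \<in> I"
    using assms(2) by (auto simp: lie_ideal_def)
  show carr: "z \<in> carrier L" if "z \<in> I" for z using submoduleE(1)[OF sub] that by blast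
  show "\<lblot>z, x\<rblot>\<^bsub>L\<^esub> \<in> I" if "x \<in> carrier L" "z \<in> I" for x z
    using bracket_antisym[of z x] br submoduleE(3)[OF sub] carr that by metis
qed

locale lie_quotient = lie_algebra K L for K and L + fixes I
  assumes ideal: "lie_ideal K L I"
begin

lemmas ideal_rules = lie_idealD[OF lie_algebra_axioms ideal]

sublocale quot: quotient_space K L I "quot_lie L I"
  by (rule quotient_space_quot_lie[OF module_axioms ideal_rules(1)])

text \<open>The defining union runs over representatives of both arguments; since \<open>I\<close>
  is an ideal, it collapses first in \<open>y\<close> and then in \<open>x\<close>.\<close>

lemma coset_bracket:
  assumes "x \<in> carrier L" "y \<in> carrier L"
  shows "\<lblot>I +>\<^bsub>L\<^esub> x, I +>\<^bsub>L\<^esub> y\<rblot>\<^bsub>quot_lie L I\<^esub> = I +>\<^bsub>L\<^esub> \<lblot>x, y\<rblot>\<^bsub>L\<^esub>"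
proof -
  have "I +>\<^bsub>L\<^esub> \<lblot>u \<oplus>\<^bsub>L\<^esub> x, y'\<rblot>\<^bsub>L\<^esub> = I +>\<^bsub>L\<^esub> \<lblot>x, y'\<rblot>\<^bsub>L\<^esub>" if "u \<in> I" "y' \<in> carrier L" for u y'
    using that assms by (simp add: bracket_add_left quot.coset_eqI ideal_rules)
  moreover have "I +>\<^bsub>L\<^esub> \<lblot>x', u \<oplus>\<^bsub>L\<^esub> y\<rblot>\<^bsub>L\<^esub> = I +>\<^bsub>L\<^esub> \<lblot>x', y\<rblot>\<^bsub>L\<^esub>" if "u \<in> I" "x' \<in> carrier L" for u x'
    using that assms by (simp add: bracket_add_right quot.coset_eqI ideal_rules)
  ultimately have "(\<Union>y'\<in>I +>\<^bsub>L\<^esub> y. I +>\<^bsub>L\<^esub> \<lblot>x', y'\<rblot>\<^bsub>L\<^esub>) = I +>\<^bsub>L\<^esub> \<lblot>x', y\<rblot>\<^bsub>L\<^esub>" if "x' \<in> carrier L" for x'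
    using that assms by (intro quot.coset_UN) auto
  then have "(\<Union>x'\<in>I +>\<^bsub>L\<^esub> x. \<Union>y'\<in>I +>\<^bsub>L\<^esub> y. I +>\<^bsub>L\<^esub> \<lblot>x', y'\<rblot>\<^bsub>L\<^esub>) = (\<Union>x'\<in>I +>\<^bsub>L\<^esub> x. I +>\<^bsub>L\<^esub> \<lblot>x', y\<rblot>\<^bsub>L\<^esub>)"
    using assms quot.U.a_elemrcos_carrier by (intro SUP_cong) auto
  also have "\<dots> = I +>\<^bsub>L\<^esub> \<lblot>x, y\<rblot>\<^bsub>L\<^esub>"
    using assms by (intro quot.coset_UN)
      (auto simp: bracket_add_left quot.coset_eqI ideal_rules)
  finally show ?thesis by (simp add: quot_lie_def)
qed

lemma lie_algebra_quot: "lie_algebra K (quot_lie L I)"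
  by (intro lie_algebra.intro lie_algebra_axioms.intro field_axioms quot.module_quot)
    (auto elim!: quot.quot_cases simp: coset_bracket quot.coset_add quot.coset_smult
      bracket_add_left bracket_add_right bracket_smult_left bracket_smult_right bracket_alternating
      jacobi quot.coset_zero)

sublocale Q: lie_algebra K "quot_lie L I"
  by (rule lie_algebra_quot)

end

text \<open>Applied to \<open>Der(H, M)\<close> modulo the inner derivations, where it gives the
  action of \<open>G\<close> on \<open>H^1(H, M)\<close>. The action is written as a union over a
  coset to match \<open>H1_action\<close>.\<close>

lemma (in lie_module) lie_module_quotient:
  assumes U: "submodule U K N" and stable: "\<And>x n. x \<in> carrier L \<Longrightarrow> n \<in> U \<Longrightarrow> act x n \<in> U"
  shows "x \<in> carrier L \<Longrightarrow> n \<in> carrier N \<Longrightarrow> (\<Union>n'\<in>U +>\<^bsub>N\<^esub> n. U +>\<^bsub>N\<^esub> act x n') = U +>\<^bsub>N\<^esub> act x n"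
    and "lie_module K L (quot_module N U) (\<lambda>x C. \<Union>n\<in>C. U +>\<^bsub>N\<^esub> act x n)"
proof -
  interpret U: quotient_space K N U "quot_module N U"
    by (rule quotient_space_quot_module[OF N.module_axioms U])
  show coset: "(\<Union>n'\<in>U +>\<^bsub>N\<^esub> n. U +>\<^bsub>N\<^esub> act x n') = U +>\<^bsub>N\<^esub> act x n"
    if "x \<in> carrier L" "n \<in> carrier N" for x n
    using that by (intro U.coset_UN) (auto simp: act_add_right stable U.coset_eqI)
  define \<rho> where "\<rho> = (\<lambda>x C. \<Union>n\<in>C. U +>\<^bsub>N\<^esub> act x n)"
  have \<rho>: "\<rho> x (U +>\<^bsub>N\<^esub> n) = U +>\<^bsub>N\<^esub> act x n" if "x \<in> carrier L" "n \<in> carrier N" for x n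
    using coset that by (simp add: \<rho>_def)
  show "lie_module K L (quot_module N U) (\<lambda>x C. \<Union>n\<in>C. U +>\<^bsub>N\<^esub> act x n)"
    unfolding \<rho>_def[symmetric]
    by (intro lie_module.intro lie_module_axioms.intro lie_algebra_axioms U.module_quot)
      (auto elim!: U.quot_cases simp: \<rho> U.coset_add U.coset_smult U.coset_minus act_rules
        act_bracket)
qed

text \<open>Used twice, for \<open>H^1(H, M)\<close> and for the invariants. \<open>\<rho>'\<close>
  is prescribed on cosets only, so that it can be whichever encoding of the descended action the
  definitions use: a union of classes in one case, \<open>the_elem\<close> of an image in the
  other.\<close>

lemma (in lie_quotient) lie_module_descend:
  assumes "lie_module K L W \<rho>"
    and triv: "\<And>z w. z \<in> I \<Longrightarrow> w \<in> carrier W \<Longrightarrow> \<rho> z w = \<zero>\<^bsub>W\<^esub>"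
    and act: "\<And>x w. x \<in> carrier L \<Longrightarrow> w \<in> carrier W \<Longrightarrow> \<rho>' (I +>\<^bsub>L\<^esub> x) w = \<rho> x w"
  shows "lie_module K (quot_lie L I) W \<rho>'"
proof -
  interpret W: lie_module K L W \<rho> by fact
  show ?thesis
    by (intro lie_module.intro lie_module_axioms.intro lie_algebra_quot W.N.module_axioms)
      (auto elim!: quot.quot_cases simp: act quot.coset_add quot.coset_smult coset_bracket
        W.act_rules W.act_bracket)
qed

section \<open>A module over an algebra with an ideal: derivations on the ideal, its first
  cohomology, the invariants\<close>

locale lie_ideal_module = lie_module K G M act + lie_quotient K G H
  for K and G and M and act and H
begin

abbreviation "G_H \<equiv> G\<lparr>carrier := H\<rparr>"
abbreviation "Q \<equiv> quot_lie G H"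
abbreviation "V \<equiv> H1 K G_H M act"
abbreviation "DerH \<equiv> derivations K G_H M act"
abbreviation "InnH \<equiv> Inn G_H M act"
abbreviation "DER \<equiv> Der K G_H M act"
abbreviation "q x \<equiv> H +>\<^bsub>G\<^esub> x"
abbreviation "dact \<equiv> der_action G H M act"
abbreviation "hact \<equiv> H1_action K G H M act"
abbreviation "inn m \<equiv> inner_der G_H act m"
abbreviation "M_H \<equiv> M\<lparr>carrier := invariants M act H\<rparr>"

lemmas H_rules [simp] = ideal_rules(2-4) quot.U_closed

sublocale h: lie_module K G_H M act
  by (rule lie_module_subalgebra) (auto simp: ideal_rules)

lemma G_H_uminus: "z \<in> H \<Longrightarrow> \<ominus>\<^bsub>G_H\<^esub> z = \<ominus>\<^bsub>G\<^esub> z"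
  by (rule abelian_group_a_inv_cong[OF M.abelian_group_axioms h.M.abelian_group_axioms]) auto

lemma G_H_minus: "z \<in> H \<Longrightarrow> w \<ominus>\<^bsub>G_H\<^esub> z = w \<ominus>\<^bsub>G\<^esub> z"
  by (simp add: a_minus_def G_H_uminus)

lemma DerH_rules:
  assumes "d \<in> DerH"
  shows "z \<in> H \<Longrightarrow> d z \<in> carrier M"
    "z \<in> H \<Longrightarrow> w \<in> H \<Longrightarrow> d (z \<oplus>\<^bsub>G\<^esub> w) = d z \<oplus>\<^bsub>M\<^esub> d w"
    "a \<in> carrier K \<Longrightarrow> z \<in> H \<Longrightarrow> d (a \<odot>\<^bsub>G\<^esub> z) = a \<odot>\<^bsub>M\<^esub> d z"
    "d \<zero>\<^bsub>G\<^esub> = \<zero>\<^bsub>M\<^esub>"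
    "z \<in> H \<Longrightarrow> d (\<ominus>\<^bsub>G\<^esub> z) = \<ominus>\<^bsub>M\<^esub> d z"
    "z \<in> H \<Longrightarrow> w \<in> H \<Longrightarrow> d (z \<ominus>\<^bsub>G\<^esub> w) = d z \<ominus>\<^bsub>M\<^esub> d w"
  using h.derivation_rules[OF assms] by (simp_all add: G_H_uminus G_H_minus)

lemmas DerH_bracket = h.derivationsD(3)[simplified]
lemmas DER_simps [simp] = h.Der_simps[simplified]
lemmas DER_uminus = h.Der_uminus[simplified]
lemmas DER_minus = h.Der_minus[simplified]

lemma DerH_ext: "d \<in> DerH \<Longrightarrow> d \<in> extensional H"
  using h.derivationsD(2) by (auto simp: PiE_def)

lemma DerHI:
  assumes "d \<in> extensional H" "\<And>z. z \<in> H \<Longrightarrow> d z \<in> carrier M"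
    "\<And>z w. z \<in> H \<Longrightarrow> w \<in> H \<Longrightarrow> d (z \<oplus>\<^bsub>G\<^esub> w) = d z \<oplus>\<^bsub>M\<^esub> d w"
    "\<And>a z. a \<in> carrier K \<Longrightarrow> z \<in> H \<Longrightarrow> d (a \<odot>\<^bsub>G\<^esub> z) = a \<odot>\<^bsub>M\<^esub> d z"
    "\<And>z w. z \<in> H \<Longrightarrow> w \<in> H \<Longrightarrow> d \<lblot>z, w\<rblot>\<^bsub>G\<^esub> = act z (d w) \<ominus>\<^bsub>M\<^esub> act w (d z)"
  shows "d \<in> DerH"
  by (rule h.derivationsI) (auto intro!: lin_homI simp: assms)

lemma DerH_eqI:
  assumes "d \<in> extensional H" "e \<in> extensional H" "\<And>z. z \<in> H \<Longrightarrow> d z = e z"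
  shows "d = e"
  using assms by (rule extensionalityI)

lemma der_action_apply: "z \<in> H \<Longrightarrow> dact x d z = act x (d z) \<ominus>\<^bsub>M\<^esub> d \<lblot>x, z\<rblot>\<^bsub>G\<^esub>"
  by (simp add: der_action_def)

lemma der_action_ext [simp]: "dact x d \<in> extensional H"
  by (simp add: der_action_def)

lemma der_action_closed:
  assumes [simp]: "x \<in> carrier G" and d: "d \<in> DerH"
  shows "dact x d \<in> DerH"
proof (rule DerHI)
  note d' [simp] = DerH_rules[OF d]
  show "dact x d z \<in> carrier M" if "z \<in> H" for z
    using that by (simp add: der_action_apply)
  show "dact x d (a \<odot>\<^bsub>G\<^esub> z) = a \<odot>\<^bsub>M\<^esub> dact x d z"
    if "a \<in> carrier K" "z \<in> H" for a z
    using that by (simp add: der_action_apply act_rules bracket_smult_right a_minus_def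
        N.smult_r_distr N.smult_r_minus)
  fix z w assume [simp]: "z \<in> H" "w \<in> H"
  show "dact x d (z \<oplus>\<^bsub>G\<^esub> w) = dact x d z \<oplus>\<^bsub>M\<^esub> dact x d w"
    apply (simp add: der_action_apply act_rules bracket_add_right)
    by (rule N.M.formal_sum_eqI, (rule N.M.formal_sum_intros | (rule N.M.formal_sum_atom, simp))+, simp add: algebra_simps)
  \<comment> \<open>\<open>d\<close> is a derivation on \<open>H\<close> only and \<open>x\<close>
    may lie outside, so the brackets are regrouped until both arguments of the outer bracket belong
    to \<open>H\<close>.\<close>
  have "d \<lblot>x, \<lblot>z, w\<rblot>\<^bsub>G\<^esub>\<rblot>\<^bsub>G\<^esub> = d (\<lblot>\<lblot>x, z\<rblot>\<^bsub>G\<^esub>, w\<rblot>\<^bsub>G\<^esub> \<oplus>\<^bsub>G\<^esub> \<lblot>z, \<lblot>x, w\<rblot>\<^bsub>G\<^esub>\<rblot>\<^bsub>G\<^esub>)"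
    by (rule arg_cong[of _ _ d], simp add: jacobi_left[of x z w]) (rule M.formal_sum_eqI, (rule M.formal_sum_intros | (rule M.formal_sum_atom, simp))+, simp add: algebra_simps)
  then show "dact x d \<lblot>z, w\<rblot>\<^bsub>G\<^esub> =
      act z (dact x d w) \<ominus>\<^bsub>M\<^esub> act w (dact x d z)"
    apply (simp add: der_action_apply act_rules DerH_bracket[OF d] act_bracket)
    by (rule N.M.formal_sum_eqI, (rule N.M.formal_sum_intros | (rule N.M.formal_sum_atom, simp))+, simp add: algebra_simps)
qed simp

lemma lie_module_der_action: "lie_module K G DER dact"
proof (intro lie_module.intro lie_module_axioms.intro lie_algebra_axioms h.module_Der)
  fix x d assume [simp]: "x \<in> carrier G" and d: "d \<in> carrier DER"
  note d' [simp] = DerH_rules[OF d[simplified]]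
  show "dact x d \<in> carrier DER" using d by (simp add: der_action_closed)
  show "dact (a \<odot>\<^bsub>G\<^esub> x) d = a \<odot>\<^bsub>DER\<^esub> dact x d"
    if "a \<in> carrier K" for a
    by (rule DerH_eqI) (use that in \<open>auto simp: der_action_apply act_rules bracket_smult_left
        a_minus_def N.smult_r_distr N.smult_r_minus\<close>)
  show "dact x (a \<odot>\<^bsub>DER\<^esub> d) = a \<odot>\<^bsub>DER\<^esub> dact x d"
    if "a \<in> carrier K" for a
    by (rule DerH_eqI) (use that in \<open>auto simp: der_action_apply act_rules
        a_minus_def N.smult_r_distr N.smult_r_minus\<close>)
  show "dact x (d \<oplus>\<^bsub>DER\<^esub> e) = dact x d \<oplus>\<^bsub>DER\<^esub> dact x e"
    if e: "e \<in> carrier DER" for e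
  proof (rule DerH_eqI)
    note [simp] = DerH_rules[OF e[simplified]]
    fix z assume [simp]: "z \<in> H"
    show "dact x (d \<oplus>\<^bsub>DER\<^esub> e) z =
        (dact x d \<oplus>\<^bsub>DER\<^esub> dact x e) z"
      apply (simp add: der_action_apply act_rules)
      by (rule N.M.formal_sum_eqI, (rule N.M.formal_sum_intros | (rule N.M.formal_sum_atom, simp))+, simp add: algebra_simps)
  qed simp_all
  fix y assume [simp]: "y \<in> carrier G"
  show "dact (x \<oplus>\<^bsub>G\<^esub> y) d = dact x d \<oplus>\<^bsub>DER\<^esub> dact y d"
  proof (rule DerH_eqI)
    fix z assume [simp]: "z \<in> H"
    show "dact (x \<oplus>\<^bsub>G\<^esub> y) d z =
        (dact x d \<oplus>\<^bsub>DER\<^esub> dact y d) z"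
      apply (simp add: der_action_apply act_rules bracket_add_left)
      by (rule N.M.formal_sum_eqI, (rule N.M.formal_sum_intros | (rule N.M.formal_sum_atom, simp))+, simp add: algebra_simps)
  qed simp_all
  have e: "dact y (dact x d) \<in> DerH"
    using d by (simp add: der_action_closed)
  show "dact \<lblot>x, y\<rblot>\<^bsub>G\<^esub> d = dact x (dact y d)
      \<ominus>\<^bsub>DER\<^esub> dact y (dact x d)"
    unfolding DER_minus[OF e]
  proof (rule DerH_eqI)
    fix z assume [simp]: "z \<in> H"
    show "dact \<lblot>x, y\<rblot>\<^bsub>G\<^esub> d z =
        (\<lambda>z\<in>H. dact x (dact y d) z
          \<ominus>\<^bsub>M\<^esub> dact y (dact x d) z) z"
      apply (simp add: der_action_apply act_rules act_bracket jacobi_left)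
      by (rule N.M.formal_sum_eqI, (rule N.M.formal_sum_intros | (rule N.M.formal_sum_atom, simp))+, simp add: algebra_simps)
  qed simp_all
qed

sublocale D: lie_module K G DER "dact"
  by (rule lie_module_der_action)

lemma inner_apply: "z \<in> H \<Longrightarrow> inn m z = act z m"
  by (simp add: inner_der_def)

lemma inner_ext [simp]: "inn m \<in> extensional H"
  by (simp add: inner_der_def)

lemma inner_closed: "m \<in> carrier M \<Longrightarrow> inn m \<in> DerH"
  by (rule h.inner_der_derivation)

lemma InnI: "m \<in> carrier M \<Longrightarrow> inn m \<in> InnH"
  by (simp add: Inn_def)

text \<open>Cartan's homotopy formula in degree one. It makes \<open>H\<close> act trivially on
  \<open>H^1(H, M)\<close>, so that the action of \<open>G\<close> descends to the quotient, and it
  is used again in the compatibility of the boundary map with the action.\<close>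

lemma der_action_ideal:
  assumes "z \<in> H" "d \<in> DerH"
  shows "dact z d = inn (d z)"
proof (rule DerH_eqI)
  note [simp] = DerH_rules[OF assms(2)] assms(1)
  fix w assume [simp]: "w \<in> H"
  show "dact z d w = inn (d z) w"
    apply (simp add: der_action_apply inner_apply DerH_bracket[OF assms(2)])
    by (rule N.M.formal_sum_eqI, (rule N.M.formal_sum_intros | (rule N.M.formal_sum_atom, simp))+, simp add: algebra_simps)
qed simp_all

text \<open>Makes the inner derivations stable under \<open>G\<close>, as the passage to
  \<open>H^1(H, M)\<close> requires.\<close>

lemma der_action_inner:
  assumes [simp]: "x \<in> carrier G" "m \<in> carrier M"
  shows "dact x (inn m) = inn (act x m)"
proof (rule DerH_eqI)
  fix w assume [simp]: "w \<in> H"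
  show "dact x (inn m) w = inn (act x m) w"
    apply (simp add: der_action_apply inner_apply act_bracket)
    by (rule N.M.formal_sum_eqI, (rule N.M.formal_sum_intros | (rule N.M.formal_sum_atom, simp))+, simp add: algebra_simps)
qed simp_all

lemma lie_module_V: "lie_module K G V (\<lambda>x C. \<Union>d\<in>C. InnH +>\<^bsub>DER\<^esub> dact x d)"
  and V_coset: "x \<in> carrier G \<Longrightarrow> d \<in> DerH \<Longrightarrow>
    (\<Union>d'\<in>InnH +>\<^bsub>DER\<^esub> d. InnH +>\<^bsub>DER\<^esub> dact x d') = InnH +>\<^bsub>DER\<^esub> dact x d"
proof -
  have st: "dact x u \<in> InnH" if "x \<in> carrier G" "u \<in> InnH" for x u
    using that by (auto simp: Inn_def der_action_inner)
  show "lie_module K G V (\<lambda>x C. \<Union>d\<in>C. InnH +>\<^bsub>DER\<^esub> dact x d)"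
    unfolding H1_def by (rule D.lie_module_quotient(2)) (rule h.submodule_Inn, rule st)
  show "(\<Union>d'\<in>InnH +>\<^bsub>DER\<^esub> d. InnH +>\<^bsub>DER\<^esub> dact x d') = InnH +>\<^bsub>DER\<^esub> dact x d"
    if "x \<in> carrier G" "d \<in> DerH"
    by (rule D.lie_module_quotient(1)) (use that h.submodule_Inn st in auto)
qed

abbreviation "cls d \<equiv> H1_class K G_H M act d"
abbreviation "DerQ \<equiv> derivations K Q V hact"
abbreviation "Cls D \<equiv> H1_class K Q V hact D"
abbreviation "X_ext D \<equiv> lam_ext K G H M act D"
abbreviation "X_cocycle D c \<equiv> crossed_cocycle K Q M_H (inv_action act) (X_ext D) c"

lemma V_cases:
  assumes "C \<in> carrier V"
  obtains d where "d \<in> DerH" "C = cls d"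
  using h.H1.quot_cases[OF assms] by (auto simp: H1_class_def)

lemma cls_rules:
  "d \<in> DerH \<Longrightarrow> cls d \<in> carrier V"
  "d \<in> DerH \<Longrightarrow> e \<in> DerH \<Longrightarrow> cls d \<oplus>\<^bsub>V\<^esub> cls e = cls (d \<oplus>\<^bsub>DER\<^esub> e)"
  "d \<in> DerH \<Longrightarrow> e \<in> DerH \<Longrightarrow> cls d \<ominus>\<^bsub>V\<^esub> cls e = cls (d \<ominus>\<^bsub>DER\<^esub> e)"
  "a \<in> carrier K \<Longrightarrow> d \<in> DerH \<Longrightarrow> a \<odot>\<^bsub>V\<^esub> cls d = cls (a \<odot>\<^bsub>DER\<^esub> d)"
  "d \<in> DerH \<Longrightarrow> e \<in> DerH \<Longrightarrow> cls d = cls e \<longleftrightarrow> (\<exists>m\<in>carrier M. d = inn m \<oplus>\<^bsub>DER\<^esub> e)"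
proof -
  show "d \<in> DerH \<Longrightarrow> cls d \<in> carrier V"
    "d \<in> DerH \<Longrightarrow> e \<in> DerH \<Longrightarrow> cls d \<oplus>\<^bsub>V\<^esub> cls e = cls (d \<oplus>\<^bsub>DER\<^esub> e)"
    "d \<in> DerH \<Longrightarrow> e \<in> DerH \<Longrightarrow> cls d \<ominus>\<^bsub>V\<^esub> cls e = cls (d \<ominus>\<^bsub>DER\<^esub> e)"
    "a \<in> carrier K \<Longrightarrow> d \<in> DerH \<Longrightarrow> a \<odot>\<^bsub>V\<^esub> cls d = cls (a \<odot>\<^bsub>DER\<^esub> d)"
    unfolding H1_class_def
    by (simp_all only: h.H1.coset_closed h.H1.coset_add h.H1.coset_minus h.H1.coset_smult h.Der_simps(1))
  assume d: "d \<in> DerH" and e: "e \<in> DerH"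
  have "cls d = cls e \<longleftrightarrow> d \<in> InnH +>\<^bsub>DER\<^esub> e"
    unfolding H1_class_def
    by (metis d e h.Der_simps(1) h.H1.U.a_rcos_self h.H1.U.a_repr_independence')
  also have "\<dots> \<longleftrightarrow> (\<exists>m\<in>carrier M. d = inn m \<oplus>\<^bsub>DER\<^esub> e)"
    unfolding h.H1.coset_def' by (auto simp: Inn_def simp del: DER_simps h.Der_simps)
  finally show "cls d = cls e \<longleftrightarrow> (\<exists>m\<in>carrier M. d = inn m \<oplus>\<^bsub>DER\<^esub> e)" .
qed

lemma H1_action_triv:
  assumes "z \<in> H" "C \<in> carrier V"
  shows "(\<Union>d\<in>C. InnH +>\<^bsub>DER\<^esub> dact z d) = \<zero>\<^bsub>V\<^esub>"
proof -
  obtain d where d: "d \<in> DerH" "C = cls d" using V_cases assms(2) by blast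
  have "(\<Union>d\<in>C. InnH +>\<^bsub>DER\<^esub> dact z d) = InnH +>\<^bsub>DER\<^esub> inn (d z)"
    using V_coset[of z d] d assms by (simp add: H1_class_def der_action_ideal)
  also have "\<dots> = InnH"
    using h.H1.coset_eq_zero_iff[of "inn (d z)"] d assms
    by (simp add: inner_closed InnI DerH_rules)
  finally show ?thesis using h.H1.zero_quot by simp
qed

text \<open>Two representatives of \<open>q x\<close> differ by an element of \<open>H\<close>,
  which acts by zero.\<close>

lemma H1_action_rep:
  assumes "x \<in> carrier G" "C \<in> carrier V"
  shows "hact (q x) C = (\<Union>d\<in>C. InnH +>\<^bsub>DER\<^esub> dact x d)"
proof -
  interpret V': lie_module K G V "\<lambda>x C. \<Union>d\<in>C. InnH +>\<^bsub>DER\<^esub> dact x d"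
    by (rule lie_module_V)
  show ?thesis
    unfolding H1_action_def H1_class_def
  proof (rule quot.coset_UN)
    fix u assume u: "u \<in> H"
    have "(\<Union>d\<in>C. InnH +>\<^bsub>DER\<^esub> dact (u \<oplus>\<^bsub>G\<^esub> x) d) =
      (\<Union>d\<in>C. InnH +>\<^bsub>DER\<^esub> dact u d) \<oplus>\<^bsub>V\<^esub> (\<Union>d\<in>C. InnH +>\<^bsub>DER\<^esub> dact x d)"
      using assms u by (intro V'.act_add_left) auto
    also have "\<dots> = (\<Union>d\<in>C. InnH +>\<^bsub>DER\<^esub> dact x d)"
      using V'.act_closed[OF assms] by (simp only: H1_action_triv[OF u assms(2)] h.H1.W.M.l_zero)
    finally show "(\<Union>d\<in>C. InnH +>\<^bsub>DER\<^esub> dact (u \<oplus>\<^bsub>G\<^esub> x) d) =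
      (\<Union>d\<in>C. InnH +>\<^bsub>DER\<^esub> dact x d)" .
  qed fact
qed

lemma H1_action_cls:
  "x \<in> carrier G \<Longrightarrow> d \<in> DerH \<Longrightarrow> hact (q x) (cls d) = cls (dact x d)"
  using H1_action_rep[of x "cls d"] V_coset[of x d] by (simp add: cls_rules H1_class_def)

sublocale V: lie_module K Q V "hact"
  by (rule lie_module_descend[OF lie_module_V]) (use H1_action_triv H1_action_rep in auto)

lemma invariantsD:
  assumes "m \<in> invariants M act H"
  shows "m \<in> carrier M" "z \<in> H \<Longrightarrow> act z m = \<zero>\<^bsub>M\<^esub>"
  using assms by (auto simp: invariants_def)

lemma submodule_invariants: "submodule (invariants M act H) K M"
  by (rule N.submoduleI) (auto simp: invariants_def act_rules)

text \<open>\<open>z (x m) = [z, x] m + x (z m)\<close>, and \<open>[z, x]\<close> lies in the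
  ideal.\<close>

lemma invariants_stable:
  assumes x: "x \<in> carrier G" and m: "m \<in> invariants M act H"
  shows "act x m \<in> invariants M act H"
proof -
  have "act z (act x m) = \<zero>\<^bsub>M\<^esub>" if z: "z \<in> H" for z
  proof -
    have "act \<lblot>z, x\<rblot>\<^bsub>G\<^esub> m = act z (act x m) \<ominus>\<^bsub>M\<^esub> act x (act z m)"
      using x z invariantsD(1)[OF m] by (simp add: act_bracket)
    moreover have "act \<lblot>z, x\<rblot>\<^bsub>G\<^esub> m = \<zero>\<^bsub>M\<^esub>" using x z m by (simp add: invariantsD(2))
    ultimately show ?thesis using x z invariantsD[OF m] by (simp add: act_rules)
  qed
  then show ?thesis using x m by (simp add: invariants_def)
qed

lemma inv_action_rep:
  assumes "x \<in> carrier G" "m \<in> invariants M act H"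
  shows "inv_action act (q x) m = act x m"
proof -
  have "act x' m = act x m" if "x' \<in> q x" for x'
    using that assms by (auto simp: quot.coset_def' act_rules invariantsD)
  moreover have "x \<in> q x" using assms quot.U.a_rcos_self by blast
  then have "q x \<noteq> {}" by blast
  ultimately show ?thesis
    unfolding inv_action_def by (intro the_elem_image_unique)
qed

sublocale I: lie_module K Q M_H "inv_action act"
  by (rule lie_module_descend[OF lie_module_submodule[OF submodule_invariants]])
    (auto simp: invariants_stable invariantsD inv_action_rep)

end

section \<open>Connections and 3-cocycles\<close>

lemma ce_diff2_apply:
  "x \<in> carrier L \<Longrightarrow> y \<in> carrier L \<Longrightarrow> z \<in> carrier L \<Longrightarrow> ce_diff2 L N act b (x, y, z) =
    act x (b (y, z)) \<ominus>\<^bsub>N\<^esub> act y (b (x, z)) \<oplus>\<^bsub>N\<^esub> act z (b (x, y))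
    \<ominus>\<^bsub>N\<^esub> b (\<lblot>x, y\<rblot>\<^bsub>L\<^esub>, z) \<oplus>\<^bsub>N\<^esub> b (\<lblot>x, z\<rblot>\<^bsub>L\<^esub>, y) \<ominus>\<^bsub>N\<^esub> b (\<lblot>y, z\<rblot>\<^bsub>L\<^esub>, x)"
  by (simp add: ce_diff2_def)

lemma ce_diff3_apply:
  "x \<in> carrier L \<Longrightarrow> y \<in> carrier L \<Longrightarrow> z \<in> carrier L \<Longrightarrow> w \<in> carrier L \<Longrightarrow> ce_diff3 L N act c (x, y, z, w) =
    act x (c (y, z, w)) \<ominus>\<^bsub>N\<^esub> act y (c (x, z, w)) \<oplus>\<^bsub>N\<^esub> act z (c (x, y, w)) \<ominus>\<^bsub>N\<^esub> act w (c (x, y, z))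
    \<ominus>\<^bsub>N\<^esub> c (\<lblot>x, y\<rblot>\<^bsub>L\<^esub>, z, w) \<oplus>\<^bsub>N\<^esub> c (\<lblot>x, z\<rblot>\<^bsub>L\<^esub>, y, w) \<ominus>\<^bsub>N\<^esub> c (\<lblot>x, w\<rblot>\<^bsub>L\<^esub>, y, z)
    \<ominus>\<^bsub>N\<^esub> c (\<lblot>y, z\<rblot>\<^bsub>L\<^esub>, x, w) \<oplus>\<^bsub>N\<^esub> c (\<lblot>y, w\<rblot>\<^bsub>L\<^esub>, x, z) \<ominus>\<^bsub>N\<^esub> c (\<lblot>z, w\<rblot>\<^bsub>L\<^esub>, x, y)"
  by (simp add: ce_diff3_def)

text \<open>Stated for bare families of operators, because operators along a linear section do not
  form an action of \<open>L\<close>. It carries the Bianchi identity and the cocycles along linear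
  maps such as the boundary map.\<close>

lemma ce_diff2_natural:
  assumes "lie_algebra K L" "module K A" "module K B" and \<phi>: "\<phi> \<in> lin_hom K A B"
    and f: "\<And>x y. x \<in> carrier L \<Longrightarrow> y \<in> carrier L \<Longrightarrow> f (x, y) \<in> carrier A"
    and g: "\<And>x y. x \<in> carrier L \<Longrightarrow> y \<in> carrier L \<Longrightarrow> g (x, y) = \<phi> (f (x, y))"
    and op: "\<And>x a. x \<in> carrier L \<Longrightarrow> a \<in> carrier A \<Longrightarrow> op x a \<in> carrier A"
    "\<And>x a. x \<in> carrier L \<Longrightarrow> a \<in> carrier A \<Longrightarrow> op' x (\<phi> a) = \<phi> (op x a)"
    and t: "t \<in> carrier L \<times> carrier L \<times> carrier L"
  shows "ce_diff2 L B op' g t = \<phi> (ce_diff2 L A op f t)"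
proof -
  interpret lie_algebra K L by fact
  interpret A: module K A by fact
  interpret B: module K B by fact
  obtain x y z where "t = (x, y, z)" "x \<in> carrier L" "y \<in> carrier L" "z \<in> carrier L"
    using t by auto
  then show ?thesis
    by (simp add: ce_diff2_apply f g op lin_homD[OF \<phi>] lin_hom_additive[OF assms(2,3) \<phi>])
qed

lemma ce_diff3_natural:
  assumes "lie_algebra K L" "module K A" "module K B" and \<phi>: "\<phi> \<in> lin_hom K A B"
    and f: "\<And>x y z. x \<in> carrier L \<Longrightarrow> y \<in> carrier L \<Longrightarrow> z \<in> carrier L \<Longrightarrow> f (x, y, z) \<in> carrier A"
    and g: "\<And>x y z. x \<in> carrier L \<Longrightarrow> y \<in> carrier L \<Longrightarrow> z \<in> carrier L \<Longrightarrow> g (x, y, z) = \<phi> (f (x, y, z))"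
    and op: "\<And>x a. x \<in> carrier L \<Longrightarrow> a \<in> carrier A \<Longrightarrow> op x a \<in> carrier A"
    "\<And>x a. x \<in> carrier L \<Longrightarrow> a \<in> carrier A \<Longrightarrow> op' x (\<phi> a) = \<phi> (op x a)"
    and t: "t \<in> carrier L \<times> carrier L \<times> carrier L \<times> carrier L"
  shows "ce_diff3 L B op' g t = \<phi> (ce_diff3 L A op f t)"
proof -
  interpret lie_algebra K L by fact
  interpret A: module K A by fact
  interpret B: module K B by fact
  obtain x y z w where "t = (x, y, z, w)" "x \<in> carrier L" "y \<in> carrier L" "z \<in> carrier L" "w \<in> carrier L"
    using t by auto
  then show ?thesis
    by (simp add: ce_diff3_apply f g op lin_homD[OF \<phi>] lin_hom_additive[OF assms(2,3) \<phi>])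
qed

text \<open>Used at fixed arguments to eliminate one of the three double brackets of a triple, after
  which the remaining ones can be treated as independent atoms.\<close>

lemma (in lie_algebra) jacobi_cyclic:
  assumes "x \<in> carrier L" "y \<in> carrier L" "z \<in> carrier L"
  shows "\<lblot>\<lblot>x, y\<rblot>\<^bsub>L\<^esub>, z\<rblot>\<^bsub>L\<^esub> = \<lblot>\<lblot>x, z\<rblot>\<^bsub>L\<^esub>, y\<rblot>\<^bsub>L\<^esub> \<ominus>\<^bsub>L\<^esub> \<lblot>\<lblot>y, z\<rblot>\<^bsub>L\<^esub>, x\<rblot>\<^bsub>L\<^esub>"
proof -
  have "\<lblot>\<lblot>x, z\<rblot>\<^bsub>L\<^esub>, y\<rblot>\<^bsub>L\<^esub> = \<ominus>\<^bsub>L\<^esub> \<lblot>y, \<lblot>x, z\<rblot>\<^bsub>L\<^esub>\<rblot>\<^bsub>L\<^esub>" "\<lblot>\<lblot>y, z\<rblot>\<^bsub>L\<^esub>, x\<rblot>\<^bsub>L\<^esub> = \<ominus>\<^bsub>L\<^esub> \<lblot>x, \<lblot>y, z\<rblot>\<^bsub>L\<^esub>\<rblot>\<^bsub>L\<^esub>"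
    using assms by (auto intro: bracket_antisym)
  then show ?thesis
    apply (insert assms, simp add: jacobi_left)
    by (rule M.formal_sum_eqI, (rule M.formal_sum_intros | (rule M.formal_sum_atom, simp))+, simp add: algebra_simps)
qed

section \<open>Curvature of a linear map and the Bianchi identity\<close>

lemma curvature_alt_bilinear:
  assumes "lie_algebra K Q" "lie_algebra K L" and \<tau>: "\<tau> \<in> lin_hom K Q L"
  shows "(\<lambda>(x, y)\<in>carrier Q \<times> carrier Q. \<lblot>\<tau> x, \<tau> y\<rblot>\<^bsub>L\<^esub> \<ominus>\<^bsub>L\<^esub> \<tau> \<lblot>x, y\<rblot>\<^bsub>Q\<^esub>) \<in> alt_bilinear K Q L"
proof -
  interpret Q: lie_algebra K Q by fact
  interpret L: lie_algebra K L by fact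
  note [simp] = lin_homD[OF \<tau>] lin_hom_additive[OF Q.module_axioms L.module_axioms \<tau>]
  show ?thesis
  proof (rule alt_bilinearI)
    fix x y z assume [simp]: "x \<in> carrier Q" "y \<in> carrier Q" "z \<in> carrier Q"
    show "(\<lambda>(x, y)\<in>carrier Q \<times> carrier Q. \<lblot>\<tau> x, \<tau> y\<rblot>\<^bsub>L\<^esub> \<ominus>\<^bsub>L\<^esub> \<tau> \<lblot>x, y\<rblot>\<^bsub>Q\<^esub>) (x \<oplus>\<^bsub>Q\<^esub> y, z) =
      (\<lambda>(x, y)\<in>carrier Q \<times> carrier Q. \<lblot>\<tau> x, \<tau> y\<rblot>\<^bsub>L\<^esub> \<ominus>\<^bsub>L\<^esub> \<tau> \<lblot>x, y\<rblot>\<^bsub>Q\<^esub>) (x, z) \<oplus>\<^bsub>L\<^esub>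
      (\<lambda>(x, y)\<in>carrier Q \<times> carrier Q. \<lblot>\<tau> x, \<tau> y\<rblot>\<^bsub>L\<^esub> \<ominus>\<^bsub>L\<^esub> \<tau> \<lblot>x, y\<rblot>\<^bsub>Q\<^esub>) (y, z)"
      apply (simp add: L.bracket_add_left Q.bracket_add_left)
      by (rule L.M.formal_sum_eqI, (rule L.M.formal_sum_intros | (rule L.M.formal_sum_atom, simp))+, simp add: algebra_simps)
    show "(\<lambda>(x, y)\<in>carrier Q \<times> carrier Q. \<lblot>\<tau> x, \<tau> y\<rblot>\<^bsub>L\<^esub> \<ominus>\<^bsub>L\<^esub> \<tau> \<lblot>x, y\<rblot>\<^bsub>Q\<^esub>) (x, y \<oplus>\<^bsub>Q\<^esub> z) =
      (\<lambda>(x, y)\<in>carrier Q \<times> carrier Q. \<lblot>\<tau> x, \<tau> y\<rblot>\<^bsub>L\<^esub> \<ominus>\<^bsub>L\<^esub> \<tau> \<lblot>x, y\<rblot>\<^bsub>Q\<^esub>) (x, y) \<oplus>\<^bsub>L\<^esub>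
      (\<lambda>(x, y)\<in>carrier Q \<times> carrier Q. \<lblot>\<tau> x, \<tau> y\<rblot>\<^bsub>L\<^esub> \<ominus>\<^bsub>L\<^esub> \<tau> \<lblot>x, y\<rblot>\<^bsub>Q\<^esub>) (x, z)"
      apply (simp add: L.bracket_add_right Q.bracket_add_right)
      by (rule L.M.formal_sum_eqI, (rule L.M.formal_sum_intros | (rule L.M.formal_sum_atom, simp))+, simp add: algebra_simps)
  qed (auto simp: L.bracket_smult_left Q.bracket_smult_left L.bracket_smult_right
      Q.bracket_smult_right L.bracket_alternating Q.bracket_alternating a_minus_def
      L.smult_r_distr L.smult_r_minus)
qed

text \<open>The double brackets of values of \<open>\<tau>\<close> cancel by the Jacobi identity in
  \<open>L\<close>, the values of \<open>\<tau>\<close> on double brackets by the one in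
  \<open>Q\<close>, and the mixed terms in pairs by antisymmetry.\<close>

lemma bianchi:
  assumes "lie_algebra K Q" "lie_algebra K L" and \<tau>: "\<tau> \<in> lin_hom K Q L"
    and \<kappa>: "\<And>x y. x \<in> carrier Q \<Longrightarrow> y \<in> carrier Q \<Longrightarrow> \<kappa> (x, y) = \<lblot>\<tau> x, \<tau> y\<rblot>\<^bsub>L\<^esub> \<ominus>\<^bsub>L\<^esub> \<tau> \<lblot>x, y\<rblot>\<^bsub>Q\<^esub>"
    and t: "t \<in> carrier Q \<times> carrier Q \<times> carrier Q"
  shows "ce_diff2 Q L (\<lambda>x. lie_bracket L (\<tau> x)) \<kappa> t = \<zero>\<^bsub>L\<^esub>"
proof -
  interpret Q: lie_algebra K Q by fact
  interpret L: lie_algebra K L by fact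
  note [simp] = lin_homD[OF \<tau>] lin_hom_additive[OF Q.module_axioms L.module_axioms \<tau>]
  obtain x y z where t': "t = (x, y, z)" and [simp]: "x \<in> carrier Q" "y \<in> carrier Q" "z \<in> carrier Q"
    using t by auto
  have "\<lblot>\<tau> \<lblot>x, y\<rblot>\<^bsub>Q\<^esub>, \<tau> z\<rblot>\<^bsub>L\<^esub> = \<ominus>\<^bsub>L\<^esub> \<lblot>\<tau> z, \<tau> \<lblot>x, y\<rblot>\<^bsub>Q\<^esub>\<rblot>\<^bsub>L\<^esub>"
    "\<lblot>\<tau> \<lblot>x, z\<rblot>\<^bsub>Q\<^esub>, \<tau> y\<rblot>\<^bsub>L\<^esub> = \<ominus>\<^bsub>L\<^esub> \<lblot>\<tau> y, \<tau> \<lblot>x, z\<rblot>\<^bsub>Q\<^esub>\<rblot>\<^bsub>L\<^esub>"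
    "\<lblot>\<tau> \<lblot>y, z\<rblot>\<^bsub>Q\<^esub>, \<tau> x\<rblot>\<^bsub>L\<^esub> = \<ominus>\<^bsub>L\<^esub> \<lblot>\<tau> x, \<tau> \<lblot>y, z\<rblot>\<^bsub>Q\<^esub>\<rblot>\<^bsub>L\<^esub>"
    "\<lblot>\<tau> z, \<lblot>\<tau> x, \<tau> y\<rblot>\<^bsub>L\<^esub>\<rblot>\<^bsub>L\<^esub> = \<ominus>\<^bsub>L\<^esub> \<lblot>\<lblot>\<tau> x, \<tau> y\<rblot>\<^bsub>L\<^esub>, \<tau> z\<rblot>\<^bsub>L\<^esub>"
    by (auto intro: L.bracket_antisym)
  then show ?thesis
    apply (simp add: t' ce_diff2_apply \<kappa> L.bracket_additive L.jacobi_left[of "\<tau> x"]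
        Q.jacobi_cyclic[of x y z])
    by (rule L.M.formal_sum_eqI, (rule L.M.formal_sum_intros | (rule L.M.formal_sum_atom, simp))+, simp add: algebra_simps)
qed

text \<open>An action of \<open>Q\<close> on \<open>A\<close> by derivations up to inner ones: the
  factor set \<open>(op, f)\<close> of a non-abelian extension of \<open>Q\<close> by
  \<open>A\<close>, except that \<open>ce_diff2 Q A op f\<close> may be nonzero. That defect is the
  obstruction cocycle.\<close>

locale lie_connection = Q: lie_algebra K Q + A: lie_algebra K A
  for K and Q and A +
  fixes op and f
  assumes op_closed [simp]: "x \<in> carrier Q \<Longrightarrow> a \<in> carrier A \<Longrightarrow> op x a \<in> carrier A"
    and op_add_left: "x \<in> carrier Q \<Longrightarrow> y \<in> carrier Q \<Longrightarrow> a \<in> carrier A \<Longrightarrow>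
      op (x \<oplus>\<^bsub>Q\<^esub> y) a = op x a \<oplus>\<^bsub>A\<^esub> op y a"
    and op_add_right: "x \<in> carrier Q \<Longrightarrow> a \<in> carrier A \<Longrightarrow> b \<in> carrier A \<Longrightarrow>
      op x (a \<oplus>\<^bsub>A\<^esub> b) = op x a \<oplus>\<^bsub>A\<^esub> op x b"
    and op_smult_left: "k \<in> carrier K \<Longrightarrow> x \<in> carrier Q \<Longrightarrow> a \<in> carrier A \<Longrightarrow>
      op (k \<odot>\<^bsub>Q\<^esub> x) a = k \<odot>\<^bsub>A\<^esub> op x a"
    and op_smult_right: "k \<in> carrier K \<Longrightarrow> x \<in> carrier Q \<Longrightarrow> a \<in> carrier A \<Longrightarrow>
      op x (k \<odot>\<^bsub>A\<^esub> a) = k \<odot>\<^bsub>A\<^esub> op x a"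
    and op_bracket: "x \<in> carrier Q \<Longrightarrow> a \<in> carrier A \<Longrightarrow> b \<in> carrier A \<Longrightarrow>
      op x \<lblot>a, b\<rblot>\<^bsub>A\<^esub> = \<lblot>op x a, b\<rblot>\<^bsub>A\<^esub> \<oplus>\<^bsub>A\<^esub> \<lblot>a, op x b\<rblot>\<^bsub>A\<^esub>"
    and f: "f \<in> alt_bilinear K Q A"
    and op_curvature: "x \<in> carrier Q \<Longrightarrow> y \<in> carrier Q \<Longrightarrow> a \<in> carrier A \<Longrightarrow>
      op x (op y a) = op y (op x a) \<oplus>\<^bsub>A\<^esub> op \<lblot>x, y\<rblot>\<^bsub>Q\<^esub> a \<oplus>\<^bsub>A\<^esub> \<lblot>f (x, y), a\<rblot>\<^bsub>A\<^esub>"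
begin

lemma op_zero:
  "a \<in> carrier A \<Longrightarrow> op \<zero>\<^bsub>Q\<^esub> a = \<zero>\<^bsub>A\<^esub>" "x \<in> carrier Q \<Longrightarrow> op x \<zero>\<^bsub>A\<^esub> = \<zero>\<^bsub>A\<^esub>"
  using additive_map(1)[OF Q.M.abelian_group_axioms A.M.abelian_group_axioms, of "\<lambda>x. op x a"]
    additive_map(1)[OF A.M.abelian_group_axioms A.M.abelian_group_axioms, of "op x"]
  by (auto simp: op_add_left op_add_right)

lemma op_additive:
  assumes "x \<in> carrier Q" "a \<in> carrier A"
  shows "op (\<ominus>\<^bsub>Q\<^esub> x) a = \<ominus>\<^bsub>A\<^esub> op x a" "op x (\<ominus>\<^bsub>A\<^esub> a) = \<ominus>\<^bsub>A\<^esub> op x a"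
    "y \<in> carrier Q \<Longrightarrow> op (x \<ominus>\<^bsub>Q\<^esub> y) a = op x a \<ominus>\<^bsub>A\<^esub> op y a"
    "b \<in> carrier A \<Longrightarrow> op x (a \<ominus>\<^bsub>A\<^esub> b) = op x a \<ominus>\<^bsub>A\<^esub> op x b"
  using additive_map[OF Q.M.abelian_group_axioms A.M.abelian_group_axioms, of "\<lambda>x. op x a"]
    additive_map[OF A.M.abelian_group_axioms A.M.abelian_group_axioms, of "op x"] assms
  by (auto simp: op_add_left op_add_right)

lemmas op_rules = op_add_left op_add_right op_smult_left op_smult_right op_zero op_additive

lemmas f_rules = alt_bilinearD[OF f] alt_bilinear_additive[OF Q.module_axioms A.module_axioms f]
lemmas f_antisym = alt_bilinear_antisym[OF Q.module_axioms A.module_axioms f]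

lemma ce_diff2_closed:
  "x \<in> carrier Q \<Longrightarrow> y \<in> carrier Q \<Longrightarrow> z \<in> carrier Q \<Longrightarrow> ce_diff2 Q A op f (x, y, z) \<in> carrier A"
  by (simp add: ce_diff2_apply f_rules)

text \<open>Compared with a genuine action, the curvature adds the terms
  \<open>[f (x, y), f (z, w)]\<close>. Each complementary pair of arguments occurs in both orders
  with the same sign, so these terms cancel by antisymmetry.\<close>

lemma ce_diff3_ce_diff2:
  assumes [simp]: "x \<in> carrier Q" "y \<in> carrier Q" "z \<in> carrier Q" "w \<in> carrier Q"
  shows "ce_diff3 Q A op (ce_diff2 Q A op f) (x, y, z, w) = \<zero>\<^bsub>A\<^esub>"
proof -
  note [simp] = f_rules
  \<comment> \<open>As general rewrite rules, the curvature equation and antisymmetry could be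
    applied back and forth; the listed instances orient each exchange once.\<close>
  note curv = op_curvature[of x y "f (z, w)"] op_curvature[of x z "f (y, w)"]
    op_curvature[of x w "f (y, z)"] op_curvature[of y z "f (x, w)"]
    op_curvature[of y w "f (x, z)"] op_curvature[of z w "f (x, y)"]
  note br = A.bracket_antisym[of "f (z, w)" "f (x, y)"] A.bracket_antisym[of "f (y, w)" "f (x, z)"]
    A.bracket_antisym[of "f (y, z)" "f (x, w)"]
  note as = f_antisym[of "\<lblot>z, w\<rblot>\<^bsub>Q\<^esub>" "\<lblot>x, y\<rblot>\<^bsub>Q\<^esub>"] f_antisym[of "\<lblot>y, w\<rblot>\<^bsub>Q\<^esub>" "\<lblot>x, z\<rblot>\<^bsub>Q\<^esub>"]
    f_antisym[of "\<lblot>y, z\<rblot>\<^bsub>Q\<^esub>" "\<lblot>x, w\<rblot>\<^bsub>Q\<^esub>"]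
  note jac = Q.jacobi_cyclic[of x y z] Q.jacobi_cyclic[of x y w] Q.jacobi_cyclic[of x z w]
    Q.jacobi_cyclic[of y z w]
  show ?thesis
    apply (simp add: ce_diff3_apply ce_diff2_apply op_rules)
    apply (simp add: curv br as jac)
    by (rule A.M.formal_sum_eqI, (rule A.M.formal_sum_intros | (rule A.M.formal_sum_atom, simp))+, simp add: algebra_simps)
qed

lemma ce_diff2_trilinear:
  assumes [simp]: "x \<in> carrier Q" "y \<in> carrier Q" "z \<in> carrier Q"
  shows
    "x' \<in> carrier Q \<Longrightarrow> ce_diff2 Q A op f (x \<oplus>\<^bsub>Q\<^esub> x', y, z) =
      ce_diff2 Q A op f (x, y, z) \<oplus>\<^bsub>A\<^esub> ce_diff2 Q A op f (x', y, z)"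
    "x' \<in> carrier Q \<Longrightarrow> ce_diff2 Q A op f (y, x \<oplus>\<^bsub>Q\<^esub> x', z) =
      ce_diff2 Q A op f (y, x, z) \<oplus>\<^bsub>A\<^esub> ce_diff2 Q A op f (y, x', z)"
    "x' \<in> carrier Q \<Longrightarrow> ce_diff2 Q A op f (y, z, x \<oplus>\<^bsub>Q\<^esub> x') =
      ce_diff2 Q A op f (y, z, x) \<oplus>\<^bsub>A\<^esub> ce_diff2 Q A op f (y, z, x')"
    "k \<in> carrier K \<Longrightarrow> ce_diff2 Q A op f (k \<odot>\<^bsub>Q\<^esub> x, y, z) = k \<odot>\<^bsub>A\<^esub> ce_diff2 Q A op f (x, y, z)"
    "k \<in> carrier K \<Longrightarrow> ce_diff2 Q A op f (y, k \<odot>\<^bsub>Q\<^esub> x, z) = k \<odot>\<^bsub>A\<^esub> ce_diff2 Q A op f (y, x, z)"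
    "k \<in> carrier K \<Longrightarrow> ce_diff2 Q A op f (y, z, k \<odot>\<^bsub>Q\<^esub> x) = k \<odot>\<^bsub>A\<^esub> ce_diff2 Q A op f (y, z, x)"
proof -
  note [simp] = f_rules
  show "ce_diff2 Q A op f (x \<oplus>\<^bsub>Q\<^esub> x', y, z) =
      ce_diff2 Q A op f (x, y, z) \<oplus>\<^bsub>A\<^esub> ce_diff2 Q A op f (x', y, z)" if [simp]: "x' \<in> carrier Q"
    apply (simp add: ce_diff2_apply op_rules Q.bracket_add_left)
    by (rule A.M.formal_sum_eqI, (rule A.M.formal_sum_intros | (rule A.M.formal_sum_atom, simp))+, simp add: algebra_simps)
  show "ce_diff2 Q A op f (y, x \<oplus>\<^bsub>Q\<^esub> x', z) =
      ce_diff2 Q A op f (y, x, z) \<oplus>\<^bsub>A\<^esub> ce_diff2 Q A op f (y, x', z)" if [simp]: "x' \<in> carrier Q"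
    apply (simp add: ce_diff2_apply op_rules Q.bracket_add_left Q.bracket_add_right)
    by (rule A.M.formal_sum_eqI, (rule A.M.formal_sum_intros | (rule A.M.formal_sum_atom, simp))+, simp add: algebra_simps)
  show "ce_diff2 Q A op f (y, z, x \<oplus>\<^bsub>Q\<^esub> x') =
      ce_diff2 Q A op f (y, z, x) \<oplus>\<^bsub>A\<^esub> ce_diff2 Q A op f (y, z, x')" if [simp]: "x' \<in> carrier Q"
    apply (simp add: ce_diff2_apply op_rules Q.bracket_add_right)
    by (rule A.M.formal_sum_eqI, (rule A.M.formal_sum_intros | (rule A.M.formal_sum_atom, simp))+, simp add: algebra_simps)
qed (simp_all add: ce_diff2_apply op_rules f_rules Q.bracket_smult_left Q.bracket_smult_right
    a_minus_def A.smult_r_distr A.smult_r_minus)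

text \<open>Computed on repeated arguments, since antisymmetry would not suffice in characteristic
  2.\<close>

lemma ce_diff2_alternating:
  assumes [simp]: "x \<in> carrier Q" "y \<in> carrier Q"
  shows "ce_diff2 Q A op f (x, x, y) = \<zero>\<^bsub>A\<^esub>" "ce_diff2 Q A op f (x, y, x) = \<zero>\<^bsub>A\<^esub>"
    "ce_diff2 Q A op f (y, x, x) = \<zero>\<^bsub>A\<^esub>"
proof -
  note [simp] = f_rules
  have a: "f (y, x) = \<ominus>\<^bsub>A\<^esub> f (x, y)" by (rule f_antisym) simp_all
  have b: "\<lblot>y, x\<rblot>\<^bsub>Q\<^esub> = \<ominus>\<^bsub>Q\<^esub> \<lblot>x, y\<rblot>\<^bsub>Q\<^esub>" by (rule Q.bracket_antisym) simp_all
  show "ce_diff2 Q A op f (x, x, y) = \<zero>\<^bsub>A\<^esub>"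
    by (simp add: ce_diff2_apply op_rules Q.bracket_alternating)
  show "ce_diff2 Q A op f (x, y, x) = \<zero>\<^bsub>A\<^esub>"
    apply (simp add: ce_diff2_apply op_rules Q.bracket_alternating a b)
    by (rule A.M.formal_sum_eqI, (rule A.M.formal_sum_intros | (rule A.M.formal_sum_atom, simp))+, simp add: algebra_simps)
  show "ce_diff2 Q A op f (y, x, x) = \<zero>\<^bsub>A\<^esub>"
    apply (simp add: ce_diff2_apply op_rules Q.bracket_alternating)
    by (rule A.M.formal_sum_eqI, (rule A.M.formal_sum_intros | (rule A.M.formal_sum_atom, simp))+, simp add: algebra_simps)
qed

text \<open>Replacing the connection \<open>op\<close> by \<open>op + ad \<eta>\<close> changes its curvature by
  \<open>d \<eta> + [\<eta>, \<eta>]\<close>, and leaves the covariant derivative of the curvature unchanged.\<close>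

lemma ce_diff2_change:
  assumes \<eta>: "\<eta> \<in> lin_hom K Q A"
    and op': "\<And>x a. x \<in> carrier Q \<Longrightarrow> a \<in> carrier A \<Longrightarrow> op' x a = op x a \<oplus>\<^bsub>A\<^esub> \<lblot>\<eta> x, a\<rblot>\<^bsub>A\<^esub>"
    and f': "\<And>x y. x \<in> carrier Q \<Longrightarrow> y \<in> carrier Q \<Longrightarrow> f' (x, y) =
      f (x, y) \<oplus>\<^bsub>A\<^esub> (op x (\<eta> y) \<ominus>\<^bsub>A\<^esub> op y (\<eta> x) \<ominus>\<^bsub>A\<^esub> \<eta> \<lblot>x, y\<rblot>\<^bsub>Q\<^esub> \<oplus>\<^bsub>A\<^esub> \<lblot>\<eta> x, \<eta> y\<rblot>\<^bsub>A\<^esub>)"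
    and [simp]: "x \<in> carrier Q" "y \<in> carrier Q" "z \<in> carrier Q"
  shows "ce_diff2 Q A op' f' (x, y, z) = ce_diff2 Q A op f (x, y, z)"
proof -
  note [simp] = f_rules lin_homD[OF \<eta>] lin_hom_additive[OF Q.module_axioms A.module_axioms \<eta>]
  note curv = op_curvature[of x y "\<eta> z"] op_curvature[of x z "\<eta> y"] op_curvature[of y z "\<eta> x"]
  note as = A.bracket_antisym[of "op x (\<eta> y)" "\<eta> z"] A.bracket_antisym[of "op x (\<eta> z)" "\<eta> y"]
    A.bracket_antisym[of "op y (\<eta> x)" "\<eta> z"] A.bracket_antisym[of "op y (\<eta> z)" "\<eta> x"]
    A.bracket_antisym[of "op z (\<eta> x)" "\<eta> y"] A.bracket_antisym[of "op z (\<eta> y)" "\<eta> x"]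
    A.bracket_antisym[of "f (x, y)" "\<eta> z"] A.bracket_antisym[of "f (x, z)" "\<eta> y"]
    A.bracket_antisym[of "f (y, z)" "\<eta> x"]
    A.bracket_antisym[of "\<eta> \<lblot>x, y\<rblot>\<^bsub>Q\<^esub>" "\<eta> z"] A.bracket_antisym[of "\<eta> \<lblot>x, z\<rblot>\<^bsub>Q\<^esub>" "\<eta> y"]
    A.bracket_antisym[of "\<eta> \<lblot>y, z\<rblot>\<^bsub>Q\<^esub>" "\<eta> x"]
  \<comment> \<open>For the terms cubic in \<open>\<eta>\<close>, which come from
    \<open>[\<eta>, [\<eta>, \<eta>]]\<close> and cancel by the Jacobi identity.\<close>
  have jac: "\<lblot>\<eta> x, \<lblot>\<eta> y, \<eta> z\<rblot>\<^bsub>A\<^esub>\<rblot>\<^bsub>A\<^esub> = \<lblot>\<eta> y, \<lblot>\<eta> x, \<eta> z\<rblot>\<^bsub>A\<^esub>\<rblot>\<^bsub>A\<^esub> \<ominus>\<^bsub>A\<^esub> \<lblot>\<eta> z, \<lblot>\<eta> x, \<eta> y\<rblot>\<^bsub>A\<^esub>\<rblot>\<^bsub>A\<^esub>"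
  proof -
    have "\<lblot>\<eta> z, \<lblot>\<eta> x, \<eta> y\<rblot>\<^bsub>A\<^esub>\<rblot>\<^bsub>A\<^esub> = \<ominus>\<^bsub>A\<^esub> (\<lblot>\<eta> x, \<lblot>\<eta> y, \<eta> z\<rblot>\<^bsub>A\<^esub>\<rblot>\<^bsub>A\<^esub> \<ominus>\<^bsub>A\<^esub> \<lblot>\<eta> y, \<lblot>\<eta> x, \<eta> z\<rblot>\<^bsub>A\<^esub>\<rblot>\<^bsub>A\<^esub>)"
      using A.bracket_antisym[of "\<eta> z" "\<lblot>\<eta> x, \<eta> y\<rblot>\<^bsub>A\<^esub>"] A.jacobi_left[of "\<eta> x" "\<eta> y" "\<eta> z"] by simp
    then show ?thesis
      apply simp
      by (rule A.M.formal_sum_eqI, (rule A.M.formal_sum_intros | (rule A.M.formal_sum_atom, simp))+, simp add: algebra_simps)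
  qed
  show ?thesis
    apply (simp add: ce_diff2_apply op' f' op_rules op_bracket A.bracket_add_right A.bracket_additive)
    apply (simp add: curv as jac Q.jacobi_cyclic[of x y z])
    by (rule A.M.formal_sum_eqI, (rule A.M.formal_sum_intros | (rule A.M.formal_sum_atom, simp))+, simp add: algebra_simps)
qed

end

section \<open>Cochains and classes in third cohomology\<close>

context lie_module
begin

lemma ce_diff2_add:
  assumes f: "f \<in> alt_bilinear K L N" and g: "g \<in> alt_bilinear K L N"
  shows "(\<lambda>t\<in>carrier L \<times> carrier L. f t \<oplus>\<^bsub>N\<^esub> g t) \<in> alt_bilinear K L N"
    "t \<in> carrier L \<times> carrier L \<times> carrier L \<Longrightarrow>
      ce_diff2 L N act (\<lambda>t\<in>carrier L \<times> carrier L. f t \<oplus>\<^bsub>N\<^esub> g t) t =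
      ce_diff2 L N act f t \<oplus>\<^bsub>N\<^esub> ce_diff2 L N act g t"
proof -
  note [simp] = alt_bilinearD[OF f] alt_bilinearD[OF g]
  show "(\<lambda>t\<in>carrier L \<times> carrier L. f t \<oplus>\<^bsub>N\<^esub> g t) \<in> alt_bilinear K L N"
    by (rule alt_bilinearI) (auto simp: N.M.a_ac N.smult_r_distr)
  show "ce_diff2 L N act (\<lambda>t\<in>carrier L \<times> carrier L. f t \<oplus>\<^bsub>N\<^esub> g t) t =
      ce_diff2 L N act f t \<oplus>\<^bsub>N\<^esub> ce_diff2 L N act g t" if t: "t \<in> carrier L \<times> carrier L \<times> carrier L"
  proof -
    obtain x y z where t: "t = (x, y, z)" and [simp]: "x \<in> carrier L" "y \<in> carrier L" "z \<in> carrier L"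
      using t by auto
    show ?thesis
      unfolding t
      apply (simp add: ce_diff2_apply act_rules)
      by (rule N.M.formal_sum_eqI, (rule N.M.formal_sum_intros | (rule N.M.formal_sum_atom, simp))+, simp add: algebra_simps)
  qed
qed

lemma ce_diff2_uminus:
  assumes f: "f \<in> alt_bilinear K L N"
  shows "(\<lambda>t\<in>carrier L \<times> carrier L. \<ominus>\<^bsub>N\<^esub> f t) \<in> alt_bilinear K L N"
    "t \<in> carrier L \<times> carrier L \<times> carrier L \<Longrightarrow>
      ce_diff2 L N act (\<lambda>t\<in>carrier L \<times> carrier L. \<ominus>\<^bsub>N\<^esub> f t) t = \<ominus>\<^bsub>N\<^esub> ce_diff2 L N act f t"
proof -
  note [simp] = alt_bilinearD[OF f]
  show "(\<lambda>t\<in>carrier L \<times> carrier L. \<ominus>\<^bsub>N\<^esub> f t) \<in> alt_bilinear K L N"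
    by (rule alt_bilinearI) (auto simp: N.M.minus_add N.smult_r_minus)
  show "ce_diff2 L N act (\<lambda>t\<in>carrier L \<times> carrier L. \<ominus>\<^bsub>N\<^esub> f t) t = \<ominus>\<^bsub>N\<^esub> ce_diff2 L N act f t"
    if t: "t \<in> carrier L \<times> carrier L \<times> carrier L"
  proof -
    obtain x y z where t: "t = (x, y, z)" and [simp]: "x \<in> carrier L" "y \<in> carrier L" "z \<in> carrier L"
      using t by auto
    show ?thesis
      unfolding t
      apply (simp add: ce_diff2_apply act_rules)
      by (rule N.M.formal_sum_eqI, (rule N.M.formal_sum_intros | (rule N.M.formal_sum_atom, simp))+, simp add: algebra_simps)
  qed
qed

lemma ce_diff2_closed:
  "f \<in> alt_bilinear K L N \<Longrightarrow> t \<in> carrier L \<times> carrier L \<times> carrier L \<Longrightarrow> ce_diff2 L N act f t \<in> carrier N"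
  by (auto simp: ce_diff2_apply alt_bilinearD)

lemma ce_diff2_zero:
  "(\<lambda>t\<in>carrier L \<times> carrier L. \<zero>\<^bsub>N\<^esub>) \<in> alt_bilinear K L N"
  "t \<in> carrier L \<times> carrier L \<times> carrier L \<Longrightarrow> ce_diff2 L N act (\<lambda>t\<in>carrier L \<times> carrier L. \<zero>\<^bsub>N\<^esub>) t = \<zero>\<^bsub>N\<^esub>"
  by (auto intro!: alt_bilinearI simp: ce_diff2_apply act_rules)

lemma ce_diff2_ext: "ce_diff2 L N act f \<in> extensional (carrier L \<times> carrier L \<times> carrier L)"
  by (auto simp: ce_diff2_def)

text \<open>Brings classes down to cochains, so that cosets can be compared without first turning
  \<open>Z3\<close> into a module.\<close>

lemma H3_class_iff:
  "c' \<in> H3_class K L N act c \<longleftrightarrow>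
    (\<exists>b\<in>alt_bilinear K L N. c' = (\<lambda>t\<in>carrier L \<times> carrier L \<times> carrier L. ce_diff2 L N act b t \<oplus>\<^bsub>N\<^esub> c t))"
  by (auto simp: H3_class_def Z3_def B3_def fun_module_def a_r_coset_def r_coset_def)

lemma H3_class_eqI:
  assumes c: "\<And>t. t \<in> carrier L \<times> carrier L \<times> carrier L \<Longrightarrow> c t \<in> carrier N"
    and b: "b \<in> alt_bilinear K L N"
    and eq: "\<And>t. t \<in> carrier L \<times> carrier L \<times> carrier L \<Longrightarrow> c' t = ce_diff2 L N act b t \<oplus>\<^bsub>N\<^esub> c t"
  shows "H3_class K L N act c' = H3_class K L N act c"
proof
  show "H3_class K L N act c' \<subseteq> H3_class K L N act c"
  proof
    fix e assume "e \<in> H3_class K L N act c'"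
    then obtain b' where b': "b' \<in> alt_bilinear K L N"
      "e = (\<lambda>t\<in>carrier L \<times> carrier L \<times> carrier L. ce_diff2 L N act b' t \<oplus>\<^bsub>N\<^esub> c' t)"
      by (auto simp: H3_class_iff)
    have "e = (\<lambda>t\<in>carrier L \<times> carrier L \<times> carrier L.
        ce_diff2 L N act (\<lambda>t\<in>carrier L \<times> carrier L. b' t \<oplus>\<^bsub>N\<^esub> b t) t \<oplus>\<^bsub>N\<^esub> c t)"
      unfolding b'(2)
      by (rule restrict_ext) (simp only: ce_diff2_add(2)[OF b'(1) b] eq c N.M.a_assoc ce_diff2_closed b b')
    then show "e \<in> H3_class K L N act c"
      using ce_diff2_add(1)[OF b'(1) b] by (auto simp: H3_class_iff)
  qed
  show "H3_class K L N act c \<subseteq> H3_class K L N act c'"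
  proof
    fix e assume "e \<in> H3_class K L N act c"
    then obtain b' where b': "b' \<in> alt_bilinear K L N"
      "e = (\<lambda>t\<in>carrier L \<times> carrier L \<times> carrier L. ce_diff2 L N act b' t \<oplus>\<^bsub>N\<^esub> c t)"
      by (auto simp: H3_class_iff)
    note nb = ce_diff2_uminus[OF b]
    have "e = (\<lambda>t\<in>carrier L \<times> carrier L \<times> carrier L.
        ce_diff2 L N act (\<lambda>t\<in>carrier L \<times> carrier L. b' t \<oplus>\<^bsub>N\<^esub> (\<lambda>t\<in>carrier L \<times> carrier L. \<ominus>\<^bsub>N\<^esub> b t) t) t \<oplus>\<^bsub>N\<^esub> c' t)"
      unfolding b'(2)
    proof (rule restrict_ext)
      fix t assume t: "t \<in> carrier L \<times> carrier L \<times> carrier L"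
      have [simp]: "ce_diff2 L N act b t \<in> carrier N" "ce_diff2 L N act b' t \<in> carrier N" "c t \<in> carrier N"
        using t b b'(1) c ce_diff2_closed by auto
      show "ce_diff2 L N act b' t \<oplus>\<^bsub>N\<^esub> c t =
        ce_diff2 L N act (\<lambda>t\<in>carrier L \<times> carrier L. b' t \<oplus>\<^bsub>N\<^esub> (\<lambda>t\<in>carrier L \<times> carrier L. \<ominus>\<^bsub>N\<^esub> b t) t) t \<oplus>\<^bsub>N\<^esub> c' t"
        apply (simp only: ce_diff2_add(2)[OF b'(1) nb(1) t] nb(2)[OF t] eq[OF t])
        by (rule N.M.formal_sum_eqI, (rule N.M.formal_sum_intros | (rule N.M.formal_sum_atom, simp))+, simp add: algebra_simps)
    qed
    then show "e \<in> H3_class K L N act c'"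
      using ce_diff2_add(1)[OF b'(1) nb(1)] unfolding H3_class_iff by blast
  qed
qed

lemma H3_class_zeroD:
  assumes c: "c \<in> carrier L \<times> carrier L \<times> carrier L \<rightarrow>\<^sub>E carrier N"
    and zero: "H3_class K L N act c = B3 K L N act"
  obtains b where "b \<in> alt_bilinear K L N" "c = ce_diff2 L N act b"
proof -
  \<comment> \<open>The cochain zero exhibits \<open>c\<close> as a member of its own class.\<close>
  have "c = (\<lambda>t\<in>carrier L \<times> carrier L \<times> carrier L.
      ce_diff2 L N act (\<lambda>t\<in>carrier L \<times> carrier L. \<zero>\<^bsub>N\<^esub>) t \<oplus>\<^bsub>N\<^esub> c t)"
  proof (rule extensionalityI)
    fix t assume t: "t \<in> carrier L \<times> carrier L \<times> carrier L"
    then show "c t = (\<lambda>t\<in>carrier L \<times> carrier L \<times> carrier L.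
      ce_diff2 L N act (\<lambda>t\<in>carrier L \<times> carrier L. \<zero>\<^bsub>N\<^esub>) t \<oplus>\<^bsub>N\<^esub> c t) t"
      using c PiE_mem[OF c t] by (simp only: ce_diff2_zero(2)[OF t] restrict_apply') simp
  qed (use c in \<open>auto simp: PiE_def\<close>)
  then have "c \<in> H3_class K L N act c"
    using ce_diff2_zero(1) unfolding H3_class_iff by blast
  then show thesis using that zero by (auto simp: B3_def)
qed

lemma H3_class_zero:
  "H3_class K L N act (\<lambda>t\<in>carrier L \<times> carrier L \<times> carrier L. \<zero>\<^bsub>N\<^esub>) = B3 K L N act"
proof -
  have "(\<lambda>t\<in>carrier L \<times> carrier L \<times> carrier L. ce_diff2 L N act b t \<oplus>\<^bsub>N\<^esub>
      (\<lambda>t\<in>carrier L \<times> carrier L \<times> carrier L. \<zero>\<^bsub>N\<^esub>) t) = ce_diff2 L N act b"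
    if b: "b \<in> alt_bilinear K L N" for b
  proof (rule extensionalityI[OF _ ce_diff2_ext])
    fix t assume t: "t \<in> carrier L \<times> carrier L \<times> carrier L"
    show "(\<lambda>t\<in>carrier L \<times> carrier L \<times> carrier L. ce_diff2 L N act b t \<oplus>\<^bsub>N\<^esub>
      (\<lambda>t\<in>carrier L \<times> carrier L \<times> carrier L. \<zero>\<^bsub>N\<^esub>) t) t = ce_diff2 L N act b t"
      using ce_diff2_closed[OF b t] t by (simp only: restrict_apply') simp
  qed simp
  then show ?thesis by (auto simp: set_eq_iff H3_class_iff B3_def intro!: bexI image_eqI)
qed

end

section \<open>The cocycle class of a crossed extension\<close>

locale crossed_ext = lie_module K Q N act for K and Q and N and act +
  fixes E
  assumes ext: "crossed_extension K Q N act E"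
begin

abbreviation "A \<equiv> x_src E"
abbreviation "P \<equiv> x_tgt E"
abbreviation "i \<equiv> x_incl E"
abbreviation "bnd \<equiv> x_bnd E"
abbreviation "\<pi> \<equiv> x_proj E"

lemma crossed_rules:
  "lie_algebra K A" "lie_module K P A (x_act E)" "bnd \<in> lie_hom K A P"
  "\<And>p a a'. p \<in> carrier P \<Longrightarrow> a \<in> carrier A \<Longrightarrow> a' \<in> carrier A \<Longrightarrow>
    x_act E p \<lblot>a, a'\<rblot>\<^bsub>A\<^esub> = \<lblot>x_act E p a, a'\<rblot>\<^bsub>A\<^esub> \<oplus>\<^bsub>A\<^esub> \<lblot>a, x_act E p a'\<rblot>\<^bsub>A\<^esub>"
  "\<And>p a. p \<in> carrier P \<Longrightarrow> a \<in> carrier A \<Longrightarrow> bnd (x_act E p a) = \<lblot>p, bnd a\<rblot>\<^bsub>P\<^esub>"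
  "\<And>a a'. a \<in> carrier A \<Longrightarrow> a' \<in> carrier A \<Longrightarrow> x_act E (bnd a) a' = \<lblot>a, a'\<rblot>\<^bsub>A\<^esub>"
  "i \<in> lin_hom K N A" "\<pi> \<in> lie_hom K P Q" "inj_on i (carrier N)"
  "i ` carrier N = a_kernel A P bnd" "bnd ` carrier A = a_kernel P Q \<pi>"
  "\<pi> ` carrier P = carrier Q"
  "\<And>p n. p \<in> carrier P \<Longrightarrow> n \<in> carrier N \<Longrightarrow> i (act (\<pi> p) n) = x_act E p (i n)"
  using ext by (auto simp: crossed_extension_def crossed_module_def)

sublocale A: lie_algebra K A by (rule crossed_rules)
sublocale P: lie_module K P A "x_act E" by (rule crossed_rules)

lemmas i_hom = lin_homD[OF crossed_rules(7)]
  lin_hom_additive[OF N.module_axioms A.module_axioms crossed_rules(7)]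
lemmas bnd_hom = lin_homD[OF lie_homD(1)[OF crossed_rules(3)]] lie_homD(2)[OF crossed_rules(3)]
  lin_hom_additive[OF A.module_axioms P.module_axioms lie_homD(1)[OF crossed_rules(3)]]
lemmas \<pi>_hom = lin_homD[OF lie_homD(1)[OF crossed_rules(8)]] lie_homD(2)[OF crossed_rules(8)]
  lin_hom_additive[OF P.module_axioms module_axioms lie_homD(1)[OF crossed_rules(8)]]

lemma kernel_bnd: "a \<in> carrier A \<Longrightarrow> bnd a = \<zero>\<^bsub>P\<^esub> \<Longrightarrow> a \<in> i ` carrier N"
  and bnd_i: "n \<in> carrier N \<Longrightarrow> bnd (i n) = \<zero>\<^bsub>P\<^esub>"
  and kernel_\<pi>: "p \<in> carrier P \<Longrightarrow> \<pi> p = \<zero>\<^bsub>Q\<^esub> \<Longrightarrow> p \<in> bnd ` carrier A"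
  and \<pi>_bnd: "a \<in> carrier A \<Longrightarrow> \<pi> (bnd a) = \<zero>\<^bsub>Q\<^esub>"
  using crossed_rules(10,11) by (auto simp: A.a_kernelI P.a_kernelI)

text \<open>Names the two choices behind \<open>crossed_cocycle\<close>, because cocycles are
  compared by altering \<open>\<sigma>\<close> and \<open>f\<close> one after the other.\<close>

definition "datum \<sigma> f c \<longleftrightarrow> \<sigma> \<in> lin_hom K Q P \<and> f \<in> alt_bilinear K Q A \<and>
    (\<forall>x\<in>carrier Q. \<pi> (\<sigma> x) = x) \<and>
    (\<forall>x\<in>carrier Q. \<forall>y\<in>carrier Q. bnd (f (x, y)) = \<lblot>\<sigma> x, \<sigma> y\<rblot>\<^bsub>P\<^esub> \<ominus>\<^bsub>P\<^esub> \<sigma> \<lblot>x, y\<rblot>\<^bsub>Q\<^esub>) \<and>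
    (\<forall>t\<in>carrier Q \<times> carrier Q \<times> carrier Q. i (c t) = ce_diff2 Q A (\<lambda>x. x_act E (\<sigma> x)) f t)"

lemma crossed_cocycle_iff:
  "crossed_cocycle K Q N act E c \<longleftrightarrow>
    c \<in> carrier Q \<times> carrier Q \<times> carrier Q \<rightarrow>\<^sub>E carrier N \<and> (\<exists>\<sigma> f. datum \<sigma> f c)"
  by (auto simp: crossed_cocycle_def datum_def ext)

lemma datumD:
  assumes "datum \<sigma> f c"
  shows "\<sigma> \<in> lin_hom K Q P" "f \<in> alt_bilinear K Q A" "\<And>x. x \<in> carrier Q \<Longrightarrow> \<pi> (\<sigma> x) = x"
    "\<And>x y. x \<in> carrier Q \<Longrightarrow> y \<in> carrier Q \<Longrightarrow> bnd (f (x, y)) = \<lblot>\<sigma> x, \<sigma> y\<rblot>\<^bsub>P\<^esub> \<ominus>\<^bsub>P\<^esub> \<sigma> \<lblot>x, y\<rblot>\<^bsub>Q\<^esub>"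
    "\<And>t. t \<in> carrier Q \<times> carrier Q \<times> carrier Q \<Longrightarrow> i (c t) = ce_diff2 Q A (\<lambda>x. x_act E (\<sigma> x)) f t"
  using assms by (auto simp: datum_def)

text \<open>The curvature of the operators \<open>x_act E (\<sigma> x)\<close> is the operator of
  the curvature of \<open>\<sigma>\<close>, which is \<open>bnd f\<close>; by the Peiffer identity
  \<open>x_act (bnd a) = [a, _]\<close> this is the bracket with \<open>f\<close>.\<close>

lemma datum_connection:
  assumes "datum \<sigma> f c"
  shows "lie_connection K Q A (\<lambda>x. x_act E (\<sigma> x)) f"
proof (intro lie_connection.intro lie_connection_axioms.intro lie_algebra_axioms A.lie_algebra_axioms)
  note d = datumD[OF assms]
  note [simp] = lin_homD[OF d(1)] alt_bilinearD[OF d(2)]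
  fix x y a assume [simp]: "x \<in> carrier Q" "y \<in> carrier Q" "a \<in> carrier A"
  have "\<lblot>\<sigma> x, \<sigma> y\<rblot>\<^bsub>P\<^esub> = \<sigma> \<lblot>x, y\<rblot>\<^bsub>Q\<^esub> \<oplus>\<^bsub>P\<^esub> bnd (f (x, y))"
    unfolding d(4)[OF \<open>x \<in> carrier Q\<close> \<open>y \<in> carrier Q\<close>]
    by (rule P.M.formal_sum_eqI, (rule P.M.formal_sum_intros | (rule P.M.formal_sum_atom, simp))+, simp add: algebra_simps)
  then have "x_act E (\<sigma> \<lblot>x, y\<rblot>\<^bsub>Q\<^esub>) a \<oplus>\<^bsub>A\<^esub> \<lblot>f (x, y), a\<rblot>\<^bsub>A\<^esub> =
      x_act E (\<sigma> x) (x_act E (\<sigma> y) a) \<ominus>\<^bsub>A\<^esub> x_act E (\<sigma> y) (x_act E (\<sigma> x) a)"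
    using P.act_bracket[of "\<sigma> x" "\<sigma> y" a]
    by (simp add: P.act_add_left bnd_hom crossed_rules(6))
  then have "x_act E (\<sigma> x) (x_act E (\<sigma> y) a) = x_act E (\<sigma> y) (x_act E (\<sigma> x) a) \<oplus>\<^bsub>A\<^esub>
      (x_act E (\<sigma> \<lblot>x, y\<rblot>\<^bsub>Q\<^esub>) a \<oplus>\<^bsub>A\<^esub> \<lblot>f (x, y), a\<rblot>\<^bsub>A\<^esub>)"
    apply simp
    by (rule A.M.formal_sum_eqI, (rule A.M.formal_sum_intros | (rule A.M.formal_sum_atom, simp))+, simp add: algebra_simps)
  then show "x_act E (\<sigma> x) (x_act E (\<sigma> y) a) = x_act E (\<sigma> y) (x_act E (\<sigma> x) a) \<oplus>\<^bsub>A\<^esub>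
      x_act E (\<sigma> \<lblot>x, y\<rblot>\<^bsub>Q\<^esub>) a \<oplus>\<^bsub>A\<^esub> \<lblot>f (x, y), a\<rblot>\<^bsub>A\<^esub>"
    by (simp add: A.M.a_assoc)
qed (use datumD[OF assms] in \<open>simp_all add: lin_homD P.act_rules crossed_rules(4)\<close>)

text \<open>The covariant derivative of the curvature is killed by the boundary, hence a cochain
  with values in \<open>N\<close>.\<close>

lemma bnd_ce_diff2:
  assumes \<sigma>: "\<sigma> \<in> lin_hom K Q P" and f: "f \<in> alt_bilinear K Q A"
    and bf: "\<And>x y. x \<in> carrier Q \<Longrightarrow> y \<in> carrier Q \<Longrightarrow> bnd (f (x, y)) = \<lblot>\<sigma> x, \<sigma> y\<rblot>\<^bsub>P\<^esub> \<ominus>\<^bsub>P\<^esub> \<sigma> \<lblot>x, y\<rblot>\<^bsub>Q\<^esub>"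
    and t: "t \<in> carrier Q \<times> carrier Q \<times> carrier Q"
  shows "bnd (ce_diff2 Q A (\<lambda>x. x_act E (\<sigma> x)) f t) = \<zero>\<^bsub>P\<^esub>"
proof -
  have "ce_diff2 Q P (\<lambda>x. lie_bracket P (\<sigma> x)) (\<lambda>u. bnd (f u)) t =
      bnd (ce_diff2 Q A (\<lambda>x. x_act E (\<sigma> x)) f t)"
    by (rule ce_diff2_natural[OF lie_algebra_axioms A.module_axioms P.module_axioms
          lie_homD(1)[OF crossed_rules(3)]])
      (use t in \<open>auto simp: alt_bilinearD[OF f] lin_homD[OF \<sigma>] crossed_rules(5)\<close>)
  moreover have "ce_diff2 Q P (\<lambda>x. lie_bracket P (\<sigma> x)) (\<lambda>u. bnd (f u)) t = \<zero>\<^bsub>P\<^esub>"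
    by (rule bianchi[OF lie_algebra_axioms P.lie_algebra_axioms \<sigma>]) (use t bf in auto)
  ultimately show ?thesis by simp
qed

lemma datum_exists:
  assumes \<sigma>: "\<sigma> \<in> lin_hom K Q P" and f: "f \<in> alt_bilinear K Q A" and sec: "\<And>x. x \<in> carrier Q \<Longrightarrow> \<pi> (\<sigma> x) = x"
    and bf: "\<And>x y. x \<in> carrier Q \<Longrightarrow> y \<in> carrier Q \<Longrightarrow> bnd (f (x, y)) = \<lblot>\<sigma> x, \<sigma> y\<rblot>\<^bsub>P\<^esub> \<ominus>\<^bsub>P\<^esub> \<sigma> \<lblot>x, y\<rblot>\<^bsub>Q\<^esub>"
  obtains c where "datum \<sigma> f c" "c \<in> carrier Q \<times> carrier Q \<times> carrier Q \<rightarrow>\<^sub>E carrier N"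
proof -
  have "\<exists>n\<in>carrier N. i n = ce_diff2 Q A (\<lambda>x. x_act E (\<sigma> x)) f t"
    if t: "t \<in> carrier Q \<times> carrier Q \<times> carrier Q" for t
  proof -
    have "ce_diff2 Q A (\<lambda>x. x_act E (\<sigma> x)) f t \<in> carrier A"
      using t by (auto simp: ce_diff2_apply alt_bilinearD[OF f] lin_homD[OF \<sigma>])
    from kernel_bnd[OF this bnd_ce_diff2[OF \<sigma> f bf t]] show ?thesis by auto
  qed
  then obtain c where c: "\<And>t. t \<in> carrier Q \<times> carrier Q \<times> carrier Q \<Longrightarrow>
      c t \<in> carrier N \<and> i (c t) = ce_diff2 Q A (\<lambda>x. x_act E (\<sigma> x)) f t"
    by metis
  have "datum \<sigma> f (restrict c (carrier Q \<times> carrier Q \<times> carrier Q))"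
    using assms c by (auto simp: datum_def)
  moreover have "restrict c (carrier Q \<times> carrier Q \<times> carrier Q) \<in> carrier Q \<times> carrier Q \<times> carrier Q \<rightarrow>\<^sub>E carrier N"
    using c by auto
  ultimately show thesis by (rule that)
qed

text \<open>A linear section of \<open>\<pi>\<close> exists by surjectivity. Its curvature is killed
  by \<open>\<pi>\<close>, so exactness at the target places it in the image of \<open>bnd\<close>,
  where it can be lifted.\<close>

lemma crossed_cocycle_exists: "\<exists>c. crossed_cocycle K Q N act E c"
proof -
  have "(\<lambda>x. x) \<in> lin_hom K Q Q" by (auto simp: lin_hom_def)
  then obtain \<sigma> where \<sigma>: "\<sigma> \<in> lin_hom K Q P" "\<And>x. x \<in> carrier Q \<Longrightarrow> \<pi> (\<sigma> x) = x"
    using linear_lift[OF field_axioms P.module_axioms module_axioms lie_homD(1)[OF crossed_rules(8)],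
        of "\<lambda>x. x" Q] crossed_rules(12) by auto
  note \<kappa> = curvature_alt_bilinear[OF lie_algebra_axioms P.lie_algebra_axioms \<sigma>(1)]
  have "(\<lambda>(x, y)\<in>carrier Q \<times> carrier Q. \<lblot>\<sigma> x, \<sigma> y\<rblot>\<^bsub>P\<^esub> \<ominus>\<^bsub>P\<^esub> \<sigma> \<lblot>x, y\<rblot>\<^bsub>Q\<^esub>) ` (carrier Q \<times> carrier Q) \<subseteq>
      bnd ` carrier A"
    by (auto intro!: kernel_\<pi> simp: \<pi>_hom lin_homD[OF \<sigma>(1)] \<sigma>(2))
  with \<kappa> obtain f where f: "f \<in> alt_bilinear K Q A" "\<And>x y. x \<in> carrier Q \<Longrightarrow> y \<in> carrier Q \<Longrightarrow>
      bnd (f (x, y)) = (\<lambda>(x, y)\<in>carrier Q \<times> carrier Q. \<lblot>\<sigma> x, \<sigma> y\<rblot>\<^bsub>P\<^esub> \<ominus>\<^bsub>P\<^esub> \<sigma> \<lblot>x, y\<rblot>\<^bsub>Q\<^esub>) (x, y)"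
    using alt_bilinear_lift[OF field_axioms A.module_axioms P.module_axioms
      lie_homD(1)[OF crossed_rules(3)] module_axioms] by blast
  then have bf: "\<And>x y. x \<in> carrier Q \<Longrightarrow> y \<in> carrier Q \<Longrightarrow> bnd (f (x, y)) = \<lblot>\<sigma> x, \<sigma> y\<rblot>\<^bsub>P\<^esub> \<ominus>\<^bsub>P\<^esub> \<sigma> \<lblot>x, y\<rblot>\<^bsub>Q\<^esub>"
    by auto
  obtain c where "datum \<sigma> f c" "c \<in> carrier Q \<times> carrier Q \<times> carrier Q \<rightarrow>\<^sub>E carrier N"
    by (rule datum_exists[OF \<sigma>(1) f(1) \<sigma>(2)]) (use bf in blast)+
  then show ?thesis unfolding crossed_cocycle_iff by blast
qed

lemma i_eq: "n \<in> carrier N \<Longrightarrow> n' \<in> carrier N \<Longrightarrow> i n = i n' \<Longrightarrow> n = n'"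
  using crossed_rules(9) by (auto dest: inj_onD)

text \<open>Since \<open>i\<close> is injective, every identity for \<open>c\<close> can be tested
  after \<open>i\<close>, where \<open>c\<close> becomes the covariant derivative of
  \<open>f\<close> and the rules for connections apply.\<close>

lemma crossed_cocycle_Z3:
  assumes "crossed_cocycle K Q N act E c"
  shows "c \<in> carrier (Z3 K Q N act)"
proof -
  obtain \<sigma> f where d: "datum \<sigma> f c" and c: "c \<in> carrier Q \<times> carrier Q \<times> carrier Q \<rightarrow>\<^sub>E carrier N"
    using assms by (auto simp: crossed_cocycle_iff)
  interpret C: lie_connection K Q A "\<lambda>x. x_act E (\<sigma> x)" f by (rule datum_connection[OF d])
  have [simp]: "c (x, y, z) \<in> carrier N" if "x \<in> carrier Q" "y \<in> carrier Q" "z \<in> carrier Q" for x y z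
    using c that by auto
  have ic: "i (c (x, y, z)) = ce_diff2 Q A (\<lambda>x. x_act E (\<sigma> x)) f (x, y, z)"
    if "x \<in> carrier Q" "y \<in> carrier Q" "z \<in> carrier Q" for x y z
    using datumD(5)[OF d] that by simp
  have "c \<in> alt_trilinear K Q N"
    unfolding alt_trilinear_def
    using c by (auto intro!: lin_homI i_eq simp: ic i_hom C.ce_diff2_trilinear C.ce_diff2_alternating)
  moreover have "ce_diff3 Q N act c = (\<lambda>_\<in>carrier Q \<times> carrier Q \<times> carrier Q \<times> carrier Q. \<zero>\<^bsub>N\<^esub>)"
  proof (rule extensionalityI)
    fix t assume t: "t \<in> carrier Q \<times> carrier Q \<times> carrier Q \<times> carrier Q"
    have "ce_diff3 Q A (\<lambda>x. x_act E (\<sigma> x)) (ce_diff2 Q A (\<lambda>x. x_act E (\<sigma> x)) f) t = i (ce_diff3 Q N act c t)"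
    proof (rule ce_diff3_natural[OF lie_algebra_axioms N.module_axioms A.module_axioms crossed_rules(7)])
      show "x_act E (\<sigma> x) (i a) = i (act x a)" if "x \<in> carrier Q" "a \<in> carrier N" for x a
        using that crossed_rules(13)[of "\<sigma> x" a] datumD(3)[OF d] lin_homD(1)[OF datumD(1)[OF d]] by simp
    qed (use t ic in auto)
    moreover have "ce_diff3 Q A (\<lambda>x. x_act E (\<sigma> x)) (ce_diff2 Q A (\<lambda>x. x_act E (\<sigma> x)) f) t = \<zero>\<^bsub>A\<^esub>"
      using t by (auto intro: C.ce_diff3_ce_diff2)
    ultimately have "i (ce_diff3 Q N act c t) = i \<zero>\<^bsub>N\<^esub>" by (simp add: i_hom)
    moreover have "ce_diff3 Q N act c t \<in> carrier N" using t by (auto simp: ce_diff3_apply)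
    ultimately show "ce_diff3 Q N act c t = (\<lambda>_\<in>carrier Q \<times> carrier Q \<times> carrier Q \<times> carrier Q. \<zero>\<^bsub>N\<^esub>) t"
      using t by (simp add: i_eq)
  qed (auto simp: ce_diff3_def)
  ultimately show ?thesis by (simp add: Z3_def)
qed

text \<open>Adding \<open>i b\<close> to the lift leaves the curvature equation alone because
  \<open>bnd\<close> kills it. On the image of \<open>i\<close> the operators along
  \<open>\<sigma>\<close> are the action of \<open>Q\<close>, so the cocycle moves by the ordinary
  coboundary of \<open>b\<close>.\<close>

lemma datum_shift:
  assumes d: "datum \<sigma> f c" and b: "b \<in> alt_bilinear K Q N"
    and c: "c \<in> carrier Q \<times> carrier Q \<times> carrier Q \<rightarrow>\<^sub>E carrier N"
  shows "datum \<sigma> (\<lambda>t\<in>carrier Q \<times> carrier Q. f t \<oplus>\<^bsub>A\<^esub> i (b t))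
    (\<lambda>t\<in>carrier Q \<times> carrier Q \<times> carrier Q. ce_diff2 Q N act b t \<oplus>\<^bsub>N\<^esub> c t)"
proof -
  note [simp] = lin_homD[OF datumD(1)[OF d]]
  note [simp] = i_hom(1)
  note fb [simp] = alt_bilinearD[OF datumD(2)[OF d]] alt_bilinearD[OF b]
  have f': "(\<lambda>t\<in>carrier Q \<times> carrier Q. f t \<oplus>\<^bsub>A\<^esub> i (b t)) \<in> alt_bilinear K Q A"
    by (rule alt_bilinearI) (auto simp: A.M.a_ac A.smult_r_distr i_hom)
  have "i (ce_diff2 Q N act b t \<oplus>\<^bsub>N\<^esub> c t) =
      ce_diff2 Q A (\<lambda>x. x_act E (\<sigma> x)) (\<lambda>t\<in>carrier Q \<times> carrier Q. f t \<oplus>\<^bsub>A\<^esub> i (b t)) t"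
    if t: "t \<in> carrier Q \<times> carrier Q \<times> carrier Q" for t
  proof -
    obtain x y z where t': "t = (x, y, z)" and [simp]: "x \<in> carrier Q" "y \<in> carrier Q" "z \<in> carrier Q"
      using t by auto
    have e: "x_act E (\<sigma> x) (i n) = i (act x n)" if "x \<in> carrier Q" "n \<in> carrier N" for x n
      using that crossed_rules(13)[of "\<sigma> x" n] datumD(3)[OF d] by simp
    have db: "ce_diff2 Q A (\<lambda>x. x_act E (\<sigma> x)) (\<lambda>u. i (b u)) t = i (ce_diff2 Q N act b t)"
      by (rule ce_diff2_natural[OF lie_algebra_axioms N.module_axioms A.module_axioms crossed_rules(7)])
        (use t in \<open>auto simp: e\<close>)
    have "ce_diff2 Q A (\<lambda>x. x_act E (\<sigma> x)) (\<lambda>t\<in>carrier Q \<times> carrier Q. f t \<oplus>\<^bsub>A\<^esub> i (b t)) t =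
        ce_diff2 Q A (\<lambda>x. x_act E (\<sigma> x)) (\<lambda>u. i (b u)) t \<oplus>\<^bsub>A\<^esub> ce_diff2 Q A (\<lambda>x. x_act E (\<sigma> x)) f t"
      unfolding t'
      apply (simp add: ce_diff2_apply i_hom P.act_rules)
      by (rule A.M.formal_sum_eqI, (rule A.M.formal_sum_intros | (rule A.M.formal_sum_atom, simp))+, simp add: algebra_simps)
    then show ?thesis
      using ce_diff2_closed[OF b t] PiE_mem[OF c t] by (simp add: db datumD(5)[OF d t] i_hom)
  qed
  then show ?thesis
    using datumD(1,3,4)[OF d] f' by (auto simp: datum_def bnd_hom bnd_i i_hom)
qed

text \<open>A change of the section by \<open>bnd \<eta>\<close> can be compensated in the lift so
  that the cocycle itself, and not merely its class, stays the same.\<close>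

lemma datum_change:
  assumes d: "datum \<sigma> f c" and \<eta>: "\<eta> \<in> lin_hom K Q A"
  obtains f' where "datum (\<lambda>x. \<sigma> x \<oplus>\<^bsub>P\<^esub> bnd (\<eta> x)) f' c"
proof -
  interpret C: lie_connection K Q A "\<lambda>x. x_act E (\<sigma> x)" f by (rule datum_connection[OF d])
  \<comment> \<open>By the Peiffer identity the new operators are \<open>op + ad \<eta>\<close>, so
    this is the lift for which \<open>ce_diff2_change\<close> applies.\<close>
  define f' where "f' = (\<lambda>(x, y)\<in>carrier Q \<times> carrier Q. f (x, y) \<oplus>\<^bsub>A\<^esub>
    (x_act E (\<sigma> x) (\<eta> y) \<ominus>\<^bsub>A\<^esub> x_act E (\<sigma> y) (\<eta> x) \<ominus>\<^bsub>A\<^esub> \<eta> \<lblot>x, y\<rblot>\<^bsub>Q\<^esub> \<oplus>\<^bsub>A\<^esub> \<lblot>\<eta> x, \<eta> y\<rblot>\<^bsub>A\<^esub>))"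
  note \<sigma> [simp] = lin_homD[OF datumD(1)[OF d]]
  note [simp] = lin_homD[OF \<eta>] alt_bilinearD[OF datumD(2)[OF d]]
    lin_hom_additive[OF module_axioms A.module_axioms \<eta>]
  have \<sigma>': "(\<lambda>x. \<sigma> x \<oplus>\<^bsub>P\<^esub> bnd (\<eta> x)) \<in> lin_hom K Q P"
    by (rule lin_homI) (auto simp: bnd_hom P.M.a_ac P.smult_r_distr)
  have f': "f' \<in> alt_bilinear K Q A"
  proof (rule alt_bilinearI)
    fix x y z assume [simp]: "x \<in> carrier Q" "y \<in> carrier Q" "z \<in> carrier Q"
    show "f' (x \<oplus>\<^bsub>Q\<^esub> y, z) = f' (x, z) \<oplus>\<^bsub>A\<^esub> f' (y, z)"
      apply (simp add: f'_def P.act_rules A.bracket_add_left bracket_add_left)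
      by (rule A.M.formal_sum_eqI, (rule A.M.formal_sum_intros | (rule A.M.formal_sum_atom, simp))+, simp add: algebra_simps)
    show "f' (x, y \<oplus>\<^bsub>Q\<^esub> z) = f' (x, y) \<oplus>\<^bsub>A\<^esub> f' (x, z)"
      apply (simp add: f'_def P.act_rules A.bracket_add_right bracket_add_right)
      by (rule A.M.formal_sum_eqI, (rule A.M.formal_sum_intros | (rule A.M.formal_sum_atom, simp))+, simp add: algebra_simps)
  qed (auto simp: f'_def P.act_rules A.bracket_smult_left bracket_smult_left A.bracket_smult_right
      bracket_smult_right a_minus_def A.smult_r_distr A.smult_r_minus A.bracket_alternating
      bracket_alternating A.M.r_neg)
  have bf': "bnd (f' (x, y)) = \<lblot>\<sigma> x \<oplus>\<^bsub>P\<^esub> bnd (\<eta> x), \<sigma> y \<oplus>\<^bsub>P\<^esub> bnd (\<eta> y)\<rblot>\<^bsub>P\<^esub> \<ominus>\<^bsub>P\<^esub>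
      (\<sigma> \<lblot>x, y\<rblot>\<^bsub>Q\<^esub> \<oplus>\<^bsub>P\<^esub> bnd (\<eta> \<lblot>x, y\<rblot>\<^bsub>Q\<^esub>))" if [simp]: "x \<in> carrier Q" "y \<in> carrier Q" for x y
  proof -
    have "\<lblot>bnd (\<eta> x), \<sigma> y\<rblot>\<^bsub>P\<^esub> = \<ominus>\<^bsub>P\<^esub> \<lblot>\<sigma> y, bnd (\<eta> x)\<rblot>\<^bsub>P\<^esub>"
      by (rule P.bracket_antisym) (simp_all add: bnd_hom)
    then show ?thesis
      apply (simp add: f'_def bnd_hom crossed_rules(5) datumD(4)[OF d] P.bracket_add_left P.bracket_add_right)
      by (rule P.M.formal_sum_eqI, (rule P.M.formal_sum_intros | (rule P.M.formal_sum_atom, simp add: bnd_hom))+,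
          simp add: algebra_simps)
  qed
  have ic: "i (c t) = ce_diff2 Q A (\<lambda>x. x_act E (\<sigma> x \<oplus>\<^bsub>P\<^esub> bnd (\<eta> x))) f' t"
    if t: "t \<in> carrier Q \<times> carrier Q \<times> carrier Q" for t
  proof -
    obtain x y z where t': "t = (x, y, z)" "x \<in> carrier Q" "y \<in> carrier Q" "z \<in> carrier Q"
      using t by auto
    have "ce_diff2 Q A (\<lambda>x. x_act E (\<sigma> x \<oplus>\<^bsub>P\<^esub> bnd (\<eta> x))) f' t = ce_diff2 Q A (\<lambda>x. x_act E (\<sigma> x)) f t"
      unfolding t'(1)
      by (rule C.ce_diff2_change[OF \<eta>])
        (use t' in \<open>simp_all add: f'_def P.act_rules bnd_hom crossed_rules(6)\<close>)
    then show ?thesis using datumD(5)[OF d t] by simp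
  qed
  have "\<pi> (\<sigma> x \<oplus>\<^bsub>P\<^esub> bnd (\<eta> x)) = x" if "x \<in> carrier Q" for x
    using that by (simp add: \<pi>_hom bnd_hom \<pi>_bnd datumD(3)[OF d])
  then have "datum (\<lambda>x. \<sigma> x \<oplus>\<^bsub>P\<^esub> bnd (\<eta> x)) f' c"
    using \<sigma>' f' bf' ic by (auto simp: datum_def)
  then show thesis by (rule that)
qed

text \<open>Two sections differ by a map into the kernel of \<open>\<pi>\<close>, hence by
  \<open>bnd \<eta>\<close> for a linear \<open>\<eta>\<close>, and \<open>datum_change\<close>
  makes them equal. The two lifts then differ by a map into the kernel of \<open>bnd\<close>, hence
  by \<open>i b\<close>, and \<open>datum_shift\<close> shows that the cocycles differ by the
  coboundary of \<open>b\<close>.\<close>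

lemma crossed_cocycle_unique:
  assumes c: "crossed_cocycle K Q N act E c" and c': "crossed_cocycle K Q N act E c'"
  shows "H3_class K Q N act c' = H3_class K Q N act c"
proof -
  obtain \<sigma> f where d: "datum \<sigma> f c" and cN: "c \<in> carrier Q \<times> carrier Q \<times> carrier Q \<rightarrow>\<^sub>E carrier N"
    using c by (auto simp: crossed_cocycle_iff)
  obtain \<sigma>' f' where d': "datum \<sigma>' f' c'" and cN': "c' \<in> carrier Q \<times> carrier Q \<times> carrier Q \<rightarrow>\<^sub>E carrier N"
    using c' by (auto simp: crossed_cocycle_iff)
  note \<sigma> = lin_homD[OF datumD(1)[OF d]] and \<sigma>' = lin_homD[OF datumD(1)[OF d']]
  have diff: "(\<lambda>x. \<sigma>' x \<ominus>\<^bsub>P\<^esub> \<sigma> x) \<in> lin_hom K Q P"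
    by (rule P.lin_hom_minus_closed[OF module_axioms datumD(1)[OF d'] datumD(1)[OF d]])
  moreover have "(\<lambda>x. \<sigma>' x \<ominus>\<^bsub>P\<^esub> \<sigma> x) ` carrier Q \<subseteq> bnd ` carrier A"
    by (auto intro!: kernel_\<pi> simp: \<pi>_hom \<sigma> \<sigma>' datumD(3)[OF d] datumD(3)[OF d'])
  ultimately obtain \<eta> where \<eta>: "\<eta> \<in> lin_hom K Q A" "\<And>x. x \<in> carrier Q \<Longrightarrow> bnd (\<eta> x) = \<sigma>' x \<ominus>\<^bsub>P\<^esub> \<sigma> x"
    using linear_lift[OF field_axioms A.module_axioms P.module_axioms lie_homD(1)[OF crossed_rules(3)]]
    by blast
  obtain g where g: "datum (\<lambda>x. \<sigma> x \<oplus>\<^bsub>P\<^esub> bnd (\<eta> x)) g c" using datum_change[OF d \<eta>(1)] .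
  have eq: "\<sigma> x \<oplus>\<^bsub>P\<^esub> bnd (\<eta> x) = \<sigma>' x" if x: "x \<in> carrier Q" for x
    unfolding \<eta>(2)[OF x] using \<sigma>(1)[OF x] \<sigma>'(1)[OF x]
    apply -
    by (rule P.M.formal_sum_eqI, (rule P.M.formal_sum_intros | (rule P.M.formal_sum_atom, simp))+, simp add: algebra_simps)
  \<comment> \<open>The sections agree on the carrier only, so their equality is carried through
    \<open>ce_diff2\<close> pointwise.\<close>
  have "ce_diff2 Q A (\<lambda>x. x_act E (\<sigma> x \<oplus>\<^bsub>P\<^esub> bnd (\<eta> x))) g t = ce_diff2 Q A (\<lambda>x. x_act E (\<sigma>' x)) g t"
    if "t \<in> carrier Q \<times> carrier Q \<times> carrier Q" for t
    using that by (auto simp: ce_diff2_apply eq)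
  then have g': "datum \<sigma>' g c"
    using g datumD(1,3)[OF d'] eq by (auto simp: datum_def)
  note gD [simp] = alt_bilinearD[OF datumD(2)[OF g']] alt_bilinearD[OF datumD(2)[OF d']]
  define h where "h = (\<lambda>t\<in>carrier Q \<times> carrier Q. f' t \<ominus>\<^bsub>A\<^esub> g t)"
  have "h \<in> alt_bilinear K Q A"
  proof (rule alt_bilinearI)
    fix x y z assume [simp]: "x \<in> carrier Q" "y \<in> carrier Q" "z \<in> carrier Q"
    show "h (x \<oplus>\<^bsub>Q\<^esub> y, z) = h (x, z) \<oplus>\<^bsub>A\<^esub> h (y, z)"
      apply (simp add: h_def)
      by (rule A.M.formal_sum_eqI, (rule A.M.formal_sum_intros | (rule A.M.formal_sum_atom, simp))+, simp add: algebra_simps)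
    show "h (x, y \<oplus>\<^bsub>Q\<^esub> z) = h (x, y) \<oplus>\<^bsub>A\<^esub> h (x, z)"
      apply (simp add: h_def)
      by (rule A.M.formal_sum_eqI, (rule A.M.formal_sum_intros | (rule A.M.formal_sum_atom, simp))+, simp add: algebra_simps)
  qed (auto simp: h_def a_minus_def A.smult_r_distr A.smult_r_minus)
  moreover have "h ` (carrier Q \<times> carrier Q) \<subseteq> i ` carrier N"
    by (auto intro!: kernel_bnd simp: h_def bnd_hom datumD(4)[OF d'] datumD(4)[OF g'] \<sigma>')
  ultimately obtain b where b: "b \<in> alt_bilinear K Q N"
    "\<And>x y. x \<in> carrier Q \<Longrightarrow> y \<in> carrier Q \<Longrightarrow> i (b (x, y)) = h (x, y)"
    using alt_bilinear_lift[OF field_axioms N.module_axioms A.module_axioms crossed_rules(7) module_axioms]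
    by blast
  have "(\<lambda>t\<in>carrier Q \<times> carrier Q. g t \<oplus>\<^bsub>A\<^esub> i (b t)) = f'"
  proof (rule extensionalityI)
    fix t assume "t \<in> carrier Q \<times> carrier Q"
    then obtain x y where t: "t = (x, y)" and [simp]: "x \<in> carrier Q" "y \<in> carrier Q" by auto
    show "(\<lambda>t\<in>carrier Q \<times> carrier Q. g t \<oplus>\<^bsub>A\<^esub> i (b t)) t = f' t"
      apply (simp add: t b(2) h_def)
      by (rule A.M.formal_sum_eqI, (rule A.M.formal_sum_intros | (rule A.M.formal_sum_atom, simp))+, simp add: algebra_simps)
  qed (use datumD(2)[OF d'] in \<open>auto simp: alt_bilinear_def PiE_def\<close>)
  then have d'': "datum \<sigma>' f' (\<lambda>t\<in>carrier Q \<times> carrier Q \<times> carrier Q. ce_diff2 Q N act b t \<oplus>\<^bsub>N\<^esub> c t)"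
    using datum_shift[OF g' b(1) cN] by simp
  show ?thesis
  proof (rule H3_class_eqI[OF _ b(1)])
    fix t assume t: "t \<in> carrier Q \<times> carrier Q \<times> carrier Q"
    show ct: "c t \<in> carrier N" using cN t by auto
    show "c' t = ce_diff2 Q N act b t \<oplus>\<^bsub>N\<^esub> c t"
      by (rule i_eq) (use t ct cN' ce_diff2_closed[OF b(1) t] datumD(5)[OF d'' t] datumD(5)[OF d' t] in auto)
  qed
qed

lemma crossed_class_eq:
  assumes "crossed_cocycle K Q N act E c"
  shows "crossed_class K Q N act E = H3_class K Q N act c"
  using assms crossed_cocycle_unique unfolding crossed_class_def by blast

lemma crossed_class_H3: "crossed_class K Q N act E \<in> carrier (H3 K Q N act)"
proof -
  obtain c where c: "crossed_cocycle K Q N act E c" using crossed_cocycle_exists by blast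
  then have "H3_class K Q N act c \<in> a_rcosets\<^bsub>Z3 K Q N act\<^esub> (B3 K Q N act)"
    using crossed_cocycle_Z3 by (auto simp: H3_class_def A_RCOSETS_def RCOSETS_def a_r_coset_def)
  then show ?thesis using crossed_class_eq[OF c] by (simp add: H3_def quot_module_def)
qed

end

text \<open>The section and the lift are pushed forward by \<open>\<beta>\<close> and
  \<open>\<alpha>\<close>. The cocycle comes out unchanged because \<open>\<alpha>\<close> induces
  the identity on \<open>N\<close>.\<close>

lemma (in crossed_ext) crossed_cocycle_morphism:
  assumes E': "crossed_extension K Q N act E'"
    and \<alpha>: "\<alpha> \<in> lin_hom K (x_src E) (x_src E')" and \<beta>: "\<beta> \<in> lie_hom K (x_tgt E) (x_tgt E')"
    and incl: "\<And>n. n \<in> carrier N \<Longrightarrow> \<alpha> (x_incl E n) = x_incl E' n"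
    and bnd: "\<And>a. a \<in> carrier (x_src E) \<Longrightarrow> x_bnd E' (\<alpha> a) = \<beta> (x_bnd E a)"
    and proj: "\<And>p. p \<in> carrier (x_tgt E) \<Longrightarrow> x_proj E' (\<beta> p) = x_proj E p"
    and equiv: "\<And>p a. p \<in> carrier (x_tgt E) \<Longrightarrow> a \<in> carrier (x_src E) \<Longrightarrow>
      \<alpha> (x_act E p a) = x_act E' (\<beta> p) (\<alpha> a)"
    and c: "crossed_cocycle K Q N act E c"
  shows "crossed_cocycle K Q N act E' c"
proof -
  interpret E': crossed_ext K Q N act E'
    by (intro crossed_ext.intro crossed_ext_axioms.intro lie_module_axioms E')
  obtain \<sigma> f where d: "datum \<sigma> f c" and cN: "c \<in> carrier Q \<times> carrier Q \<times> carrier Q \<rightarrow>\<^sub>E carrier N"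
    using c by (auto simp: crossed_cocycle_iff)
  note \<beta>_hom = lin_homD[OF lie_homD(1)[OF \<beta>]]
    lin_hom_additive[OF P.module_axioms E'.P.module_axioms lie_homD(1)[OF \<beta>]]
  note [simp] = lin_homD[OF datumD(1)[OF d]] alt_bilinearD[OF datumD(2)[OF d]] lin_homD[OF \<alpha>]
  have f': "(\<lambda>t\<in>carrier Q \<times> carrier Q. \<alpha> (f t)) \<in> alt_bilinear K Q (x_src E')"
    by (rule alt_bilinearI) (auto simp: lin_hom_additive[OF A.module_axioms E'.A.module_axioms \<alpha>])
  have "x_incl E' (c t) = ce_diff2 Q (x_src E') (\<lambda>x. x_act E' (\<beta> (\<sigma> x))) (\<lambda>t\<in>carrier Q \<times> carrier Q. \<alpha> (f t)) t"
    if t: "t \<in> carrier Q \<times> carrier Q \<times> carrier Q" for t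
  proof -
    have "ce_diff2 Q (x_src E') (\<lambda>x. x_act E' (\<beta> (\<sigma> x))) (\<lambda>t\<in>carrier Q \<times> carrier Q. \<alpha> (f t)) t =
        \<alpha> (ce_diff2 Q (x_src E) (\<lambda>x. x_act E (\<sigma> x)) f t)"
      by (rule ce_diff2_natural[OF lie_algebra_axioms A.module_axioms E'.A.module_axioms \<alpha>])
        (use t in \<open>auto simp: equiv\<close>)
    then show ?thesis using datumD(5)[OF d t, symmetric] incl PiE_mem[OF cN t] by simp
  qed
  moreover have "(\<lambda>x. \<beta> (\<sigma> x)) \<in> lin_hom K Q (x_tgt E')"
    by (rule lin_hom_comp[OF datumD(1)[OF d] lie_homD(1)[OF \<beta>]])
  ultimately have "E'.datum (\<lambda>x. \<beta> (\<sigma> x)) (\<lambda>t\<in>carrier Q \<times> carrier Q. \<alpha> (f t)) c"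
    using f' by (auto simp: E'.datum_def bnd proj datumD(3,4)[OF d] \<beta>_hom lie_homD(2)[OF \<beta>])
  then show ?thesis using cN by (auto simp: E'.crossed_cocycle_iff)
qed

section \<open>The crossed extension of a derivation\<close>

locale lam_setup = lie_ideal_module +
  fixes \<Delta>
  assumes \<Delta>: "\<Delta> \<in> DerQ"
begin

abbreviation "PD \<equiv> lam_alg K G H M act \<Delta>"
abbreviation "MH \<equiv> semidirect M G_H act"
abbreviation "SD \<equiv> semidirect DER G dact"

lemmas \<Delta>_rules = V.derivation_rules[OF \<Delta>]

lemma PD_simps [simp]:
  "carrier PD = {(d, x). d \<in> DerH \<and> x \<in> carrier G \<and> cls d = \<Delta> (q x)}"
  "u \<oplus>\<^bsub>PD\<^esub> v = u \<oplus>\<^bsub>SD\<^esub> v" "a \<odot>\<^bsub>PD\<^esub> u = a \<odot>\<^bsub>SD\<^esub> u" "\<zero>\<^bsub>PD\<^esub> = \<zero>\<^bsub>SD\<^esub>"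
  "\<lblot>u, v\<rblot>\<^bsub>PD\<^esub> = \<lblot>u, v\<rblot>\<^bsub>SD\<^esub>"
  by (auto simp: lam_alg_def)

lemma q_zero: "z \<in> H \<Longrightarrow> q z = \<zero>\<^bsub>Q\<^esub>"
  by (simp add: quot.zero_quot quot.coset_eq_zero_iff)

lemma cls_zero: "cls (\<lambda>z\<in>H. \<zero>\<^bsub>M\<^esub>) = \<zero>\<^bsub>V\<^esub>"
  using h.H1.coset_zero by (simp add: H1_class_def)

lemma cls_zero_iff: "d \<in> DerH \<Longrightarrow> cls d = \<zero>\<^bsub>V\<^esub> \<longleftrightarrow> (\<exists>m\<in>carrier M. d = inn m)"
  using h.H1.coset_eq_zero_iff[of d] h.H1.zero_quot by (auto simp: H1_class_def Inn_def)

lemma DerH_zero: "(\<lambda>z\<in>H. \<zero>\<^bsub>M\<^esub>) \<in> DerH"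
  using h.H1.M.zero_closed by simp

lemma DerH_closed:
  "d \<in> DerH \<Longrightarrow> e \<in> DerH \<Longrightarrow> (\<lambda>z\<in>H. d z \<oplus>\<^bsub>M\<^esub> e z) \<in> DerH"
  "a \<in> carrier K \<Longrightarrow> d \<in> DerH \<Longrightarrow> (\<lambda>z\<in>H. a \<odot>\<^bsub>M\<^esub> d z) \<in> DerH"
  "d \<in> DerH \<Longrightarrow> (\<lambda>z\<in>H. \<ominus>\<^bsub>M\<^esub> d z) \<in> DerH"
  "d \<in> DerH \<Longrightarrow> e \<in> DerH \<Longrightarrow> (\<lambda>z\<in>H. d z \<ominus>\<^bsub>M\<^esub> e z) \<in> DerH"
  using h.H1.M.a_closed[of d e] h.H1.smult_closed[of a d] h.H1.M.a_inv_closed[of d]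
    h.H1.M.minus_closed[of d e]
  by (simp_all add: DER_uminus DER_minus)

lemma cls_simps:
  "d \<in> DerH \<Longrightarrow> e \<in> DerH \<Longrightarrow> cls (\<lambda>z\<in>H. d z \<oplus>\<^bsub>M\<^esub> e z) = cls d \<oplus>\<^bsub>V\<^esub> cls e"
  "a \<in> carrier K \<Longrightarrow> d \<in> DerH \<Longrightarrow> cls (\<lambda>z\<in>H. a \<odot>\<^bsub>M\<^esub> d z) = a \<odot>\<^bsub>V\<^esub> cls d"
  "d \<in> DerH \<Longrightarrow> e \<in> DerH \<Longrightarrow> cls (\<lambda>z\<in>H. d z \<ominus>\<^bsub>M\<^esub> e z) = cls d \<ominus>\<^bsub>V\<^esub> cls e"
  by (simp_all add: cls_rules(2-4) DER_minus)

text \<open>Closure under the bracket is exactly the derivation rule for \<open>\<Delta>\<close>;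
  all identities are inherited from the semidirect product of \<open>DER\<close> and
  \<open>G\<close>.\<close>

lemma lie_algebra_PD: "lie_algebra K PD"
proof -
  interpret S: lie_algebra K SD by (rule D.lie_algebra_semidirect)
  note [simp] = DerH_closed cls_simps der_action_closed
  have "submodule (carrier PD) K SD"
  proof (rule S.submoduleI)
    show "\<zero>\<^bsub>SD\<^esub> \<in> carrier PD"
      using \<Delta>_rules(4) by (simp add: DerH_zero cls_zero quot.coset_zero)
    show "\<ominus>\<^bsub>SD\<^esub> u \<in> carrier PD" if u': "u \<in> carrier PD" for u
    proof -
      obtain d x where u: "u = (d, x)" "d \<in> DerH" "x \<in> carrier G" "cls d = \<Delta> (q x)"
        using u' by auto
      have "cls (\<lambda>z\<in>H. \<ominus>\<^bsub>M\<^esub> d z) = \<ominus>\<^bsub>V\<^esub> cls d"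
        unfolding H1_class_def using h.H1.coset_uminus[of d] u by (simp add: DER_uminus)
      then show ?thesis
        using u \<Delta>_rules(5)[of "q x"] by (simp add: DER_uminus quot.coset_uminus)
    qed
  qed (auto simp: quot.coset_add[symmetric] quot.coset_smult[symmetric] \<Delta>_rules)
  moreover have "\<lblot>u, v\<rblot>\<^bsub>SD\<^esub> \<in> carrier PD" if uv: "u \<in> carrier PD" "v \<in> carrier PD" for u v
  proof -
    obtain d x where u: "u = (d, x)" "d \<in> DerH" "x \<in> carrier G" "cls d = \<Delta> (q x)"
      using uv(1) by auto
    obtain e y where v: "v = (e, y)" "e \<in> DerH" "y \<in> carrier G" "cls e = \<Delta> (q y)"
      using uv(2) by auto
    have "\<Delta> (q \<lblot>x, y\<rblot>\<^bsub>G\<^esub>) = hact (q x) (\<Delta> (q y)) \<ominus>\<^bsub>V\<^esub> hact (q y) (\<Delta> (q x))"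
      using V.derivationsD(3)[OF \<Delta>, of "q x" "q y"] u v by (simp add: coset_bracket)
    also have "\<dots> = cls (dact x e) \<ominus>\<^bsub>V\<^esub> cls (dact y d)"
      using u v H1_action_cls[of x e] H1_action_cls[of y d] by simp
    finally show ?thesis using u v by (simp add: DER_minus)
  qed
  ultimately have "lie_algebra K (SD\<lparr>carrier := carrier PD\<rparr>)"
    by (rule S.lie_subalgebra)
  then show ?thesis by (simp add: lam_alg_def)
qed

lemma lam_ext_simps [simp]:
  "x_src (X_ext \<Delta>) = MH"
  "x_tgt (X_ext \<Delta>) = PD"
  "x_act (X_ext \<Delta>) (d, x) (m, z) = (act x m \<oplus>\<^bsub>M\<^esub> d z, \<lblot>x, z\<rblot>\<^bsub>G\<^esub>)"
  "x_incl (X_ext \<Delta>) m = (m, \<zero>\<^bsub>G\<^esub>)"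
  "z \<in> H \<Longrightarrow> m \<in> carrier M \<Longrightarrow> x_bnd (X_ext \<Delta>) (m, z) = (\<lambda>w\<in>H. \<ominus>\<^bsub>M\<^esub> act w m, z)"
  "x_proj (X_ext \<Delta>) (d, x) = q x"
  by (auto simp: lam_ext_def DER_uminus[OF inner_closed] inner_apply intro!: restrict_ext)

lemma MH_minus [simp]:
  "n' \<in> carrier M \<Longrightarrow> z' \<in> H \<Longrightarrow> (n, z) \<ominus>\<^bsub>MH\<^esub> (n', z') = (n \<ominus>\<^bsub>M\<^esub> n', z \<ominus>\<^bsub>G\<^esub> z')"
  using h.semidirect_minus[of n' z' n z] by (simp add: G_H_minus)

lemmas MH_simps [simp] = h.semidirect_simps[simplified]

lemma lie_module_MH: "lie_module K PD MH (x_act (X_ext \<Delta>))"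
proof (intro lie_module.intro lie_module_axioms.intro lie_algebra_PD h.module_semidirect)
  fix p a k assume p: "p \<in> carrier PD" and a: "a \<in> carrier MH"
  obtain d x where px [simp]: "p = (d, x)" by (cases p)
  have x [simp]: "x \<in> carrier G" and d: "d \<in> DerH" using p by auto
  obtain m z where [simp]: "a = (m, z)" by (cases a)
  have [simp]: "m \<in> carrier M" "z \<in> H" using a by auto
  note [simp] = DerH_rules[OF d]
  show "x_act (X_ext \<Delta>) p a \<in> carrier MH" by simp
  show "x_act (X_ext \<Delta>) (k \<odot>\<^bsub>PD\<^esub> p) a = k \<odot>\<^bsub>MH\<^esub> x_act (X_ext \<Delta>) p a"
    if "k \<in> carrier K" using that by (simp add: act_rules N.smult_r_distr bracket_smult_left)
  show "x_act (X_ext \<Delta>) p (k \<odot>\<^bsub>MH\<^esub> a) = k \<odot>\<^bsub>MH\<^esub> x_act (X_ext \<Delta>) p a"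
    if "k \<in> carrier K" using that by (simp add: act_rules N.smult_r_distr bracket_smult_right)
  show "x_act (X_ext \<Delta>) p (a \<oplus>\<^bsub>MH\<^esub> a') =
      x_act (X_ext \<Delta>) p a \<oplus>\<^bsub>MH\<^esub> x_act (X_ext \<Delta>) p a'"
    if "a' \<in> carrier MH" for a'
    using that by (auto simp: act_rules bracket_add_right N.M.a_ac)
  fix p' assume p': "p' \<in> carrier PD"
  obtain d' x' where px' [simp]: "p' = (d', x')" by (cases p')
  have x' [simp]: "x' \<in> carrier G" and d': "d' \<in> DerH" using p' by auto
  note [simp] = DerH_rules[OF d']
  show "x_act (X_ext \<Delta>) (p \<oplus>\<^bsub>PD\<^esub> p') a =
      x_act (X_ext \<Delta>) p a \<oplus>\<^bsub>MH\<^esub> x_act (X_ext \<Delta>) p' a"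
    by (simp add: act_rules bracket_add_left N.M.a_ac)
  show "x_act (X_ext \<Delta>) \<lblot>p, p'\<rblot>\<^bsub>PD\<^esub> a =
      x_act (X_ext \<Delta>) p (x_act (X_ext \<Delta>) p' a) \<ominus>\<^bsub>MH\<^esub>
      x_act (X_ext \<Delta>) p' (x_act (X_ext \<Delta>) p a)"
    apply (simp add: act_rules act_bracket jacobi_left DER_minus[OF der_action_closed[OF x' d]] der_action_apply G_H_minus)
    by (rule N.M.formal_sum_eqI, (rule N.M.formal_sum_intros | (rule N.M.formal_sum_atom, simp))+, simp add: algebra_simps)
qed

text \<open>For \<open>z\<close> in \<open>H\<close> the condition defining \<open>PD\<close> reads
  zero on both sides: the derivation is inner, and \<open>q z\<close> vanishes.\<close>

lemma bnd_closed:
  assumes "a \<in> carrier MH"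
  shows "x_bnd (X_ext \<Delta>) a \<in> carrier PD"
proof -
  obtain m z where a: "a = (m, z)" "m \<in> carrier M" "z \<in> H" using assms by auto
  have 1: "(\<lambda>w\<in>H. \<ominus>\<^bsub>M\<^esub> act w m) = inn (\<ominus>\<^bsub>M\<^esub> m)"
    using a by (auto simp: inner_der_def act_rules)
  have "cls (inn (\<ominus>\<^bsub>M\<^esub> m)) = \<zero>\<^bsub>V\<^esub>"
    using a by (subst cls_zero_iff) (auto simp: inner_closed)
  moreover have "q z = \<zero>\<^bsub>Q\<^esub>" using a by (simp add: quot.zero_quot quot.coset_eq_zero_iff)
  ultimately show ?thesis using a 1 \<Delta>_rules(4) by (simp add: inner_closed)
qed

text \<open>The sign in the boundary map is forced by the Peiffer identity: the boundary of
  \<open>(m, z)\<close> acting on \<open>(m', z')\<close> has to contribute \<open>- z' m\<close> to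
  the first component.\<close>

lemma crossed_module_lam: "crossed_module K MH PD (x_act (X_ext \<Delta>)) (x_bnd (X_ext \<Delta>))"
proof -
  have "x_bnd (X_ext \<Delta>) \<in> lin_hom K MH PD"
  proof (rule lin_homI)
    show "x_bnd (X_ext \<Delta>) (k \<odot>\<^bsub>MH\<^esub> u) = k \<odot>\<^bsub>PD\<^esub> x_bnd (X_ext \<Delta>) u"
      if "k \<in> carrier K" "u \<in> carrier MH" for k u
      using that by (auto simp: act_rules N.smult_r_minus intro!: restrict_ext)
    show "x_bnd (X_ext \<Delta>) (u \<oplus>\<^bsub>MH\<^esub> v) =
        x_bnd (X_ext \<Delta>) u \<oplus>\<^bsub>PD\<^esub> x_bnd (X_ext \<Delta>) v"
      if "u \<in> carrier MH" "v \<in> carrier MH" for u v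
      using that by (auto simp: act_rules N.M.minus_add intro!: restrict_ext)
  qed (rule bnd_closed)
  moreover have "x_bnd (X_ext \<Delta>) \<lblot>u, v\<rblot>\<^bsub>MH\<^esub> =
      \<lblot>x_bnd (X_ext \<Delta>) u, x_bnd (X_ext \<Delta>) v\<rblot>\<^bsub>PD\<^esub>"
    if uv: "u \<in> carrier MH" "v \<in> carrier MH" for u v
  proof -
    obtain m z where u [simp]: "u = (m, z)" "m \<in> carrier M" "z \<in> H" using uv(1) by auto
    obtain m' z' where v [simp]: "v = (m', z')" "m' \<in> carrier M" "z' \<in> H" using uv(2) by auto
    have e: "dact z' (\<lambda>w\<in>H. \<ominus>\<^bsub>M\<^esub> act w m) \<in> DerH"
      using bnd_closed[OF uv(1)] by (simp add: der_action_closed)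
    have "(\<lambda>w\<in>H. \<ominus>\<^bsub>M\<^esub> act w (act z m' \<ominus>\<^bsub>M\<^esub> act z' m)) = dact z (\<lambda>w\<in>H. \<ominus>\<^bsub>M\<^esub> act w m') \<ominus>\<^bsub>DER\<^esub>
        dact z' (\<lambda>w\<in>H. \<ominus>\<^bsub>M\<^esub> act w m)"
      unfolding DER_minus[OF e]
    proof (rule DerH_eqI)
      fix w assume [simp]: "w \<in> H"
      show "(\<lambda>w\<in>H. \<ominus>\<^bsub>M\<^esub> act w (act z m' \<ominus>\<^bsub>M\<^esub> act z' m)) w =
          (\<lambda>w\<in>H. dact z (\<lambda>w\<in>H. \<ominus>\<^bsub>M\<^esub> act w m') w \<ominus>\<^bsub>M\<^esub>
          dact z' (\<lambda>w\<in>H. \<ominus>\<^bsub>M\<^esub> act w m) w) w"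
        apply (simp add: der_action_apply act_rules act_bracket)
        by (rule N.M.formal_sum_eqI, (rule N.M.formal_sum_intros | (rule N.M.formal_sum_atom, simp))+, simp add: algebra_simps)
    qed simp_all
    then show ?thesis by simp
  qed
  moreover have "x_act (X_ext \<Delta>) p \<lblot>u, v\<rblot>\<^bsub>MH\<^esub> =
      \<lblot>x_act (X_ext \<Delta>) p u, v\<rblot>\<^bsub>MH\<^esub> \<oplus>\<^bsub>MH\<^esub> \<lblot>u, x_act (X_ext \<Delta>) p v\<rblot>\<^bsub>MH\<^esub>"
    if p: "p \<in> carrier PD" and uv: "u \<in> carrier MH" "v \<in> carrier MH" for p u v
  proof -
    obtain m z where [simp]: "u = (m, z)" "m \<in> carrier M" "z \<in> H" using uv(1) by auto
    obtain m' z' where [simp]: "v = (m', z')" "m' \<in> carrier M" "z' \<in> H" using uv(2) by auto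
    obtain d x where [simp]: "p = (d, x)" "x \<in> carrier G" and d: "d \<in> DerH" using p by auto
    note [simp] = DerH_rules[OF d]
    have "\<lblot>x, \<lblot>z, z'\<rblot>\<^bsub>G\<^esub>\<rblot>\<^bsub>G\<^esub> = \<lblot>\<lblot>x, z\<rblot>\<^bsub>G\<^esub>, z'\<rblot>\<^bsub>G\<^esub> \<oplus>\<^bsub>G\<^esub> \<lblot>z, \<lblot>x, z'\<rblot>\<^bsub>G\<^esub>\<rblot>\<^bsub>G\<^esub>"
      apply (simp add: jacobi_left[of x z z'])
      by (rule M.formal_sum_eqI, (rule M.formal_sum_intros | (rule M.formal_sum_atom, simp))+, simp add: algebra_simps)
    then show ?thesis
      apply (simp add: act_rules act_bracket DerH_bracket[OF d])
      by (rule N.M.formal_sum_eqI, (rule N.M.formal_sum_intros | (rule N.M.formal_sum_atom, simp))+, simp add: algebra_simps)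
  qed
  moreover have "x_bnd (X_ext \<Delta>) (x_act (X_ext \<Delta>) p u) =
      \<lblot>p, x_bnd (X_ext \<Delta>) u\<rblot>\<^bsub>PD\<^esub>"
    if p: "p \<in> carrier PD" and u: "u \<in> carrier MH" for p u
  proof -
    obtain m z where [simp]: "u = (m, z)" "m \<in> carrier M" "z \<in> H" using u by auto
    obtain d x where [simp]: "p = (d, x)" "x \<in> carrier G" and d: "d \<in> DerH" using p by auto
    note [simp] = DerH_rules[OF d]
    have e: "dact z d \<in> DerH" using d by (simp add: der_action_closed)
    \<comment> \<open>The term \<open>d z\<close> of the action matches the bracket because
      \<open>dact z d = inn (d z)\<close>.\<close>
    have "(\<lambda>w\<in>H. \<ominus>\<^bsub>M\<^esub> act w (act x m \<oplus>\<^bsub>M\<^esub> d z)) = dact x (\<lambda>w\<in>H. \<ominus>\<^bsub>M\<^esub> act w m) \<ominus>\<^bsub>DER\<^esub>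
        dact z d"
      unfolding DER_minus[OF e]
    proof (rule DerH_eqI)
      fix w assume [simp]: "w \<in> H"
      show "(\<lambda>w\<in>H. \<ominus>\<^bsub>M\<^esub> act w (act x m \<oplus>\<^bsub>M\<^esub> d z)) w = (\<lambda>w\<in>H. dact x (\<lambda>w\<in>H. \<ominus>\<^bsub>M\<^esub> act w m) w \<ominus>\<^bsub>M\<^esub>
        dact z d w) w"
        apply (simp add: der_action_ideal[OF _ d] inner_apply der_action_apply act_rules act_bracket)
        by (rule N.M.formal_sum_eqI, (rule N.M.formal_sum_intros | (rule N.M.formal_sum_atom, simp))+, simp add: algebra_simps)
    qed simp_all
    then show ?thesis by simp
  qed
  moreover have "x_act (X_ext \<Delta>) (x_bnd (X_ext \<Delta>) u) v = \<lblot>u, v\<rblot>\<^bsub>MH\<^esub>"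
    if "u \<in> carrier MH" "v \<in> carrier MH" for u v
    using that by (auto simp: a_minus_def)
  ultimately show ?thesis
    unfolding crossed_module_def lie_hom_def
    using h.lie_algebra_semidirect lie_algebra_PD lie_module_MH by blast
qed

text \<open>The boundary of \<open>(m, z)\<close> vanishes iff \<open>z = 0\<close> and
  \<open>m\<close> is invariant. If \<open>(d, x)\<close> projects to zero, then \<open>x\<close>
  lies in \<open>H\<close> and \<open>d\<close> has class \<open>\<Delta> 0 = 0\<close>, so it is
  inner and \<open>(d, x)\<close> is a boundary. A preimage of \<open>q x\<close> is any
  representative of \<open>\<Delta> (q x)\<close> paired with \<open>x\<close>.\<close>

lemma crossed_extension_lam: "crossed_extension K Q M_H (inv_action act) (X_ext \<Delta>)"
proof -
  let ?E = "X_ext \<Delta>"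
  have "x_incl ?E \<in> lin_hom K M_H MH"
    by (rule lin_homI) (auto simp: invariantsD)
  moreover have "\<lblot>x_incl ?E m, x_incl ?E m'\<rblot>\<^bsub>MH\<^esub> = \<zero>\<^bsub>MH\<^esub>" if "m \<in> carrier M_H" "m' \<in> carrier M_H" for m m'
    using that by (simp add: act_rules bracket_additive invariantsD)
  moreover have "x_proj ?E \<in> lie_hom K PD Q"
    unfolding lie_hom_def
    by (auto intro!: lin_homI simp: quot.coset_add quot.coset_smult coset_bracket)
  moreover have "inj_on (x_incl ?E) (carrier M_H)" by (auto simp: inj_on_def)
  moreover have "x_incl ?E ` carrier M_H = a_kernel MH PD (x_bnd ?E)"
  proof -
    have "(\<lambda>w\<in>H. \<ominus>\<^bsub>M\<^esub> act w m) = (\<lambda>z\<in>H. \<zero>\<^bsub>M\<^esub>) \<longleftrightarrow> (\<forall>w\<in>H. act w m = \<zero>\<^bsub>M\<^esub>)" if "m \<in> carrier M" for m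
    proof -
      have "\<ominus>\<^bsub>M\<^esub> act w m = \<zero>\<^bsub>M\<^esub> \<longleftrightarrow> act w m = \<zero>\<^bsub>M\<^esub>" if "w \<in> H" for w
        using N.M.minus_minus[of "act w m"] that \<open>m \<in> carrier M\<close> by auto
      then show ?thesis by (auto simp: fun_eq_iff restrict_def)
    qed
    then show ?thesis by (auto simp: a_kernel_def kernel_def invariants_def)
  qed
  moreover have "x_bnd ?E ` carrier MH = a_kernel PD Q (x_proj ?E)"
  proof
    show "x_bnd ?E ` carrier MH \<subseteq> a_kernel PD Q (x_proj ?E)"
      using bnd_closed by (auto simp: a_kernel_def kernel_def q_zero)
    show "a_kernel PD Q (x_proj ?E) \<subseteq> x_bnd ?E ` carrier MH"
    proof
      fix p assume "p \<in> a_kernel PD Q (x_proj ?E)"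
      then obtain d x where p: "p = (d, x)" "d \<in> DerH" "x \<in> carrier G" "cls d = \<Delta> (q x)" "q x = \<zero>\<^bsub>Q\<^esub>"
        by (auto simp: a_kernel_def kernel_def)
      then have x: "x \<in> H" using quot.coset_eq_zero_iff quot.zero_quot by simp
      have "cls d = \<zero>\<^bsub>V\<^esub>" using p \<Delta>_rules(4) by simp
      then obtain m where m: "m \<in> carrier M" "d = inn m"
        using cls_zero_iff p by auto
      then have "p = x_bnd ?E (\<ominus>\<^bsub>M\<^esub> m, x)" using p x by (auto simp: inner_der_def act_rules)
      moreover have "(\<ominus>\<^bsub>M\<^esub> m, x) \<in> carrier MH" using m x by simp
      ultimately show "p \<in> x_bnd ?E ` carrier MH" by (rule image_eqI)
    qed
  qed
  moreover have "x_proj ?E ` carrier PD = carrier Q"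
  proof
    show "x_proj ?E ` carrier PD \<subseteq> carrier Q" by auto
    show "carrier Q \<subseteq> x_proj ?E ` carrier PD"
    proof
      fix X assume "X \<in> carrier Q"
      then obtain x where x: "x \<in> carrier G" "X = q x" by (rule quot.quot_cases)
      have "\<Delta> (q x) \<in> carrier V" using x \<Delta>_rules(1) by simp
      then obtain d where "d \<in> DerH" "\<Delta> (q x) = cls d" by (rule V_cases)
      then have "(d, x) \<in> carrier PD" using x by simp
      moreover have "X = x_proj ?E (d, x)" using x by simp
      ultimately show "X \<in> x_proj ?E ` carrier PD" by blast
    qed
  qed
  moreover have "x_incl ?E (inv_action act (x_proj ?E p) m) = x_act ?E p (x_incl ?E m)"
    if "p \<in> carrier PD" "m \<in> carrier M_H" for p m
    using that by (auto simp: inv_action_rep DerH_rules bracket_additive invariantsD)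
  ultimately show ?thesis
    unfolding crossed_extension_def using crossed_module_lam
    by (intro conjI ballI) (simp_all only: lam_ext_simps)
qed

sublocale X: crossed_ext K Q M_H "inv_action act" "X_ext \<Delta>"
  by (intro crossed_ext.intro crossed_ext_axioms.intro I.lie_module_axioms crossed_extension_lam)

end

section \<open>Independence of \<open>lam\<close> from the representative\<close>

context lie_ideal_module
begin

text \<open>If \<open>\<Delta>' = \<delta> [d\<^sub>0] + \<Delta>\<close>, then \<open>(d, x) \<mapsto> (d + x d\<^sub>0, x)\<close> and \<open>(m, z) \<mapsto> (m - d\<^sub>0 z, z)\<close> is an
  isomorphism of crossed extensions.\<close>

lemma crossed_cocycle_inner:
  assumes \<Delta>: "\<Delta> \<in> DerQ"
    and C: "C \<in> carrier V"
    and \<Delta>': "\<Delta>' = inner_der Q hact C \<oplus>\<^bsub>Der K Q V hact\<^esub> \<Delta>"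
    and c: "X_cocycle \<Delta> c"
  shows "X_cocycle \<Delta>' c"
proof -
  have \<Delta>'': "\<Delta>' \<in> DerQ"
    unfolding \<Delta>' using V.inner_der_derivation[OF C] \<Delta> V.H1.M.a_closed by simp
  interpret X: lam_setup K G M act H \<Delta> by unfold_locales fact
  interpret X': lam_setup K G M act H \<Delta>' by unfold_locales fact
  obtain d0 where d0: "d0 \<in> DerH" and C': "C = cls d0" using V_cases[OF C] .
  note [simp] = DerH_rules[OF d0]
  define \<alpha> where "\<alpha> = (\<lambda>(m, z). (m \<ominus>\<^bsub>M\<^esub> d0 z, z))"
  define \<beta> where "\<beta> = (\<lambda>(d, x). (d \<oplus>\<^bsub>DER\<^esub> dact x d0, x))"
  have e [simp]: "dact x d0 \<in> DerH" if "x \<in> carrier G" for x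
    using that d0 by (simp add: der_action_closed)
  have \<beta>_closed: "\<beta> p \<in> carrier X'.PD" if p': "p \<in> carrier X.PD" for p
  proof -
    obtain d x where p: "p = (d, x)" "d \<in> DerH" "x \<in> carrier G" "cls d = \<Delta> (q x)" using p' by auto
    have "\<Delta>' (q x) = hact (q x) C \<oplus>\<^bsub>V\<^esub> \<Delta> (q x)"
      using p by (simp add: \<Delta>' inner_der_def)
    also have "\<dots> = cls (dact x d0) \<oplus>\<^bsub>V\<^esub> cls d"
      using p d0 by (simp add: C' H1_action_cls)
    also have "\<dots> = cls (\<lambda>z\<in>H. d z \<oplus>\<^bsub>M\<^esub> dact x d0 z)"
      using p by (simp add: X.cls_simps(1) h.H1.W.M.a_comm cls_rules(1) X.\<Delta>_rules(1))
    finally show ?thesis using p by (simp add: \<beta>_def X.DerH_closed)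
  qed
  have \<beta>_lin: "\<beta> \<in> lin_hom K X.PD X'.PD"
  proof (rule lin_homI)
    fix u v k assume u: "u \<in> carrier X.PD"
    obtain d x where [simp]: "u = (d, x)" "x \<in> carrier G" and d: "d \<in> DerH" using u by auto
    note [simp] = DerH_rules[OF d]
    show "\<beta> (k \<odot>\<^bsub>X.PD\<^esub> u) = k \<odot>\<^bsub>X'.PD\<^esub> \<beta> u" if "k \<in> carrier K"
      using that d0 by (auto simp: \<beta>_def D.act_rules N.smult_r_distr DerH_rules(1)[OF e])
    assume v: "v \<in> carrier X.PD"
    obtain d' x' where [simp]: "v = (d', x')" "x' \<in> carrier G" and d': "d' \<in> DerH" using v by auto
    note [simp] = DerH_rules[OF d']
    show "\<beta> (u \<oplus>\<^bsub>X.PD\<^esub> v) = \<beta> u \<oplus>\<^bsub>X'.PD\<^esub> \<beta> v"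
      using d0 by (auto simp: \<beta>_def D.act_rules N.M.a_ac DerH_rules(1)[OF e])
  qed (rule \<beta>_closed)
  have \<beta>: "\<beta> \<in> lie_hom K X.PD X'.PD"
  proof -
    have "\<beta> \<lblot>u, v\<rblot>\<^bsub>X.PD\<^esub> = \<lblot>\<beta> u, \<beta> v\<rblot>\<^bsub>X'.PD\<^esub>" if uv: "u \<in> carrier X.PD" "v \<in> carrier X.PD" for u v
    proof -
      obtain d x where [simp]: "u = (d, x)" "x \<in> carrier G" "d \<in> DerH" using uv(1) by auto
      obtain d' x' where [simp]: "v = (d', x')" "x' \<in> carrier G" "d' \<in> DerH" using uv(2) by auto
      \<comment> \<open>\<open>x \<mapsto> dact x d0\<close> is itself an inner derivation of
        \<open>G\<close> with values in \<open>DER\<close>, which is what makes the shear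
        \<open>\<beta>\<close> respect brackets.\<close>
      have "dact x d' \<ominus>\<^bsub>DER\<^esub> dact x' d \<oplus>\<^bsub>DER\<^esub>
          dact \<lblot>x, x'\<rblot>\<^bsub>G\<^esub> d0 =
        dact x (d' \<oplus>\<^bsub>DER\<^esub> dact x' d0) \<ominus>\<^bsub>DER\<^esub>
        dact x' (d \<oplus>\<^bsub>DER\<^esub> dact x d0)"
        apply (simp add: D.act_rules D.act_bracket d0 del: DER_simps h.Der_simps(2-4))
        by (rule h.H1.M.formal_sum_eqI, (rule h.H1.M.formal_sum_intros | (rule h.H1.M.formal_sum_atom, simp add: der_action_closed d0))+, simp add: algebra_simps)
      then show ?thesis by (simp add: \<beta>_def del: DER_simps(2-4) h.Der_simps(2-4))
    qed
    then show ?thesis using \<beta>_lin by (auto simp: lie_hom_def)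
  qed
  have \<alpha>: "\<alpha> \<in> lin_hom K X.MH X.MH"
  proof (rule lin_homI)
    fix u v k assume u: "u \<in> carrier X.MH"
    obtain m z where [simp]: "u = (m, z)" "m \<in> carrier M" "z \<in> H" using u by auto
    show "\<alpha> u \<in> carrier X.MH" by (simp add: \<alpha>_def)
    show "\<alpha> (k \<odot>\<^bsub>X.MH\<^esub> u) = k \<odot>\<^bsub>X.MH\<^esub> \<alpha> u" if "k \<in> carrier K"
      using that by (simp add: \<alpha>_def a_minus_def N.smult_r_distr N.smult_r_minus)
    assume v: "v \<in> carrier X.MH"
    obtain m' z' where [simp]: "v = (m', z')" "m' \<in> carrier M" "z' \<in> H" using v by auto
    show "\<alpha> (u \<oplus>\<^bsub>X.MH\<^esub> v) = \<alpha> u \<oplus>\<^bsub>X.MH\<^esub> \<alpha> v"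
      apply (simp add: \<alpha>_def)
      by (rule N.M.formal_sum_eqI, (rule N.M.formal_sum_intros | (rule N.M.formal_sum_atom, simp))+, simp add: algebra_simps)
  qed
  show ?thesis
  proof (rule X.X.crossed_cocycle_morphism[OF X'.crossed_extension_lam _ _ _ _ _ _ c, unfolded X.lam_ext_simps X'.lam_ext_simps])
    show "\<alpha> \<in> lin_hom K X.MH X.MH" by (rule \<alpha>)
    show "\<beta> \<in> lie_hom K X.PD X'.PD" by (rule \<beta>)
    show "\<alpha> (n, \<zero>\<^bsub>G\<^esub>) = (n, \<zero>\<^bsub>G\<^esub>)" if "n \<in> carrier M_H" for n
      using that by (simp add: \<alpha>_def invariantsD)
    show "x_bnd (X_ext \<Delta>') (\<alpha> a) = \<beta> (x_bnd (X_ext \<Delta>) a)"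
      if a: "a \<in> carrier X.MH" for a
    proof -
      obtain m z where [simp]: "a = (m, z)" "m \<in> carrier M" "z \<in> H" using a by auto
      \<comment> \<open>Here \<open>dact z d0 = inn (d0 z)\<close> matches the shift in
        \<open>\<alpha>\<close> with the shift in \<open>\<beta>\<close>.\<close>
      have "(\<lambda>w\<in>H. \<ominus>\<^bsub>M\<^esub> act w (m \<ominus>\<^bsub>M\<^esub> d0 z)) = (\<lambda>w\<in>H. \<ominus>\<^bsub>M\<^esub> act w m \<oplus>\<^bsub>M\<^esub> dact z d0 w)"
      proof (rule restrict_ext)
        fix w assume [simp]: "w \<in> H"
        show "\<ominus>\<^bsub>M\<^esub> act w (m \<ominus>\<^bsub>M\<^esub> d0 z) = \<ominus>\<^bsub>M\<^esub> act w m \<oplus>\<^bsub>M\<^esub> dact z d0 w"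
          apply (simp add: der_action_ideal[OF _ d0] inner_apply act_rules)
          by (rule N.M.formal_sum_eqI, (rule N.M.formal_sum_intros | (rule N.M.formal_sum_atom, simp))+, simp add: algebra_simps)
      qed
      then show ?thesis by (auto simp: \<alpha>_def \<beta>_def cong: restrict_cong)
    qed
    show "x_proj (X_ext \<Delta>') (\<beta> p) = x_proj (X_ext \<Delta>) p"
      if "p \<in> carrier X.PD" for p
      using that by (auto simp: \<beta>_def)
    show "\<alpha> (x_act (X_ext \<Delta>) p a) = x_act (X_ext \<Delta>') (\<beta> p) (\<alpha> a)"
      if p: "p \<in> carrier X.PD" and a: "a \<in> carrier X.MH" for p a
    proof -
      obtain m z where [simp]: "a = (m, z)" "m \<in> carrier M" "z \<in> H" using a by auto
      obtain d x where [simp]: "p = (d, x)" "x \<in> carrier G" and d: "d \<in> DerH" using p by auto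
      note [simp] = DerH_rules[OF d]
      show ?thesis
        apply (simp add: \<alpha>_def \<beta>_def act_rules der_action_apply)
        by (rule N.M.formal_sum_eqI, (rule N.M.formal_sum_intros | (rule N.M.formal_sum_atom, simp))+, simp add: algebra_simps)
    qed
  qed
qed

lemma H1_H1_cases:
  assumes "X \<in> carrier (H1_H1 K G H M act)"
  obtains \<Delta> where "\<Delta> \<in> DerQ"
    "X = Cls \<Delta>"
  using V.H1.quot_cases[OF assms] by (auto simp: H1_class_def)

text \<open>Members of \<open>Cls \<Delta>\<close> differ from \<open>\<Delta>\<close> by inner
  derivations, so all their crossed extensions share the cocycle \<open>c\<close> and the union over
  the class collapses.\<close>

lemma lam_class:
  assumes \<Delta>: "\<Delta> \<in> DerQ"
    and c: "X_cocycle \<Delta> c"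
  shows "lam K G H M act (Cls \<Delta>) = H3_class K Q M_H (inv_action act) c"
proof -
  have "crossed_class K Q M_H (inv_action act) (X_ext \<Delta>') = H3_class K Q M_H (inv_action act) c"
    if \<Delta>': "\<Delta>' \<in> Cls \<Delta>" for \<Delta>'
  proof -
    have "\<Delta>' \<in> {u \<oplus>\<^bsub>Der K Q V hact\<^esub> \<Delta> | u. u \<in> Inn Q V hact}"
      using \<Delta>' by (simp only: H1_class_def[of K Q] V.H1.coset_def')
    then obtain u where u: "u \<in> Inn Q V hact"
      "\<Delta>' = u \<oplus>\<^bsub>Der K Q V hact\<^esub> \<Delta>" by blast
    obtain C where "C \<in> carrier V" "u = inner_der Q hact C"
      using u(1) unfolding Inn_def[of Q] by (rule imageE)
    with u have C: "C \<in> carrier V"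
      "\<Delta>' = inner_der Q hact C \<oplus>\<^bsub>Der K Q V hact\<^esub> \<Delta>" by simp_all
    have "\<Delta>' \<in> DerQ"
      unfolding C(2) using V.inner_der_derivation[OF C(1)] \<Delta> V.H1.M.a_closed by simp
    then interpret X': lam_setup K G M act H \<Delta>' by unfold_locales
    show ?thesis
      by (rule X'.X.crossed_class_eq) (rule crossed_cocycle_inner[OF \<Delta> C c])
  qed
  moreover have "\<Delta> \<in> Cls \<Delta>"
    unfolding H1_class_def using V.H1.U.a_rcos_self \<Delta> by simp
  ultimately show ?thesis unfolding lam_def by blast
qed

lemma lam_closed: "lam K G H M act \<in> carrier (H1_H1 K G H M act) \<rightarrow> carrier (H3_inv K G H M act)"
proof
  fix X assume "X \<in> carrier (H1_H1 K G H M act)"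
  then obtain \<Delta> where \<Delta>: "\<Delta> \<in> DerQ"
    "X = Cls \<Delta>" by (rule H1_H1_cases)
  interpret X: lam_setup K G M act H \<Delta> by unfold_locales fact
  obtain c where c: "X_cocycle \<Delta> c"
    using X.X.crossed_cocycle_exists by blast
  show "lam K G H M act X \<in> carrier (H3_inv K G H M act)"
    using X.X.crossed_class_H3 X.X.crossed_class_eq[OF c] lam_class[OF \<Delta>(1) c] \<Delta>(2) by simp
qed

end

section \<open>Extensions and the map \<open>\<rho>\<close>\<close>

locale extension = lie_module K L N act for K and L and N and act +
  fixes E
  assumes ext: "lie_extension K L N act E"
begin

abbreviation "e \<equiv> ext_alg E"
abbreviation "i \<equiv> ext_incl E"
abbreviation "p \<equiv> ext_proj E"

lemma extension_rules:
  "lie_algebra K e" "i \<in> lin_hom K N e" "p \<in> lie_hom K e L" "inj_on i (carrier N)"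
  "i ` carrier N = a_kernel e L p" "p ` carrier e = carrier L"
  "\<And>n n'. n \<in> carrier N \<Longrightarrow> n' \<in> carrier N \<Longrightarrow> \<lblot>i n, i n'\<rblot>\<^bsub>e\<^esub> = \<zero>\<^bsub>e\<^esub>"
  "\<And>y n. y \<in> carrier e \<Longrightarrow> n \<in> carrier N \<Longrightarrow> i (act (p y) n) = \<lblot>y, i n\<rblot>\<^bsub>e\<^esub>"
  using ext by (auto simp: lie_extension_def)

sublocale e: lie_algebra K e by (rule extension_rules)

lemmas i_hom = lin_homD[OF extension_rules(2)]
  lin_hom_additive[OF N.module_axioms e.module_axioms extension_rules(2)]
lemmas p_hom = lin_homD[OF lie_homD(1)[OF extension_rules(3)]] lie_homD(2)[OF extension_rules(3)]
  lin_hom_additive[OF e.module_axioms module_axioms lie_homD(1)[OF extension_rules(3)]]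

lemma i_eq: "n \<in> carrier N \<Longrightarrow> n' \<in> carrier N \<Longrightarrow> i n = i n' \<longleftrightarrow> n = n'"
  using extension_rules(4) by (auto dest: inj_onD)

lemma kernel_p: "y \<in> carrier e \<Longrightarrow> p y = \<zero>\<^bsub>L\<^esub> \<Longrightarrow> y \<in> i ` carrier N"
  and p_i: "n \<in> carrier N \<Longrightarrow> p (i n) = \<zero>\<^bsub>L\<^esub>"
  using extension_rules(5) by (auto simp: e.a_kernelI)

lemma p_surj:
  assumes "x \<in> carrier L"
  obtains y where "y \<in> carrier e" "p y = x"
proof -
  have "x \<in> p ` carrier e" using assms extension_rules(6) by simp
  then show thesis using that by auto
qed

end

lemma extension_intro: "lie_module K L N act \<Longrightarrow> lie_extension K L N act E \<Longrightarrow> extension K L N act E"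
  by (intro extension.intro extension_axioms.intro)

section \<open>Equivalence of extensions\<close>

context lie_module
begin

lemma ext_equiv_refl:
  assumes "lie_extension K L N act E"
  shows "(E, E) \<in> ext_equiv K L N act"
  using assms by (auto simp: ext_equiv_def lie_hom_def lin_hom_def intro!: bexI[of _ "\<lambda>y. y"])

lemma ext_equiv_trans:
  assumes "(E, E') \<in> ext_equiv K L N act" "(E', E'') \<in> ext_equiv K L N act"
  shows "(E, E'') \<in> ext_equiv K L N act"
proof -
  obtain \<phi> \<psi> where \<phi>: "\<phi> \<in> lie_hom K (ext_alg E) (ext_alg E')"
    "\<And>n. n \<in> carrier N \<Longrightarrow> \<phi> (ext_incl E n) = ext_incl E' n"
    "\<And>y. y \<in> carrier (ext_alg E) \<Longrightarrow> ext_proj E' (\<phi> y) = ext_proj E y"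
    and \<psi>: "\<psi> \<in> lie_hom K (ext_alg E') (ext_alg E'')"
    "\<And>n. n \<in> carrier N \<Longrightarrow> \<psi> (ext_incl E' n) = ext_incl E'' n"
    "\<And>y. y \<in> carrier (ext_alg E') \<Longrightarrow> ext_proj E'' (\<psi> y) = ext_proj E' y"
    using assms by (auto simp: ext_equiv_def)
  note \<phi>D = lin_homD[OF lie_homD(1)[OF \<phi>(1)]]
  have "(\<lambda>y. \<psi> (\<phi> y)) \<in> lie_hom K (ext_alg E) (ext_alg E'')"
    using lin_hom_comp[OF lie_homD(1)[OF \<phi>(1)] lie_homD(1)[OF \<psi>(1)]]
    by (auto simp: lie_hom_def lie_homD(2)[OF \<phi>(1)] lie_homD(2)[OF \<psi>(1)] \<phi>D)
  then show ?thesis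
    using assms \<phi>(2,3) \<psi>(2,3) \<phi>D(1) by (auto simp: ext_equiv_def intro!: bexI[of _ "\<lambda>y. \<psi> (\<phi> y)"])
qed

text \<open>The five lemma: a morphism that is the identity on both ends is bijective, and its
  inverse is again a morphism. This is why \<open>ext_equiv\<close> can ask for a morphism
  only.\<close>

lemma ext_equiv_sym:
  assumes "(E, E') \<in> ext_equiv K L N act"
  shows "(E', E) \<in> ext_equiv K L N act"
proof -
  have exts: "lie_extension K L N act E" "lie_extension K L N act E'"
    using assms by (auto simp: ext_equiv_def)
  interpret E: extension K L N act E by (rule extension_intro[OF lie_module_axioms]) fact
  interpret E': extension K L N act E' by (rule extension_intro[OF lie_module_axioms]) fact
  obtain \<phi> where \<phi>: "\<phi> \<in> lie_hom K (ext_alg E) (ext_alg E')"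
    "\<And>n. n \<in> carrier N \<Longrightarrow> \<phi> (ext_incl E n) = ext_incl E' n"
    "\<And>y. y \<in> carrier (ext_alg E) \<Longrightarrow> ext_proj E' (\<phi> y) = ext_proj E y"
    using assms by (auto simp: ext_equiv_def)
  note \<phi>D = lin_homD[OF lie_homD(1)[OF \<phi>(1)]] lie_homD(2)[OF \<phi>(1)]
    lin_hom_additive[OF E.e.module_axioms E'.e.module_axioms lie_homD(1)[OF \<phi>(1)]]
  have inj: "inj_on \<phi> (carrier (ext_alg E))"
  proof (rule inj_onI)
    fix y y' assume y: "y \<in> carrier (ext_alg E)" "y' \<in> carrier (ext_alg E)" "\<phi> y = \<phi> y'"
    have "ext_proj E (y \<ominus>\<^bsub>ext_alg E\<^esub> y') = \<zero>\<^bsub>L\<^esub>"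
      using y \<phi>(3)[of y] \<phi>(3)[of y'] by (simp add: E.p_hom)
    then obtain n where n: "n \<in> carrier N" "y \<ominus>\<^bsub>ext_alg E\<^esub> y' = ext_incl E n"
      using E.kernel_p y by blast
    have "ext_incl E' n = \<phi> (y \<ominus>\<^bsub>ext_alg E\<^esub> y')" using n \<phi>(2) by simp
    also have "\<dots> = ext_incl E' \<zero>\<^bsub>N\<^esub>" using y \<phi>D(1)[of y'] by (simp add: \<phi>D(7) E'.i_hom)
    finally have "n = \<zero>\<^bsub>N\<^esub>" using n E'.i_eq by simp
    then show "y = y'" using n y by (simp add: E.i_hom E.e.M.minus_eq_zero_iff)
  qed
  have surj: "\<phi> ` carrier (ext_alg E) = carrier (ext_alg E')"
  proof
    show "\<phi> ` carrier (ext_alg E) \<subseteq> carrier (ext_alg E')" using \<phi>D(1) by auto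
    show "carrier (ext_alg E') \<subseteq> \<phi> ` carrier (ext_alg E)"
    proof
      fix y' assume y': "y' \<in> carrier (ext_alg E')"
      then obtain y where y: "y \<in> carrier (ext_alg E)" "ext_proj E y = ext_proj E' y'"
        using E.p_surj E'.p_hom(1) by metis
      then have "ext_proj E' (y' \<ominus>\<^bsub>ext_alg E'\<^esub> \<phi> y) = \<zero>\<^bsub>L\<^esub>"
        using y' \<phi>(3) \<phi>D(1) by (simp add: E'.p_hom)
      then obtain n where n: "n \<in> carrier N" "y' \<ominus>\<^bsub>ext_alg E'\<^esub> \<phi> y = ext_incl E' n"
        using E'.kernel_p y y' \<phi>D(1) by blast
      have "y' = (y' \<ominus>\<^bsub>ext_alg E'\<^esub> \<phi> y) \<oplus>\<^bsub>ext_alg E'\<^esub> \<phi> y"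
        using y y' \<phi>D(1)[of y]
        apply simp
        by (rule E'.e.M.formal_sum_eqI, (rule E'.e.M.formal_sum_intros | (rule E'.e.M.formal_sum_atom, simp))+, simp add: algebra_simps)
      also have "\<dots> = \<phi> (ext_incl E n \<oplus>\<^bsub>ext_alg E\<^esub> y)"
        using n y by (simp add: \<phi>(2) \<phi>D E.i_hom)
      finally show "y' \<in> \<phi> ` carrier (ext_alg E)" using n y E.i_hom(1) by blast
    qed
  qed
  define \<psi> where "\<psi> = the_inv_into (carrier (ext_alg E)) \<phi>"
  have \<psi>: "\<psi> y' \<in> carrier (ext_alg E)" "\<phi> (\<psi> y') = y'" if "y' \<in> carrier (ext_alg E')" for y'
    using that inj surj by (auto simp: \<psi>_def the_inv_into_into f_the_inv_into_f)
  have eqI: "y = y'" if "y \<in> carrier (ext_alg E)" "y' \<in> carrier (ext_alg E)" "\<phi> y = \<phi> y'" for y y'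
    using inj that by (auto dest: inj_onD)
  have "\<psi> \<in> lie_hom K (ext_alg E') (ext_alg E)"
    unfolding lie_hom_def
  proof (clarsimp, intro conjI ballI lin_homI)
    fix u v k assume u: "u \<in> carrier (ext_alg E')"
    then show "\<psi> u \<in> carrier (ext_alg E)" by (rule \<psi>)
    show "\<psi> (k \<odot>\<^bsub>ext_alg E'\<^esub> u) = k \<odot>\<^bsub>ext_alg E\<^esub> \<psi> u" if "k \<in> carrier K"
      by (rule eqI) (use u that in \<open>simp_all add: \<psi> \<phi>D\<close>)
    assume v: "v \<in> carrier (ext_alg E')"
    show "\<psi> (u \<oplus>\<^bsub>ext_alg E'\<^esub> v) = \<psi> u \<oplus>\<^bsub>ext_alg E\<^esub> \<psi> v"
      by (rule eqI) (use u v in \<open>simp_all add: \<psi> \<phi>D\<close>)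
    show "\<psi> \<lblot>u, v\<rblot>\<^bsub>ext_alg E'\<^esub> = \<lblot>\<psi> u, \<psi> v\<rblot>\<^bsub>ext_alg E\<^esub>"
      by (rule eqI) (use u v in \<open>simp_all add: \<psi> \<phi>D\<close>)
  qed
  moreover have "\<psi> (ext_incl E' n) = ext_incl E n" if "n \<in> carrier N" for n
    by (rule eqI) (use that in \<open>simp_all add: \<psi> \<phi>(2) E.i_hom E'.i_hom\<close>)
  moreover have "ext_proj E (\<psi> y) = ext_proj E' y" if "y \<in> carrier (ext_alg E')" for y
    using \<phi>(3)[of "\<psi> y"] \<psi> that by simp
  ultimately show ?thesis using exts by (auto simp: ext_equiv_def)
qed

lemma ext_equiv_class_eq:
  assumes "(E, E') \<in> ext_equiv K L N act"
  shows "ext_equiv K L N act `` {E} = ext_equiv K L N act `` {E'}"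
  using assms ext_equiv_sym ext_equiv_trans by blast

end

section \<open>Restriction of extensions to the ideal\<close>

context lie_ideal_module
begin

lemma restrict_extension:
  assumes "lie_extension K G M act E"
  shows "lie_extension K G_H M act (restrict_ext H E)"
proof -
  interpret E: extension K G M act E by (rule extension_intro[OF lie_module_axioms assms])
  note [simp] = E.p_hom E.i_hom E.p_i
  let ?S = "{y \<in> carrier (ext_alg E). ext_proj E y \<in> H}"
  have "lie_algebra K ((ext_alg E)\<lparr>carrier := ?S\<rparr>)"
    by (rule E.e.lie_subalgebra, rule E.e.submoduleI) auto
  moreover have "ext_proj E ` ?S = H"
  proof
    show "H \<subseteq> ext_proj E ` ?S"
    proof
      fix z assume z: "z \<in> H"
      then obtain y where "y \<in> carrier (ext_alg E)" "ext_proj E y = z"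
        using E.p_surj[of z] by auto
      then show "z \<in> ext_proj E ` ?S" using z by auto
    qed
  qed auto
  moreover have "ext_incl E ` carrier M = {y \<in> ?S. ext_proj E y = \<zero>\<^bsub>G\<^esub>}"
    using E.extension_rules(5) by (auto simp: E.e.a_kernelI)
  ultimately show ?thesis
    using E.extension_rules(4,7,8)
    by (auto simp: lie_extension_def restrict_ext_def lie_hom_def lin_hom_def a_kernel_def kernel_def)
qed

lemma restrict_ext_equiv:
  assumes "(E, E') \<in> ext_equiv K G M act"
  shows "(restrict_ext H E, restrict_ext H E') \<in> ext_equiv K G_H M act"
proof -
  obtain \<phi> where \<phi>: "\<phi> \<in> lie_hom K (ext_alg E) (ext_alg E')"
    "\<And>n. n \<in> carrier M \<Longrightarrow> \<phi> (ext_incl E n) = ext_incl E' n"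
    "\<And>y. y \<in> carrier (ext_alg E) \<Longrightarrow> ext_proj E' (\<phi> y) = ext_proj E y"
    and ext: "lie_extension K G M act E" "lie_extension K G M act E'"
    using assms by (auto simp: ext_equiv_def)
  have "\<phi> \<in> lie_hom K (ext_alg (restrict_ext H E)) (ext_alg (restrict_ext H E'))"
    using \<phi>(1,3) by (auto simp: restrict_ext_def lie_hom_def lin_hom_def)
  then show ?thesis
    using \<phi>(2,3) restrict_extension[OF ext(1)] restrict_extension[OF ext(2)]
    by (auto simp: ext_equiv_def restrict_ext_def)
qed

lemma split_extension: "lie_extension K G_H M act (split_ext G_H M act)"
  by (auto simp: lie_extension_def split_ext_def lie_hom_def lin_hom_def h.lie_algebra_semidirect
      act_rules bracket_additive inj_on_def a_kernel_def kernel_def image_iff)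

text \<open>A morphism \<open>\<phi>\<close> from the split extension gives the splitting
  \<open>z \<mapsto> \<phi> (0, z)\<close>, and a splitting \<open>s\<close> gives the morphism
  \<open>(m, z) \<mapsto> i m + s z\<close>.\<close>

lemma split_ext_equiv_iff:
  assumes "lie_extension K G M act E"
  shows "(split_ext G_H M act, restrict_ext H E) \<in> ext_equiv K G_H M act \<longleftrightarrow>
    (\<exists>s\<in>lie_hom K G_H (ext_alg E). \<forall>z\<in>H. ext_proj E (s z) = z)"
proof
  interpret E: extension K G M act E by (rule extension_intro[OF lie_module_axioms assms])
  note semidirect_simps' [simp] = h.semidirect_simps[simplified]
  {
    assume "(split_ext G_H M act, restrict_ext H E) \<in> ext_equiv K G_H M act"
    then obtain \<phi> where \<phi>: "\<phi> \<in> lie_hom K (semidirect M G_H act) (ext_alg (restrict_ext H E))"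
      "\<And>y. y \<in> carrier M \<times> H \<Longrightarrow> ext_proj E (\<phi> y) = snd y"
      by (auto simp: ext_equiv_def split_ext_def restrict_ext_def)
    have \<phi>D: "\<phi> u \<in> carrier (ext_alg E)" "\<phi> (u \<oplus>\<^bsub>semidirect M G_H act\<^esub> v) = \<phi> u \<oplus>\<^bsub>ext_alg E\<^esub> \<phi> v"
      "\<phi> \<lblot>u, v\<rblot>\<^bsub>semidirect M G_H act\<^esub> = \<lblot>\<phi> u, \<phi> v\<rblot>\<^bsub>ext_alg E\<^esub>"
      "k \<in> carrier K \<Longrightarrow> \<phi> (k \<odot>\<^bsub>semidirect M G_H act\<^esub> u) = k \<odot>\<^bsub>ext_alg E\<^esub> \<phi> u"
      if "u \<in> carrier M \<times> H" "v \<in> carrier M \<times> H" for u v k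
      using \<phi>(1) that by (auto simp: lie_hom_def lin_hom_def restrict_ext_def)
    have "(\<lambda>z. \<phi> (\<zero>\<^bsub>M\<^esub>, z)) \<in> lie_hom K G_H (ext_alg E)"
      using \<phi>D(2)[of "(\<zero>\<^bsub>M\<^esub>, _)" "(\<zero>\<^bsub>M\<^esub>, _)"] \<phi>D(3)[of "(\<zero>\<^bsub>M\<^esub>, _)" "(\<zero>\<^bsub>M\<^esub>, _)"] \<phi>D(4)[of "(\<zero>\<^bsub>M\<^esub>, _)" "(\<zero>\<^bsub>M\<^esub>, _)"]
        \<phi>D(1)[of "(\<zero>\<^bsub>M\<^esub>, _)" "(\<zero>\<^bsub>M\<^esub>, _)"]
      by (auto simp: lie_hom_def lin_hom_def act_rules)
    then show "\<exists>s\<in>lie_hom K G_H (ext_alg E). \<forall>z\<in>H. ext_proj E (s z) = z"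
      using \<phi>(2) by (auto intro!: bexI[of _ "\<lambda>z. \<phi> (\<zero>\<^bsub>M\<^esub>, z)"])
  }
  {
    assume "\<exists>s\<in>lie_hom K G_H (ext_alg E). \<forall>z\<in>H. ext_proj E (s z) = z"
    then obtain s where s: "s \<in> lie_hom K G_H (ext_alg E)" "\<And>z. z \<in> H \<Longrightarrow> ext_proj E (s z) = z"
      by blast
    have sD: "s z \<in> carrier (ext_alg E)" "s (z \<oplus>\<^bsub>G\<^esub> w) = s z \<oplus>\<^bsub>ext_alg E\<^esub> s w"
      "s \<lblot>z, w\<rblot>\<^bsub>G\<^esub> = \<lblot>s z, s w\<rblot>\<^bsub>ext_alg E\<^esub>" "k \<in> carrier K \<Longrightarrow> s (k \<odot>\<^bsub>G\<^esub> z) = k \<odot>\<^bsub>ext_alg E\<^esub> s z"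
      if "z \<in> H" "w \<in> H" for z w k
      using s(1) that by (auto simp: lie_hom_def lin_hom_def)
    define \<phi> where "\<phi> = (\<lambda>(m, z). ext_incl E m \<oplus>\<^bsub>ext_alg E\<^esub> s z)"
    have i_act: "ext_incl E (act z m) = \<lblot>s z, ext_incl E m\<rblot>\<^bsub>ext_alg E\<^esub>" if "z \<in> H" "m \<in> carrier M" for z m
      using E.extension_rules(8)[of "s z" m] that s(2) sD(1)[of z z] by simp
    have s_closed: "s z \<in> carrier (ext_alg E)" "k \<in> carrier K \<Longrightarrow> s (k \<odot>\<^bsub>G\<^esub> z) = k \<odot>\<^bsub>ext_alg E\<^esub> s z"
      if "z \<in> H" for z k
      using sD(1,4)[of z z] that by auto
    note [simp] = E.i_hom E.p_hom E.p_i s_closed sD(2,3) s(2)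
    have "\<phi> \<in> lie_hom K (semidirect M G_H act) (ext_alg (restrict_ext H E))"
      unfolding lie_hom_def mem_Collect_eq
    proof (intro conjI ballI lin_homI)
      fix u v k assume u: "u \<in> carrier (semidirect M G_H act)"
      obtain m z where [simp]: "u = (m, z)" "m \<in> carrier M" "z \<in> H" using u by auto
      show "\<phi> u \<in> carrier (ext_alg (restrict_ext H E))"
        by (simp add: \<phi>_def restrict_ext_def)
      show "\<phi> (k \<odot>\<^bsub>semidirect M G_H act\<^esub> u) = k \<odot>\<^bsub>ext_alg (restrict_ext H E)\<^esub> \<phi> u" if "k \<in> carrier K"
        using that by (simp add: \<phi>_def restrict_ext_def E.e.smult_r_distr)
      assume v: "v \<in> carrier (semidirect M G_H act)"
      obtain m' z' where [simp]: "v = (m', z')" "m' \<in> carrier M" "z' \<in> H" using v by auto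
      show "\<phi> (u \<oplus>\<^bsub>semidirect M G_H act\<^esub> v) = \<phi> u \<oplus>\<^bsub>ext_alg (restrict_ext H E)\<^esub> \<phi> v"
        by (simp add: \<phi>_def restrict_ext_def E.e.M.a_ac)
      have "\<lblot>ext_incl E m, s z'\<rblot>\<^bsub>ext_alg E\<^esub> = \<ominus>\<^bsub>ext_alg E\<^esub> \<lblot>s z', ext_incl E m\<rblot>\<^bsub>ext_alg E\<^esub>"
        by (rule E.e.bracket_antisym) simp_all
      then show "\<phi> \<lblot>u, v\<rblot>\<^bsub>semidirect M G_H act\<^esub> = \<lblot>\<phi> u, \<phi> v\<rblot>\<^bsub>ext_alg (restrict_ext H E)\<^esub>"
        apply (simp add: \<phi>_def restrict_ext_def i_act E.e.bracket_add_left E.e.bracket_add_right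
            E.extension_rules(7))
        by (rule E.e.M.formal_sum_eqI, (rule E.e.M.formal_sum_intros | (rule E.e.M.formal_sum_atom, simp))+, simp add: algebra_simps)
    qed
    moreover have "s \<zero>\<^bsub>G\<^esub> = \<zero>\<^bsub>ext_alg E\<^esub>"
      using lin_hom_additive(1)[OF h.module_axioms E.e.module_axioms lie_homD(1)[OF s(1)]] by simp
    ultimately show "(split_ext G_H M act, restrict_ext H E) \<in> ext_equiv K G_H M act"
      using split_extension restrict_extension[OF assms]
      by (auto simp: ext_equiv_def split_ext_def restrict_ext_def \<phi>_def intro!: bexI[of _ \<phi>])
  }
qed

end

section \<open>The derivation attached to a splitting over the ideal\<close>

locale rho_setup = lie_ideal_module K G M act H + extension K G M act E
  for K and G and M and act and H and E +
  fixes s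
  assumes s: "s \<in> lie_hom K G_H e" and p_s [simp]: "z \<in> H \<Longrightarrow> p (s z) = z"
begin

lemma s_hom:
  "z \<in> H \<Longrightarrow> s z \<in> carrier e" "z \<in> H \<Longrightarrow> w \<in> H \<Longrightarrow> s (z \<oplus>\<^bsub>G\<^esub> w) = s z \<oplus>\<^bsub>e\<^esub> s w"
  "k \<in> carrier K \<Longrightarrow> z \<in> H \<Longrightarrow> s (k \<odot>\<^bsub>G\<^esub> z) = k \<odot>\<^bsub>e\<^esub> s z"
  "z \<in> H \<Longrightarrow> w \<in> H \<Longrightarrow> s \<lblot>z, w\<rblot>\<^bsub>G\<^esub> = \<lblot>s z, s w\<rblot>\<^bsub>e\<^esub>"
  "s \<zero>\<^bsub>G\<^esub> = \<zero>\<^bsub>e\<^esub>" "z \<in> H \<Longrightarrow> s (\<ominus>\<^bsub>G\<^esub> z) = \<ominus>\<^bsub>e\<^esub> s z"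
  "z \<in> H \<Longrightarrow> w \<in> H \<Longrightarrow> s (z \<ominus>\<^bsub>G\<^esub> w) = s z \<ominus>\<^bsub>e\<^esub> s w"
  using lin_homD[OF lie_homD(1)[OF s]] lie_homD(2)[OF s]
    lin_hom_additive[OF h.module_axioms e.module_axioms lie_homD(1)[OF s]]
  by (simp_all add: G_H_uminus G_H_minus)

declare s_hom(1) [simp] i_hom(1) [simp] p_hom(1) [simp] p_i [simp]

abbreviation "\<theta> y \<equiv> rho_der G H M E s y"

lemma \<theta>_ext [simp]: "\<theta> y \<in> extensional H"
  by (simp add: rho_der_def)

text \<open>\<open>\<theta> y\<close> measures how far \<open>s\<close> is from being equivariant
  under \<open>y\<close>. As \<open>p\<close> is a homomorphism with \<open>p (s z) = z\<close>, the
  difference is killed by \<open>p\<close> and comes from \<open>M\<close>.\<close>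

lemma \<theta>_rules:
  assumes y: "y \<in> carrier e" and z: "z \<in> H"
  shows \<theta>_closed: "\<theta> y z \<in> carrier M" and i_\<theta>: "i (\<theta> y z) = \<lblot>y, s z\<rblot>\<^bsub>e\<^esub> \<ominus>\<^bsub>e\<^esub> s \<lblot>p y, z\<rblot>\<^bsub>G\<^esub>"
proof -
  have "\<lblot>y, s z\<rblot>\<^bsub>e\<^esub> \<ominus>\<^bsub>e\<^esub> s \<lblot>p y, z\<rblot>\<^bsub>G\<^esub> \<in> i ` carrier M"
    using y z by (intro kernel_p) (simp_all add: p_hom)
  then show "\<theta> y z \<in> carrier M" "i (\<theta> y z) = \<lblot>y, s z\<rblot>\<^bsub>e\<^esub> \<ominus>\<^bsub>e\<^esub> s \<lblot>p y, z\<rblot>\<^bsub>G\<^esub>"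
    using z extension_rules(4)
    by (auto simp: rho_der_def f_the_inv_into_f the_inv_into_into simp del: i_hom)
qed

lemma i_act: "y \<in> carrier e \<Longrightarrow> m \<in> carrier M \<Longrightarrow> i (act (p y) m) = \<lblot>y, i m\<rblot>\<^bsub>e\<^esub>"
  by (rule extension_rules(8))

lemma i_act_H: "z \<in> H \<Longrightarrow> m \<in> carrier M \<Longrightarrow> i (act z m) = \<lblot>s z, i m\<rblot>\<^bsub>e\<^esub>"
  using i_act[of "s z" m] by simp

lemma \<theta>_DerH:
  assumes [simp]: "y \<in> carrier e"
  shows "\<theta> y \<in> DerH"
proof (rule DerHI)
  note [simp] = \<theta>_closed
  \<comment> \<open>Equations in \<open>M\<close> are tested after the injection \<open>i\<close>,
    where \<open>\<theta>\<close> turns into an explicit difference in \<open>e\<close>.\<close>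
  show "\<theta> y (k \<odot>\<^bsub>G\<^esub> z) = k \<odot>\<^bsub>M\<^esub> \<theta> y z" if "k \<in> carrier K" "z \<in> H" for k z
    using that by (subst i_eq[symmetric])
      (simp_all add: i_hom i_\<theta> s_hom e.bracket_smult_right bracket_smult_right
        a_minus_def e.smult_r_distr e.smult_r_minus)
  fix z w assume [simp]: "z \<in> H" "w \<in> H"
  show "\<theta> y z \<in> carrier M" by simp
  show "\<theta> y (z \<oplus>\<^bsub>G\<^esub> w) = \<theta> y z \<oplus>\<^bsub>M\<^esub> \<theta> y w"
    apply (subst i_eq[symmetric])
      apply (simp_all add: i_hom i_\<theta> s_hom e.bracket_add_right bracket_add_right)
    by (rule e.M.formal_sum_eqI, (rule e.M.formal_sum_intros | (rule e.M.formal_sum_atom, simp))+, simp add: algebra_simps)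
  have "\<lblot>y, \<lblot>s z, s w\<rblot>\<^bsub>e\<^esub>\<rblot>\<^bsub>e\<^esub> = \<lblot>\<lblot>y, s z\<rblot>\<^bsub>e\<^esub>, s w\<rblot>\<^bsub>e\<^esub> \<oplus>\<^bsub>e\<^esub> \<lblot>s z, \<lblot>y, s w\<rblot>\<^bsub>e\<^esub>\<rblot>\<^bsub>e\<^esub>"
    apply (simp add: e.jacobi_left[of y])
    by (rule e.M.formal_sum_eqI, (rule e.M.formal_sum_intros | (rule e.M.formal_sum_atom, simp))+, simp add: algebra_simps)
  moreover have "\<lblot>p y, \<lblot>z, w\<rblot>\<^bsub>G\<^esub>\<rblot>\<^bsub>G\<^esub> = \<lblot>\<lblot>p y, z\<rblot>\<^bsub>G\<^esub>, w\<rblot>\<^bsub>G\<^esub> \<oplus>\<^bsub>G\<^esub> \<lblot>z, \<lblot>p y, w\<rblot>\<^bsub>G\<^esub>\<rblot>\<^bsub>G\<^esub>"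
    apply (simp add: jacobi_left[of "p y"])
    by (rule M.formal_sum_eqI, (rule M.formal_sum_intros | (rule M.formal_sum_atom, simp))+, simp add: algebra_simps)
  moreover have "\<lblot>\<lblot>y, s z\<rblot>\<^bsub>e\<^esub>, s w\<rblot>\<^bsub>e\<^esub> = \<ominus>\<^bsub>e\<^esub> \<lblot>s w, \<lblot>y, s z\<rblot>\<^bsub>e\<^esub>\<rblot>\<^bsub>e\<^esub>"
    "\<lblot>s \<lblot>p y, z\<rblot>\<^bsub>G\<^esub>, s w\<rblot>\<^bsub>e\<^esub> = \<ominus>\<^bsub>e\<^esub> \<lblot>s w, s \<lblot>p y, z\<rblot>\<^bsub>G\<^esub>\<rblot>\<^bsub>e\<^esub>"
    by (rule e.bracket_antisym; simp)+
  ultimately show "\<theta> y \<lblot>z, w\<rblot>\<^bsub>G\<^esub> = act z (\<theta> y w) \<ominus>\<^bsub>M\<^esub> act w (\<theta> y z)"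
    apply (subst i_eq[symmetric])
      apply (simp_all add: i_hom i_act_H i_\<theta> s_hom(2,4-) e.bracket_additive)
    by (rule e.M.formal_sum_eqI, (rule e.M.formal_sum_intros | (rule e.M.formal_sum_atom, simp))+, simp add: algebra_simps)
qed simp

lemma \<theta>_add:
  assumes [simp]: "y \<in> carrier e" "y' \<in> carrier e"
  shows "\<theta> (y \<oplus>\<^bsub>e\<^esub> y') = \<theta> y \<oplus>\<^bsub>DER\<^esub> \<theta> y'"
proof (rule DerH_eqI)
  note [simp] = \<theta>_closed
  fix z assume [simp]: "z \<in> H"
  show "\<theta> (y \<oplus>\<^bsub>e\<^esub> y') z = (\<theta> y \<oplus>\<^bsub>DER\<^esub> \<theta> y') z"
    apply (simp, subst i_eq[symmetric])
      apply (simp_all add: i_hom i_\<theta> s_hom p_hom e.bracket_add_left bracket_add_left)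
    by (rule e.M.formal_sum_eqI, (rule e.M.formal_sum_intros | (rule e.M.formal_sum_atom, simp))+, simp add: algebra_simps)
qed simp_all

lemma \<theta>_smult:
  assumes [simp]: "k \<in> carrier K" "y \<in> carrier e"
  shows "\<theta> (k \<odot>\<^bsub>e\<^esub> y) = k \<odot>\<^bsub>DER\<^esub> \<theta> y"
proof (rule DerH_eqI)
  note [simp] = \<theta>_closed
  fix z assume [simp]: "z \<in> H"
  show "\<theta> (k \<odot>\<^bsub>e\<^esub> y) z = (k \<odot>\<^bsub>DER\<^esub> \<theta> y) z"
    by (simp, subst i_eq[symmetric]) (simp_all add: i_hom i_\<theta> s_hom p_hom e.bracket_smult_left bracket_smult_left
        a_minus_def e.smult_r_distr e.smult_r_minus)
qed simp_all

text \<open>With \<open>\<theta>_add\<close> and \<open>\<theta>_smult\<close> this makes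
  \<open>y \<mapsto> (\<theta> y, p y)\<close> a homomorphism to the semidirect product of
  \<open>DER\<close> and \<open>G\<close>.\<close>

lemma \<theta>_bracket:
  assumes [simp]: "y \<in> carrier e" "y' \<in> carrier e"
  shows "\<theta> \<lblot>y, y'\<rblot>\<^bsub>e\<^esub> = dact (p y) (\<theta> y') \<ominus>\<^bsub>DER\<^esub> dact (p y') (\<theta> y)"
proof (rule DerH_eqI)
  note [simp] = \<theta>_closed
  note d = DER_minus[OF der_action_closed[OF p_hom(1)[OF assms(2)] \<theta>_DerH[OF assms(1)]]]
  fix z assume [simp]: "z \<in> H"
  show "\<theta> \<lblot>y, y'\<rblot>\<^bsub>e\<^esub> z =
      (dact (p y) (\<theta> y') \<ominus>\<^bsub>DER\<^esub> dact (p y') (\<theta> y)) z"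
    apply (simp add: d der_action_apply, subst i_eq[symmetric])
      apply (simp_all add: i_hom i_act i_\<theta> s_hom p_hom e.jacobi_left jacobi_left e.bracket_additive)
    by (rule e.M.formal_sum_eqI, (rule e.M.formal_sum_intros | (rule e.M.formal_sum_atom, simp))+, simp add: algebra_simps)
qed (simp_all add: DER_minus der_action_closed \<theta>_DerH)

text \<open>The sign agrees with that of the boundary map
  \<open>(m, z) \<mapsto> (- inn m, z)\<close>, so that this map can factor through
  \<open>e\<close>.\<close>

lemma \<theta>_i:
  assumes [simp]: "m \<in> carrier M" "z \<in> H"
  shows "\<theta> (i m) z = \<ominus>\<^bsub>M\<^esub> act z m"
proof -
  have "\<lblot>i m, s z\<rblot>\<^bsub>e\<^esub> = \<ominus>\<^bsub>e\<^esub> \<lblot>s z, i m\<rblot>\<^bsub>e\<^esub>" by (rule e.bracket_antisym) simp_all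
  then show ?thesis
    by (subst i_eq[symmetric]) (simp_all add: \<theta>_closed i_hom i_\<theta> i_act_H s_hom bracket_additive)
qed

text \<open>\<open>s\<close> is a homomorphism and \<open>p (s z) = z\<close>, so the two terms of
  \<open>\<theta>\<close> coincide.\<close>

lemma \<theta>_s:
  assumes [simp]: "z \<in> H" "w \<in> H"
  shows "\<theta> (s z) w = \<zero>\<^bsub>M\<^esub>"
  by (subst i_eq[symmetric]) (simp_all add: \<theta>_closed i_hom i_\<theta> s_hom)

text \<open>An element of the kernel of \<open>e\<close> over \<open>Q\<close> has the form
  \<open>i m + s z\<close>; its first part changes \<open>\<theta> y\<close> by an inner derivation,
  its second part not at all.\<close>

lemma cls_\<theta>_add_kernel:
  assumes y: "y \<in> carrier e" and z: "z \<in> H" and m: "m \<in> carrier M"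
  shows "cls (\<theta> ((i m \<oplus>\<^bsub>e\<^esub> s z) \<oplus>\<^bsub>e\<^esub> y)) = cls (\<theta> y)"
proof -
  have "\<theta> ((i m \<oplus>\<^bsub>e\<^esub> s z) \<oplus>\<^bsub>e\<^esub> y) = inn (\<ominus>\<^bsub>M\<^esub> m) \<oplus>\<^bsub>DER\<^esub> \<theta> y"
    unfolding \<theta>_add[OF e.M.a_closed[OF i_hom(1)[OF m] s_hom(1)[OF z]] y]
      \<theta>_add[OF i_hom(1)[OF m] s_hom(1)[OF z]]
    by (rule DerH_eqI) (use m z y in \<open>simp_all add: \<theta>_i \<theta>_s inner_apply act_rules \<theta>_closed\<close>)
  moreover have "\<theta> ((i m \<oplus>\<^bsub>e\<^esub> s z) \<oplus>\<^bsub>e\<^esub> y) \<in> DerH" "\<theta> y \<in> DerH"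
    using m y z by (intro \<theta>_DerH; simp)+
  from cls_rules(5)[OF this] have "?thesis \<longleftrightarrow> (\<exists>m'\<in>carrier M. \<theta> ((i m \<oplus>\<^bsub>e\<^esub> s z) \<oplus>\<^bsub>e\<^esub> y) =
      inn m' \<oplus>\<^bsub>DER\<^esub> \<theta> y)" .
  ultimately show ?thesis using m N.M.a_inv_closed by blast
qed

text \<open>\<open>y - s (p y)\<close> is killed by \<open>p\<close>, hence comes from
  \<open>M\<close>.\<close>

lemma kernel_qp:
  assumes y: "y \<in> carrier e" and py: "p y \<in> H"
  obtains m z where "m \<in> carrier M" "z \<in> H" "y = i m \<oplus>\<^bsub>e\<^esub> s z"
proof -
  have "y \<ominus>\<^bsub>e\<^esub> s (p y) \<in> i ` carrier M"
    using assms by (intro kernel_p) (simp_all add: p_hom)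
  then obtain m where m: "m \<in> carrier M" "y \<ominus>\<^bsub>e\<^esub> s (p y) = i m" by auto
  have "y = (y \<ominus>\<^bsub>e\<^esub> s (p y)) \<oplus>\<^bsub>e\<^esub> s (p y)"
    using assms
    apply -
    by (rule e.M.formal_sum_eqI, (rule e.M.formal_sum_intros | (rule e.M.formal_sum_atom, simp))+, simp add: algebra_simps)
  then show thesis using that m py by simp
qed

lemma cls_\<theta>_eq:
  assumes y: "y \<in> carrier e" "y' \<in> carrier e" and eq: "q (p y) = q (p y')"
  shows "cls (\<theta> y) = cls (\<theta> y')"
proof -
  have "p (y \<ominus>\<^bsub>e\<^esub> y') \<in> H" using quot.coset_eq_iff[of "p y" "p y'"] y eq by (simp add: p_hom)
  then obtain m z where m: "m \<in> carrier M" "z \<in> H" "y \<ominus>\<^bsub>e\<^esub> y' = i m \<oplus>\<^bsub>e\<^esub> s z"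
    using kernel_qp y by (metis e.M.minus_closed)
  have "y = (y \<ominus>\<^bsub>e\<^esub> y') \<oplus>\<^bsub>e\<^esub> y'"
    using y
    apply -
    by (rule e.M.formal_sum_eqI, (rule e.M.formal_sum_intros | (rule e.M.formal_sum_atom, simp))+, simp add: algebra_simps)
  then show ?thesis using cls_\<theta>_add_kernel[of y' z m] m y by simp
qed

abbreviation "\<Delta> \<equiv> rho_derivation K G H M act E s"

text \<open>All \<open>y\<close> over one coset give the same class, so the union in
  \<open>rho_derivation\<close> collapses. Every coset has the form \<open>q (p y)\<close>, so the
  rule determines \<open>\<Delta>\<close>.\<close>

lemma \<Delta>_apply:
  assumes "y \<in> carrier e"
  shows "\<Delta> (q (p y)) = cls (\<theta> y)"
proof -
  have "(\<Union>y'\<in>{y' \<in> carrier e. q (p y') = q (p y)}. cls (\<theta> y')) = cls (\<theta> y)"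
    using assms cls_\<theta>_eq by blast
  then show ?thesis using assms by (simp add: rho_derivation_def)
qed

lemma Q_cases:
  assumes "X \<in> carrier Q"
  obtains y where "y \<in> carrier e" "X = q (p y)"
  using quot.quot_cases[OF assms] p_surj by metis

lemma \<Delta>_derivation: "\<Delta> \<in> DerQ"
proof (rule V.derivationsI)
  show "\<Delta> \<in> extensional (carrier Q)" by (simp add: rho_derivation_def)
  show "\<Delta> \<in> lin_hom K Q V"
  proof (rule lin_homI)
    fix X Y k assume "X \<in> carrier Q"
    then obtain y where y: "y \<in> carrier e" "X = q (p y)" by (rule Q_cases)
    show "\<Delta> X \<in> carrier V" using y by (simp add: \<Delta>_apply cls_rules \<theta>_DerH)
    show "\<Delta> (k \<odot>\<^bsub>Q\<^esub> X) = k \<odot>\<^bsub>V\<^esub> \<Delta> X" if "k \<in> carrier K"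
    proof -
      have "k \<odot>\<^bsub>Q\<^esub> X = q (p (k \<odot>\<^bsub>e\<^esub> y))" using that y by (simp add: quot.coset_smult p_hom)
      then show ?thesis using that y by (simp only: \<Delta>_apply e.smult_closed \<theta>_smult cls_rules(4) \<theta>_DerH)
    qed
    assume "Y \<in> carrier Q"
    then obtain y' where y': "y' \<in> carrier e" "Y = q (p y')" by (rule Q_cases)
    have "X \<oplus>\<^bsub>Q\<^esub> Y = q (p (y \<oplus>\<^bsub>e\<^esub> y'))" using y y' by (simp add: quot.coset_add p_hom)
    then show "\<Delta> (X \<oplus>\<^bsub>Q\<^esub> Y) = \<Delta> X \<oplus>\<^bsub>V\<^esub> \<Delta> Y"
      using y y' by (simp only: \<Delta>_apply e.M.a_closed \<theta>_add cls_rules(2) \<theta>_DerH)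
  qed
  fix X Y assume "X \<in> carrier Q" "Y \<in> carrier Q"
  then obtain y y' where y: "y \<in> carrier e" "X = q (p y)" and y': "y' \<in> carrier e" "Y = q (p y')"
    by (metis Q_cases)
  have "\<lblot>X, Y\<rblot>\<^bsub>Q\<^esub> = q (p \<lblot>y, y'\<rblot>\<^bsub>e\<^esub>)" using y y' by (simp add: coset_bracket p_hom)
  then show "\<Delta> \<lblot>X, Y\<rblot>\<^bsub>Q\<^esub> = hact X (\<Delta> Y) \<ominus>\<^bsub>V\<^esub> hact Y (\<Delta> X)"
    using y y' by (simp only: \<Delta>_apply e.bracket_closed \<theta>_bracket cls_rules(3) \<theta>_DerH der_action_closed
        p_hom(1) H1_action_cls)
qed

end

section \<open>Independence of \<open>rho\<close> from the choices\<close>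

context lie_ideal_module
begin

text \<open>Two splittings differ by \<open>i t\<close> for a derivation \<open>t\<close> from
  \<open>H\<close> to \<open>M\<close>. Passing from \<open>s\<close> to \<open>s'\<close> adds
  \<open>dact (p y) t\<close> to \<open>\<theta> y\<close>, and so adds to
  \<open>rho_derivation\<close> the inner derivation given by \<open>cls t\<close>.\<close>

lemma rho_sections:
  assumes "rho_setup K G M act H E s" "rho_setup K G M act H E s'"
  shows "Cls (rho_derivation K G H M act E s') =
    Cls (rho_derivation K G H M act E s)"
proof -
  interpret S: rho_setup K G M act H E s by fact
  interpret S': rho_setup K G M act H E s' by fact
  note [simp] = S.s_hom(1) S'.s_hom(1) S.\<theta>_closed S'.\<theta>_closed
  have "\<exists>m\<in>carrier M. S.i m = s' z \<ominus>\<^bsub>S.e\<^esub> s z" if z: "z \<in> H" for z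
  proof -
    have "s' z \<ominus>\<^bsub>S.e\<^esub> s z \<in> S.i ` carrier M" using z by (intro S.kernel_p) (simp_all add: S.p_hom)
    then show ?thesis by force
  qed
  then obtain t0 where t0: "\<And>z. z \<in> H \<Longrightarrow> t0 z \<in> carrier M \<and> S.i (t0 z) = s' z \<ominus>\<^bsub>S.e\<^esub> s z"
    by metis
  define t where "t = restrict t0 H"
  have t [simp]: "t z \<in> carrier M" and it: "S.i (t z) = s' z \<ominus>\<^bsub>S.e\<^esub> s z" if "z \<in> H" for z
    using t0 that by (auto simp: t_def)
  have tD: "t \<in> DerH"
  proof (rule DerHI)
    show "t \<in> extensional H" by (simp add: t_def)
    show "t z \<in> carrier M" if "z \<in> H" for z using that by simp
    show "t (k \<odot>\<^bsub>G\<^esub> z) = k \<odot>\<^bsub>M\<^esub> t z" if "k \<in> carrier K" "z \<in> H" for k z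
      using that by (subst S.i_eq[symmetric])
        (simp_all add: S.i_hom it S.s_hom S'.s_hom a_minus_def S.e.smult_r_distr S.e.smult_r_minus)
    fix z w assume [simp]: "z \<in> H" "w \<in> H"
    show "t (z \<oplus>\<^bsub>G\<^esub> w) = t z \<oplus>\<^bsub>M\<^esub> t w"
      apply (subst S.i_eq[symmetric])
        apply (simp_all add: S.i_hom it S.s_hom S'.s_hom)
      by (rule S.e.M.formal_sum_eqI, (rule S.e.M.formal_sum_intros | (rule S.e.M.formal_sum_atom, simp))+, simp add: algebra_simps)
    \<comment> \<open>One action is expressed through \<open>s\<close> and the other through
      \<open>s'\<close>, so that the mixed brackets cancel.\<close>
    have 1: "S.i (act z (t w)) = \<lblot>s z, s' w\<rblot>\<^bsub>S.e\<^esub> \<ominus>\<^bsub>S.e\<^esub> \<lblot>s z, s w\<rblot>\<^bsub>S.e\<^esub>"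
      by (simp add: S.i_act_H it S.e.bracket_additive)
    have 2: "S.i (act w (t z)) = \<lblot>s' w, s' z\<rblot>\<^bsub>S.e\<^esub> \<ominus>\<^bsub>S.e\<^esub> \<lblot>s' w, s z\<rblot>\<^bsub>S.e\<^esub>"
      by (simp add: S'.i_act_H it S.e.bracket_additive)
    have "\<lblot>s' z, s' w\<rblot>\<^bsub>S.e\<^esub> = \<ominus>\<^bsub>S.e\<^esub> \<lblot>s' w, s' z\<rblot>\<^bsub>S.e\<^esub>" "\<lblot>s z, s' w\<rblot>\<^bsub>S.e\<^esub> = \<ominus>\<^bsub>S.e\<^esub> \<lblot>s' w, s z\<rblot>\<^bsub>S.e\<^esub>"
      by (rule S.e.bracket_antisym; simp)+
    with 1 2 show "t \<lblot>z, w\<rblot>\<^bsub>G\<^esub> = act z (t w) \<ominus>\<^bsub>M\<^esub> act w (t z)"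
      apply (subst S.i_eq[symmetric])
        apply (simp_all add: S.i_hom it S.s_hom(4) S'.s_hom(4))
      by (rule S.e.M.formal_sum_eqI, (rule S.e.M.formal_sum_intros | (rule S.e.M.formal_sum_atom, simp))+, simp add: algebra_simps)
  qed
  have "rho_derivation K G H M act E s' = inner_der Q hact (cls t)
      \<oplus>\<^bsub>Der K Q V hact\<^esub> rho_derivation K G H M act E s"
  proof (rule extensionalityI)
    fix X assume X: "X \<in> carrier Q"
    then obtain y where y: "y \<in> carrier S.e" "X = q (S.p y)" by (rule S.Q_cases)
    have "S'.\<theta> y = dact (S.p y) t \<oplus>\<^bsub>DER\<^esub> S.\<theta> y"
    proof (rule DerH_eqI)
      fix z assume [simp]: "z \<in> H"
      have [simp]: "y \<in> carrier S.e" by (rule y)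
      show "S'.\<theta> y z = (dact (S.p y) t \<oplus>\<^bsub>DER\<^esub> S.\<theta> y) z"
        apply (simp add: der_action_apply, subst S.i_eq[symmetric])
          apply (simp_all add: S.i_hom it S.i_\<theta> S'.i_\<theta> S.i_act S.e.bracket_additive)
        by (rule S.e.M.formal_sum_eqI, (rule S.e.M.formal_sum_intros | (rule S.e.M.formal_sum_atom, simp))+, simp add: algebra_simps)
    qed simp_all
    then show "rho_derivation K G H M act E s' X = (inner_der Q hact (cls t)
      \<oplus>\<^bsub>Der K Q V hact\<^esub> rho_derivation K G H M act E s) X"
      using X y cls_rules(2)[of "dact (S.p y) t" "S.\<theta> y"]
      by (simp add: S.\<Delta>_apply S'.\<Delta>_apply inner_der_def H1_action_cls tD der_action_closed S.\<theta>_DerH del: DER_simps(3))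
  qed (simp_all add: rho_derivation_def)
  moreover have "inner_der Q hact (cls t) \<in> Inn Q V hact"
    by (auto simp: Inn_def[of Q] cls_rules tD)
  moreover have "rho_derivation K G H M act E s \<in> carrier (Der K Q V hact)"
    using S.\<Delta>_derivation by simp
  ultimately show ?thesis
    unfolding H1_class_def[of K Q] by (simp only: V.H1.coset_eqI)
qed

text \<open>The splitting is transported by \<open>\<phi>\<close>. Since \<open>\<phi>\<close> is
  the identity on \<open>M\<close>, the derivations \<open>\<theta>\<close> do not change at
  all.\<close>

lemma rho_equiv:
  assumes S: "rho_setup K G M act H E s" and eq: "(E, E') \<in> ext_equiv K G M act"
  obtains s' where "rho_setup K G M act H E' s'"
    "rho_derivation K G H M act E' s' = rho_derivation K G H M act E s"
proof -
  interpret S: rho_setup K G M act H E s by fact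
  obtain \<phi> where \<phi>: "\<phi> \<in> lie_hom K (ext_alg E) (ext_alg E')"
    "\<And>n. n \<in> carrier M \<Longrightarrow> \<phi> (ext_incl E n) = ext_incl E' n"
    "\<And>y. y \<in> carrier (ext_alg E) \<Longrightarrow> ext_proj E' (\<phi> y) = ext_proj E y"
    and ext': "lie_extension K G M act E'"
    using eq by (auto simp: ext_equiv_def)
  note [simp] = S.s_hom(1)
  interpret E': extension K G M act E' by (rule extension_intro[OF lie_module_axioms ext'])
  have "(\<lambda>z. \<phi> (s z)) \<in> lie_hom K G_H (ext_alg E')"
    using \<phi>(1) S.s by (auto simp: lie_hom_def lin_hom_def Pi_iff)
  then interpret S': rho_setup K G M act H E' "\<lambda>z. \<phi> (s z)"
    by unfold_locales (simp_all add: \<phi>(3))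
  note \<phi>D = lin_homD[OF lie_homD(1)[OF \<phi>(1)]] lie_homD(2)[OF \<phi>(1)]
    lin_hom_additive[OF S.e.module_axioms E'.e.module_axioms lie_homD(1)[OF \<phi>(1)]]
  have \<theta>: "S'.\<theta> (\<phi> y) = S.\<theta> y" if y: "y \<in> carrier S.e" for y
  proof (rule DerH_eqI)
    fix z assume z: "z \<in> H"
    have "ext_incl E' (S'.\<theta> (\<phi> y) z) = \<phi> (S.i (S.\<theta> y z))"
      using y z S'.i_\<theta>[of "\<phi> y" z] S.i_\<theta>[of y z] by (simp add: \<phi>D \<phi>(3))
    also have "\<dots> = ext_incl E' (S.\<theta> y z)" using y z by (simp add: \<phi>(2) S.\<theta>_closed)
    finally show "S'.\<theta> (\<phi> y) z = S.\<theta> y z" using y z S'.\<theta>_closed[of "\<phi> y" z] S.\<theta>_closed[of y z]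
      by (simp add: E'.i_eq \<phi>D(1))
  qed simp_all
  have "rho_derivation K G H M act E' (\<lambda>z. \<phi> (s z)) = rho_derivation K G H M act E s"
  proof (rule extensionalityI)
    fix X assume "X \<in> carrier Q"
    then obtain y where y: "y \<in> carrier S.e" "X = q (S.p y)" by (rule S.Q_cases)
    then show "rho_derivation K G H M act E' (\<lambda>z. \<phi> (s z)) X = rho_derivation K G H M act E s X"
      using S'.\<Delta>_apply[of "\<phi> y"] by (simp add: S.\<Delta>_apply \<theta> \<phi>D(1) \<phi>(3))
  qed (simp_all add: rho_derivation_def)
  then show thesis using that S'.rho_setup_axioms by blast
qed

lemma rho_setup_intro:
  assumes "lie_extension K G M act E" "s \<in> lie_hom K G_H (ext_alg E)" "\<And>z. z \<in> H \<Longrightarrow> ext_proj E (s z) = z"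
  shows "rho_setup K G M act H E s"
  using assms
  by (intro rho_setup.intro rho_setup_axioms.intro extension_intro lie_ideal_module_axioms lie_module_axioms)

text \<open>In the union that defines \<open>rho\<close>, \<open>rho_equiv\<close> reduces to one
  extension and \<open>rho_sections\<close> to one splitting of it.\<close>

lemma rho_class:
  assumes S: "rho_setup K G M act H E s"
  shows "rho K G H M act (ext_equiv K G M act `` {E}) =
    Cls (rho_derivation K G H M act E s)"
proof -
  interpret S: rho_setup K G M act H E s by fact
  have "Cls (rho_derivation K G H M act E' s') =
      Cls (rho_derivation K G H M act E s)"
    if E': "(E, E') \<in> ext_equiv K G M act" and s': "s' \<in> lie_hom K G_H (ext_alg E')"
      "\<forall>z\<in>H. ext_proj E' (s' z) = z" for E' s'
  proof -
    obtain s'' where s'': "rho_setup K G M act H E' s''"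
      "rho_derivation K G H M act E' s'' = rho_derivation K G H M act E s"
      using rho_equiv[OF S E'] .
    have "rho_setup K G M act H E' s'"
      using E' s' by (intro rho_setup_intro) (auto simp: ext_equiv_def)
    then show ?thesis using rho_sections[OF s''(1)] s''(2) by simp
  qed
  then have "rho K G H M act (ext_equiv K G M act `` {E}) \<subseteq>
      Cls (rho_derivation K G H M act E s)"
    unfolding rho_def by blast
  moreover have "(E, E) \<in> ext_equiv K G M act" by (rule ext_equiv_refl) (rule S.ext)
  then have "Cls (rho_derivation K G H M act E s) \<subseteq>
      rho K G H M act (ext_equiv K G M act `` {E})"
    unfolding rho_def using S.s S.p_s by blast
  ultimately show ?thesis by blast
qed

text \<open>\<open>H2_1\<close> is defined by an equality of restricted classes; through
  \<open>split_ext_equiv_iff\<close> this becomes a splitting over \<open>H\<close>, the datum on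
  which \<open>rho\<close> works.\<close>

lemma H2_1_iff:
  "X \<in> H2_1 K G H M act \<longleftrightarrow> (\<exists>E s. rho_setup K G M act H E s \<and> X = ext_equiv K G M act `` {E})"
proof
  assume X: "X \<in> H2_1 K G H M act"
  then obtain E where E: "lie_extension K G M act E" "X = ext_equiv K G M act `` {E}"
    by (auto simp: H2_1_def H2_def quotient_def)
  have "(E, E) \<in> ext_equiv K G M act" by (rule ext_equiv_refl) (rule E)
  moreover have "(restrict_ext H E, restrict_ext H E) \<in> ext_equiv K G_H M act"
    by (rule h.ext_equiv_refl) (rule restrict_extension, rule E)
  ultimately have "restrict_ext H E \<in> H2_res K G H M act X" using E(2) by (auto simp: H2_res_def)
  then have "(split_ext G_H M act, restrict_ext H E) \<in> ext_equiv K G_H M act"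
    using X by (simp add: H2_1_def)
  then obtain s where "s \<in> lie_hom K G_H (ext_alg E)" "\<And>z. z \<in> H \<Longrightarrow> ext_proj E (s z) = z"
    using split_ext_equiv_iff[OF E(1)] by blast
  then show "\<exists>E s. rho_setup K G M act H E s \<and> X = ext_equiv K G M act `` {E}"
    using rho_setup_intro[OF E(1)] E(2) by blast
next
  assume "\<exists>E s. rho_setup K G M act H E s \<and> X = ext_equiv K G M act `` {E}"
  then obtain E s where S: "rho_setup K G M act H E s" and X: "X = ext_equiv K G M act `` {E}"
    by blast
  interpret S: rho_setup K G M act H E s by fact
  have E: "(split_ext G_H M act, restrict_ext H E) \<in> ext_equiv K G_H M act"
    using split_ext_equiv_iff[OF S.ext] S.s S.p_s by blast
  have "ext_equiv K G_H M act `` {restrict_ext H E'} = ext_equiv K G_H M act `` {split_ext G_H M act}"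
    if "E' \<in> X" for E'
    using that h.ext_equiv_class_eq[OF h.ext_equiv_trans[OF E restrict_ext_equiv]] by (simp add: X)
  moreover have "E \<in> X" using ext_equiv_refl[OF S.ext] X by simp
  ultimately have "H2_res K G H M act X = ext_equiv K G_H M act `` {split_ext G_H M act}"
    unfolding H2_res_def by blast
  moreover have "X \<in> H2 K G M act" using S.ext by (auto simp: X H2_def intro: quotientI)
  ultimately show "X \<in> H2_1 K G H M act" by (simp add: H2_1_def)
qed

lemma rho_closed: "rho K G H M act \<in> H2_1 K G H M act \<rightarrow> carrier (H1_H1 K G H M act)"
proof
  fix X assume "X \<in> H2_1 K G H M act"
  then obtain E s where S: "rho_setup K G M act H E s" and X: "X = ext_equiv K G M act `` {E}"
    by (auto simp: H2_1_iff)
  interpret S: rho_setup K G M act H E s by fact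
  show "rho K G H M act X \<in> carrier (H1_H1 K G H M act)"
    unfolding X rho_class[OF S] unfolding H1_class_def[of K Q]
    by (rule V.H1.coset_closed) (simp add: S.\<Delta>_derivation)
qed

end

section \<open>Exactness\<close>

text \<open>The map \<open>y \<mapsto> (\<theta> y, p y)\<close> from \<open>e\<close> to \<open>lam_alg\<close> and the embedding
  \<open>(m, z) \<mapsto> i m + s z\<close> of \<open>M \<rtimes> H\<close> into \<open>e\<close> factor the boundary map of the crossed
  extension through \<open>e\<close>, so the Bianchi identity in \<open>e\<close> makes the 3-cocycle vanish.\<close>

lemma (in rho_setup) crossed_cocycle_zero:
  "X_cocycle \<Delta>
    (\<lambda>t\<in>carrier Q \<times> carrier Q \<times> carrier Q. \<zero>\<^bsub>M\<^esub>)"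
proof -
  interpret X: lam_setup K G M act H \<Delta> by unfold_locales (rule \<Delta>_derivation)
  let ?E = "X_ext \<Delta>"
  have lin_qp: "(\<lambda>y. q (p y)) \<in> lin_hom K e Q"
    by (rule lin_homI) (simp_all add: p_hom quot.coset_add quot.coset_smult)
  have "(\<lambda>X. X) \<in> lin_hom K Q Q" "(\<lambda>X. X) ` carrier Q \<subseteq> (\<lambda>y. q (p y)) ` carrier e"
    by (auto simp: lin_hom_def elim!: Q_cases)
  \<comment> \<open>The section of the crossed extension will be \<open>\<Theta>\<close> after
    \<open>\<tau>\<close>, so that its curvature is the image of the curvature of
    \<open>\<tau>\<close> in \<open>e\<close>.\<close>
  then obtain \<tau> where \<tau>: "\<tau> \<in> lin_hom K Q e" "\<And>X. X \<in> carrier Q \<Longrightarrow> q (p (\<tau> X)) = X"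
    using linear_lift[OF field_axioms e.module_axioms quot.module_quot lin_qp] by blast
  note \<tau>D [simp] = lin_homD[OF \<tau>(1)]
  define \<kappa> where "\<kappa> = (\<lambda>(X, Y)\<in>carrier Q \<times> carrier Q. \<lblot>\<tau> X, \<tau> Y\<rblot>\<^bsub>e\<^esub> \<ominus>\<^bsub>e\<^esub> \<tau> \<lblot>X, Y\<rblot>\<^bsub>Q\<^esub>)"
  have \<kappa>: "\<kappa> \<in> alt_bilinear K Q e"
    unfolding \<kappa>_def by (rule curvature_alt_bilinear[OF lie_algebra_quot e.lie_algebra_axioms \<tau>(1)])
  define j where "j = (\<lambda>(m, z). i m \<oplus>\<^bsub>e\<^esub> s z)"
  have j: "j \<in> lin_hom K X.MH e"
    by (rule lin_homI) (auto simp: j_def i_hom s_hom e.smult_r_distr e.M.a_ac)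
  have j_inj: "a = b" if ab: "a \<in> carrier X.MH" "b \<in> carrier X.MH" "j a = j b" for a b
  proof -
    obtain m z where a [simp]: "a = (m, z)" "m \<in> carrier M" "z \<in> H" using ab(1) by auto
    obtain m' z' where b [simp]: "b = (m', z')" "m' \<in> carrier M" "z' \<in> H" using ab(2) by auto
    have "p (j a) = z" "p (j b) = z'" by (simp_all add: j_def p_hom)
    then have "z = z'" using ab(3) by simp
    then show ?thesis using ab(3) by (simp add: j_def i_eq)
  qed
  \<comment> \<open>The curvature of \<open>\<tau>\<close> dies in \<open>Q\<close>, and
    \<open>kernel_qp\<close> says that the elements of \<open>e\<close> with this property form the
    image of \<open>j\<close>.\<close>
  have "\<kappa> ` (carrier Q \<times> carrier Q) \<subseteq> j ` carrier X.MH"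
  proof clarify
    fix X Y assume [simp]: "X \<in> carrier Q" "Y \<in> carrier Q"
    have "q (p (\<kappa> (X, Y))) = \<lblot>q (p (\<tau> X)), q (p (\<tau> Y))\<rblot>\<^bsub>Q\<^esub> \<ominus>\<^bsub>Q\<^esub> q (p (\<tau> \<lblot>X, Y\<rblot>\<^bsub>Q\<^esub>))"
      by (simp add: \<kappa>_def p_hom quot.coset_minus coset_bracket)
    then have "q (p (\<kappa> (X, Y))) = \<zero>\<^bsub>Q\<^esub>" by (simp add: \<tau>(2))
    then have "p (\<kappa> (X, Y)) \<in> H"
      using quot.coset_eq_zero_iff[of "p (\<kappa> (X, Y))"] by (simp add: quot.zero_quot \<kappa>_def)
    then obtain m z where "m \<in> carrier M" "z \<in> H" "\<kappa> (X, Y) = i m \<oplus>\<^bsub>e\<^esub> s z"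
      using kernel_qp[of "\<kappa> (X, Y)"] alt_bilinearD(1)[OF \<kappa>, of X Y] by auto
    then show "\<kappa> (X, Y) \<in> j ` carrier X.MH" by (auto simp: j_def image_iff)
  qed
  with \<kappa> obtain f where f: "f \<in> alt_bilinear K Q X.MH"
    "\<And>X Y. X \<in> carrier Q \<Longrightarrow> Y \<in> carrier Q \<Longrightarrow> j (f (X, Y)) = \<kappa> (X, Y)"
    using alt_bilinear_lift[OF field_axioms X.X.A.module_axioms[simplified] e.module_axioms j quot.module_quot]
    by blast
  note fD [simp] = alt_bilinearD[OF f(1)] alt_bilinearD(1)[OF f(1), simplified]
  define \<Theta> where "\<Theta> = (\<lambda>y. (\<theta> y, p y))"
  have \<Theta>: "\<Theta> \<in> lie_hom K e X.PD"
    unfolding lie_hom_def mem_Collect_eq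
  proof (intro conjI ballI lin_homI)
    fix u v k assume u: "u \<in> carrier e"
    show "\<Theta> u \<in> carrier X.PD" using u by (simp add: \<Theta>_def \<theta>_DerH \<Delta>_apply)
    show "\<Theta> (k \<odot>\<^bsub>e\<^esub> u) = k \<odot>\<^bsub>X.PD\<^esub> \<Theta> u" if "k \<in> carrier K"
      using that u by (simp add: \<Theta>_def \<theta>_smult p_hom)
    assume v: "v \<in> carrier e"
    show "\<Theta> (u \<oplus>\<^bsub>e\<^esub> v) = \<Theta> u \<oplus>\<^bsub>X.PD\<^esub> \<Theta> v" using u v by (simp add: \<Theta>_def \<theta>_add p_hom)
    show "\<Theta> \<lblot>u, v\<rblot>\<^bsub>e\<^esub> = \<lblot>\<Theta> u, \<Theta> v\<rblot>\<^bsub>X.PD\<^esub>" using u v by (simp add: \<Theta>_def \<theta>_bracket p_hom)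
  qed
  note \<Theta>D = lin_homD[OF lie_homD(1)[OF \<Theta>]] lie_homD(2)[OF \<Theta>]
    lin_hom_additive[OF e.module_axioms X.X.P.module_axioms[simplified] lie_homD(1)[OF \<Theta>]]
  \<comment> \<open>The boundary map is \<open>\<Theta>\<close> after \<open>j\<close>, because
    \<open>\<theta>\<close> is minus the inner derivation on \<open>i m\<close> and zero on
    \<open>s z\<close>.\<close>
  have bnd: "x_bnd ?E a = \<Theta> (j a)" if a: "a \<in> carrier X.MH" for a
  proof -
    obtain m z where [simp]: "a = (m, z)" "m \<in> carrier M" "z \<in> H" using a by auto
    have "(\<lambda>w\<in>H. \<ominus>\<^bsub>M\<^esub> act w m) = \<theta> (i m \<oplus>\<^bsub>e\<^esub> s z)"
      unfolding \<theta>_add[OF i_hom(1)[OF \<open>m \<in> carrier M\<close>] s_hom(1)[OF \<open>z \<in> H\<close>]]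
      by (rule DerH_eqI) (simp_all add: \<theta>_i \<theta>_s)
    then show ?thesis by (simp add: \<Theta>_def j_def p_hom)
  qed
  have equiv: "j (x_act ?E (\<Theta> y) a) = \<lblot>y, j a\<rblot>\<^bsub>e\<^esub>" if y [simp]: "y \<in> carrier e" and a: "a \<in> carrier X.MH" for y a
  proof -
    obtain m z where [simp]: "a = (m, z)" "m \<in> carrier M" "z \<in> H" using a by auto
    show ?thesis
      apply (simp add: \<Theta>_def j_def i_hom \<theta>_closed i_\<theta> i_act e.bracket_add_right)
      by (rule e.M.formal_sum_eqI, (rule e.M.formal_sum_intros | (rule e.M.formal_sum_atom, simp))+, simp add: algebra_simps)
  qed
  \<comment> \<open>Injectivity of \<open>j\<close> pulls the Bianchi identity in \<open>e\<close>
    back to the source of the crossed module.\<close>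
  have "ce_diff2 Q X.MH (\<lambda>x. x_act ?E (\<Theta> (\<tau> x))) f t = \<zero>\<^bsub>X.MH\<^esub>"
    if t: "t \<in> carrier Q \<times> carrier Q \<times> carrier Q" for t
  proof (rule j_inj)
    have act_closed: "x_act ?E (\<Theta> (\<tau> X)) a \<in> carrier X.MH" if "X \<in> carrier Q" "a \<in> carrier X.MH" for X a
      using X.X.P.act_closed[of "\<Theta> (\<tau> X)" a] that \<Theta>D(1)[of "\<tau> X"] by simp
    have "j (ce_diff2 Q X.MH (\<lambda>x. x_act ?E (\<Theta> (\<tau> x))) f t) = ce_diff2 Q e (\<lambda>x. lie_bracket e (\<tau> x)) \<kappa> t"
      by (rule ce_diff2_natural[symmetric, OF lie_algebra_quot X.X.A.module_axioms[simplified] e.module_axioms j])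
        (use t act_closed in \<open>simp_all add: equiv f(2) del: X.MH_simps(1)\<close>)
    also have "\<dots> = \<zero>\<^bsub>e\<^esub>"
      by (rule bianchi[OF lie_algebra_quot e.lie_algebra_axioms \<tau>(1) _ t]) (simp add: \<kappa>_def)
    finally show "j (ce_diff2 Q X.MH (\<lambda>x. x_act ?E (\<Theta> (\<tau> x))) f t) = j \<zero>\<^bsub>X.MH\<^esub>"
      using lin_hom_additive(1)[OF X.X.A.module_axioms[simplified] e.module_axioms j] by simp
    show "ce_diff2 Q X.MH (\<lambda>x. x_act ?E (\<Theta> (\<tau> x))) f t \<in> carrier X.MH"
    proof -
      obtain X Y Z where t': "t = (X, Y, Z)" "X \<in> carrier Q" "Y \<in> carrier Q" "Z \<in> carrier Q"
        using t by auto
      then show ?thesis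
        unfolding t'(1) ce_diff2_apply[OF t'(2-4)]
        by (intro X.X.A.M.a_closed[unfolded X.lam_ext_simps] X.X.A.M.minus_closed[unfolded X.lam_ext_simps]
            act_closed fD(1) Q.bracket_closed)
    qed
  qed simp
  moreover have "(\<lambda>x. \<Theta> (\<tau> x)) \<in> lin_hom K Q X.PD"
    by (rule lin_hom_comp[OF \<tau>(1) lie_homD(1)[OF \<Theta>]])
  moreover have "x_bnd ?E (f (X, Y)) = \<lblot>\<Theta> (\<tau> X), \<Theta> (\<tau> Y)\<rblot>\<^bsub>X.PD\<^esub> \<ominus>\<^bsub>X.PD\<^esub> \<Theta> (\<tau> \<lblot>X, Y\<rblot>\<^bsub>Q\<^esub>)"
    if "X \<in> carrier Q" "Y \<in> carrier Q" for X Y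
    using that by (simp only: bnd fD f(2)) (simp add: \<kappa>_def \<Theta>D del: X.PD_simps)
  moreover have "x_proj ?E (\<Theta> (\<tau> X)) = X" if "X \<in> carrier Q" for X
    using that by (simp add: \<Theta>_def \<tau>(2))
  ultimately have "X.X.datum (\<lambda>x. \<Theta> (\<tau> x)) f (\<lambda>t\<in>carrier Q \<times> carrier Q \<times> carrier Q. \<zero>\<^bsub>M\<^esub>)"
    unfolding X.X.datum_def X.lam_ext_simps using f(1) by simp
  then show ?thesis
    unfolding X.X.crossed_cocycle_iff by (auto simp: invariants_def act_rules)
qed

section \<open>Extensions given by 2-cocycles\<close>

lemma module_cong:
  assumes "module K V" "carrier W = carrier V" "add W = add V" "\<zero>\<^bsub>W\<^esub> = \<zero>\<^bsub>V\<^esub>" "smult W = smult V"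
  shows "module K W"
proof -
  interpret V: module K V by fact
  have "abelian_group W"
    by (rule abelian_groupI) (use assms V.M.l_neg V.M.a_inv_closed in \<open>auto simp: V.M.a_ac\<close>)
  then show ?thesis
    by (rule moduleI[OF V.is_cring])
      (simp_all add: assms V.smult_l_distr V.smult_r_distr V.smult_assoc1)
qed

text \<open>The standard extension attached to a 2-cochain \<open>F\<close>. It changes nothing but
  the bracket of the semidirect product, so its elements have the type that \<open>H2\<close>
  prescribes.\<close>

definition cocycle_ext ::
    "('a, 'b, 'd) lie_algebra_scheme \<Rightarrow> ('a, 'c, 'e) module_scheme \<Rightarrow> ('b \<Rightarrow> 'c \<Rightarrow> 'c) \<Rightarrow>
      ('b \<times> 'b \<Rightarrow> 'c) \<Rightarrow> ('a, 'c, 'c \<times> 'b, 'b) lie_ext"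
  where "cocycle_ext L N act F = \<lparr>ext_alg = (semidirect N L act)\<lparr>lie_bracket :=
      \<lambda>(n, x) (n', x'). (act x n' \<ominus>\<^bsub>N\<^esub> act x' n \<oplus>\<^bsub>N\<^esub> F (x, x'), \<lblot>x, x'\<rblot>\<^bsub>L\<^esub>)\<rparr>,
    ext_incl = (\<lambda>n. (n, \<zero>\<^bsub>L\<^esub>)), ext_proj = snd\<rparr>"

context lie_module
begin

lemma module_cocycle_ext: "module K (ext_alg (cocycle_ext L N act F))"
  by (rule module_cong[OF module_semidirect]) (simp_all add: cocycle_ext_def)

lemma cocycle_ext_simps [simp]:
  "carrier (ext_alg (cocycle_ext L N act F)) = carrier N \<times> carrier L"
  "\<zero>\<^bsub>ext_alg (cocycle_ext L N act F)\<^esub> = (\<zero>\<^bsub>N\<^esub>, \<zero>\<^bsub>L\<^esub>)"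
  "(n, x) \<oplus>\<^bsub>ext_alg (cocycle_ext L N act F)\<^esub> (n', x') = (n \<oplus>\<^bsub>N\<^esub> n', x \<oplus>\<^bsub>L\<^esub> x')"
  "a \<odot>\<^bsub>ext_alg (cocycle_ext L N act F)\<^esub> (n, x) = (a \<odot>\<^bsub>N\<^esub> n, a \<odot>\<^bsub>L\<^esub> x)"
  "\<lblot>(n, x), (n', x')\<rblot>\<^bsub>ext_alg (cocycle_ext L N act F)\<^esub> =
    (act x n' \<ominus>\<^bsub>N\<^esub> act x' n \<oplus>\<^bsub>N\<^esub> F (x, x'), \<lblot>x, x'\<rblot>\<^bsub>L\<^esub>)"
  "ext_incl (cocycle_ext L N act F) n = (n, \<zero>\<^bsub>L\<^esub>)"
  "ext_proj (cocycle_ext L N act F) = snd"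
  by (simp_all add: cocycle_ext_def)

lemma cocycle_ext_minus:
  assumes "n' \<in> carrier N" "x' \<in> carrier L"
  shows "(n, x) \<ominus>\<^bsub>ext_alg (cocycle_ext L N act F)\<^esub> (n', x') = (n \<ominus>\<^bsub>N\<^esub> n', x \<ominus>\<^bsub>L\<^esub> x')"
proof -
  interpret S: module K "semidirect N L act" by (rule module_semidirect)
  interpret C: module K "ext_alg (cocycle_ext L N act F)" by (rule module_cocycle_ext)
  have "(n, x) \<ominus>\<^bsub>ext_alg (cocycle_ext L N act F)\<^esub> (n', x') = (n, x) \<ominus>\<^bsub>semidirect N L act\<^esub> (n', x')"
    by (rule a_minus_cong[OF S.M.abelian_group_axioms C.M.abelian_group_axioms])
      (use assms in \<open>simp_all add: cocycle_ext_def\<close>)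
  then show ?thesis using assms by simp
qed

lemma lie_extension_cocycle_ext:
  assumes F: "F \<in> alt_bilinear K L N"
    and dF: "\<And>t. t \<in> carrier L \<times> carrier L \<times> carrier L \<Longrightarrow> ce_diff2 L N act F t = \<zero>\<^bsub>N\<^esub>"
  shows "lie_extension K L N act (cocycle_ext L N act F)"
proof -
  let ?C = "ext_alg (cocycle_ext L N act F)"
  note FD [simp] = alt_bilinearD[OF F]
  note F_add [simp] = alt_bilinear_additive[OF module_axioms N.module_axioms F]
  have "lie_algebra K ?C"
  proof (intro lie_algebra.intro lie_algebra_axioms.intro field_axioms module_cocycle_ext)
    fix u v w a
    assume u: "u \<in> carrier ?C"
    obtain n x where [simp]: "u = (n, x)" "n \<in> carrier N" "x \<in> carrier L" using u by auto
    show "\<lblot>u, u\<rblot>\<^bsub>?C\<^esub> = \<zero>\<^bsub>?C\<^esub>"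
      by (simp add: bracket_alternating)
    assume v: "v \<in> carrier ?C"
    obtain n' x' where [simp]: "v = (n', x')" "n' \<in> carrier N" "x' \<in> carrier L" using v by auto
    show "\<lblot>u, v\<rblot>\<^bsub>?C\<^esub> \<in> carrier ?C" by simp
    show "\<lblot>a \<odot>\<^bsub>?C\<^esub> u, v\<rblot>\<^bsub>?C\<^esub> = a \<odot>\<^bsub>?C\<^esub> \<lblot>u, v\<rblot>\<^bsub>?C\<^esub>" if "a \<in> carrier K"
      using that by (simp add: act_rules bracket_smult_left a_minus_def N.smult_r_distr N.smult_r_minus)
    show "\<lblot>u, a \<odot>\<^bsub>?C\<^esub> v\<rblot>\<^bsub>?C\<^esub> = a \<odot>\<^bsub>?C\<^esub> \<lblot>u, v\<rblot>\<^bsub>?C\<^esub>" if "a \<in> carrier K"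
      using that by (simp add: act_rules bracket_smult_right a_minus_def N.smult_r_distr N.smult_r_minus)
    assume w: "w \<in> carrier ?C"
    obtain n'' x'' where [simp]: "w = (n'', x'')" "n'' \<in> carrier N" "x'' \<in> carrier L" using w by auto
    show "\<lblot>u \<oplus>\<^bsub>?C\<^esub> v, w\<rblot>\<^bsub>?C\<^esub> = \<lblot>u, w\<rblot>\<^bsub>?C\<^esub> \<oplus>\<^bsub>?C\<^esub> \<lblot>v, w\<rblot>\<^bsub>?C\<^esub>"
      apply (simp add: act_rules bracket_add_left)
      by (rule N.M.formal_sum_eqI, (rule N.M.formal_sum_intros | (rule N.M.formal_sum_atom, simp))+, simp add: algebra_simps)
    show "\<lblot>u, v \<oplus>\<^bsub>?C\<^esub> w\<rblot>\<^bsub>?C\<^esub> = \<lblot>u, v\<rblot>\<^bsub>?C\<^esub> \<oplus>\<^bsub>?C\<^esub> \<lblot>u, w\<rblot>\<^bsub>?C\<^esub>"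
      apply (simp add: act_rules bracket_add_right)
      by (rule N.M.formal_sum_eqI, (rule N.M.formal_sum_intros | (rule N.M.formal_sum_atom, simp))+, simp add: algebra_simps)
    \<comment> \<open>Brings the values of \<open>F\<close> in the Jacobi sum to the argument order
      of \<open>ce_diff2\<close>.\<close>
    have 1: "F (x, \<lblot>x', x''\<rblot>\<^bsub>L\<^esub>) = \<ominus>\<^bsub>N\<^esub> F (\<lblot>x', x''\<rblot>\<^bsub>L\<^esub>, x)" "F (x'', \<lblot>x, x'\<rblot>\<^bsub>L\<^esub>) = \<ominus>\<^bsub>N\<^esub> F (\<lblot>x, x'\<rblot>\<^bsub>L\<^esub>, x'')"
      by (rule alt_bilinear_antisym[OF module_axioms N.module_axioms F]; simp)+
    have "\<lblot>x'', x\<rblot>\<^bsub>L\<^esub> = \<ominus>\<^bsub>L\<^esub> \<lblot>x, x''\<rblot>\<^bsub>L\<^esub>" by (rule bracket_antisym) simp_all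
    moreover have "F (x', \<lblot>x, x''\<rblot>\<^bsub>L\<^esub>) = \<ominus>\<^bsub>N\<^esub> F (\<lblot>x, x''\<rblot>\<^bsub>L\<^esub>, x')" "F (x'', x) = \<ominus>\<^bsub>N\<^esub> F (x, x'')"
      by (rule alt_bilinear_antisym[OF module_axioms N.module_axioms F]; simp)+
    ultimately have 2: "F (x', \<lblot>x'', x\<rblot>\<^bsub>L\<^esub>) = F (\<lblot>x, x''\<rblot>\<^bsub>L\<^esub>, x')" "F (x'', x) = \<ominus>\<^bsub>N\<^esub> F (x, x'')"
      by simp_all
    have "ce_diff2 L N act F (x, x', x'') = \<zero>\<^bsub>N\<^esub>" by (rule dF) simp
    \<comment> \<open>The cocycle condition solved for its first term, as a rewrite rule for the
      \<open>N\<close>-component of the Jacobi sum.\<close>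
    then have 3: "act x (F (x', x'')) = act x' (F (x, x'')) \<ominus>\<^bsub>N\<^esub> act x'' (F (x, x'))
        \<oplus>\<^bsub>N\<^esub> F (\<lblot>x, x'\<rblot>\<^bsub>L\<^esub>, x'') \<ominus>\<^bsub>N\<^esub> F (\<lblot>x, x''\<rblot>\<^bsub>L\<^esub>, x') \<oplus>\<^bsub>N\<^esub> F (\<lblot>x', x''\<rblot>\<^bsub>L\<^esub>, x)"
    proof -
      have "act x (F (x', x'')) = ce_diff2 L N act F (x, x', x'') \<oplus>\<^bsub>N\<^esub>
        (act x' (F (x, x'')) \<ominus>\<^bsub>N\<^esub> act x'' (F (x, x'))
        \<oplus>\<^bsub>N\<^esub> F (\<lblot>x, x'\<rblot>\<^bsub>L\<^esub>, x'') \<ominus>\<^bsub>N\<^esub> F (\<lblot>x, x''\<rblot>\<^bsub>L\<^esub>, x') \<oplus>\<^bsub>N\<^esub> F (\<lblot>x', x''\<rblot>\<^bsub>L\<^esub>, x))"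
        apply (simp add: ce_diff2_apply)
        by (rule N.M.formal_sum_eqI, (rule N.M.formal_sum_intros | (rule N.M.formal_sum_atom, simp))+, simp add: algebra_simps)
      then show ?thesis by (simp add: dF)
    qed
    have "act x (act x' n'' \<ominus>\<^bsub>N\<^esub> act x'' n' \<oplus>\<^bsub>N\<^esub> F (x', x'')) \<ominus>\<^bsub>N\<^esub> act \<lblot>x', x''\<rblot>\<^bsub>L\<^esub> n \<oplus>\<^bsub>N\<^esub> F (x, \<lblot>x', x''\<rblot>\<^bsub>L\<^esub>) \<oplus>\<^bsub>N\<^esub>
      (act x' (act x'' n \<ominus>\<^bsub>N\<^esub> act x n'' \<oplus>\<^bsub>N\<^esub> F (x'', x)) \<ominus>\<^bsub>N\<^esub> act \<lblot>x'', x\<rblot>\<^bsub>L\<^esub> n' \<oplus>\<^bsub>N\<^esub> F (x', \<lblot>x'', x\<rblot>\<^bsub>L\<^esub>)) \<oplus>\<^bsub>N\<^esub>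
      (act x'' (act x n' \<ominus>\<^bsub>N\<^esub> act x' n \<oplus>\<^bsub>N\<^esub> F (x, x')) \<ominus>\<^bsub>N\<^esub> act \<lblot>x, x'\<rblot>\<^bsub>L\<^esub> n'' \<oplus>\<^bsub>N\<^esub> F (x'', \<lblot>x, x'\<rblot>\<^bsub>L\<^esub>)) = \<zero>\<^bsub>N\<^esub>"
      unfolding 1 2
      apply (simp add: act_rules act_bracket 3)
      by (rule N.M.formal_sum_eqI, (rule N.M.formal_sum_intros | (rule N.M.formal_sum_atom, simp))+, simp add: algebra_simps)
    then show "\<lblot>u, \<lblot>v, w\<rblot>\<^bsub>?C\<^esub>\<rblot>\<^bsub>?C\<^esub> \<oplus>\<^bsub>?C\<^esub> \<lblot>v, \<lblot>w, u\<rblot>\<^bsub>?C\<^esub>\<rblot>\<^bsub>?C\<^esub> \<oplus>\<^bsub>?C\<^esub> \<lblot>w, \<lblot>u, v\<rblot>\<^bsub>?C\<^esub>\<rblot>\<^bsub>?C\<^esub> = \<zero>\<^bsub>?C\<^esub>"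
      by (simp add: jacobi)
  qed
  then show ?thesis
    unfolding lie_extension_def
    by (auto simp: lie_hom_def lin_hom_def act_rules bracket_additive inj_on_def a_kernel_def
        kernel_def image_iff)
qed

end

text \<open>With \<open>\<sigma> x = (e x, t x)\<close>, the space \<open>(M \<rtimes> H) \<times> G/H\<close> with the bracket twisted by \<open>\<sigma>\<close> and
  \<open>f\<close> is a Lie algebra because the 3-cocycle vanishes. Transported to \<open>M \<times> G\<close> along
  \<open>((m, z), x) \<mapsto> (m, z + t x)\<close>, it is the extension by the 2-cocycle \<open>F\<close> below.\<close>

lemma (in lam_setup) extension_of_zero_cocycle:
  assumes d: "X.datum \<sigma> f (\<lambda>t\<in>carrier Q \<times> carrier Q \<times> carrier Q. \<zero>\<^bsub>M\<^esub>)"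
  obtains F s where "rho_setup K G M act H (cocycle_ext G M act F) s"
    "rho_derivation K G H M act (cocycle_ext G M act F) s = \<Delta>"
proof -
  note dD = X.datumD[OF d, unfolded lam_ext_simps]
  note \<sigma>D = lin_homD[OF dD(1)]
  note fD = alt_bilinearD[OF dD(2)]
  \<comment> \<open>The datum is split into components. The curvature equation then gives
    \<open>fH\<close> in \<open>G\<close> and \<open>e_bracket\<close> in \<open>DER\<close>, and
    the vanishing of the cocycle gives \<open>fM_cocycle\<close> in \<open>M\<close>.\<close>
  define e where "e x = fst (\<sigma> x)" for x
  define t where "t x = snd (\<sigma> x)" for x
  define fM where "fM u = fst (f u)" for u
  define fH where "fH u = snd (f u)" for u
  have \<sigma>: "\<sigma> x = (e x, t x)" for x by (simp add: e_def t_def)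
  have f: "f u = (fM u, fH u)" for u by (simp add: fM_def fH_def)
  have eD: "e x \<in> DerH" and t_closed [simp]: "t x \<in> carrier G" and cls_e: "cls (e x) = \<Delta> (q (t x))"
    if "x \<in> carrier Q" for x
    using \<sigma>D(1)[OF that] by (simp_all add: \<sigma>)
  have qt [simp]: "q (t x) = x" if "x \<in> carrier Q" for x
    using dD(3)[OF that] by (simp add: \<sigma>)
  have fM_closed [simp]: "fM (x, y) \<in> carrier M" and fH_closed [simp]: "fH (x, y) \<in> H"
    if "x \<in> carrier Q" "y \<in> carrier Q" for x y
    using fD(1)[OF that] by (simp_all add: f)
  have f_lin: "y \<in> carrier Q \<Longrightarrow> fM (x \<oplus>\<^bsub>Q\<^esub> y, w) = fM (x, w) \<oplus>\<^bsub>M\<^esub> fM (y, w)"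
    "y \<in> carrier Q \<Longrightarrow> fM (w, x \<oplus>\<^bsub>Q\<^esub> y) = fM (w, x) \<oplus>\<^bsub>M\<^esub> fM (w, y)"
    "a \<in> carrier K \<Longrightarrow> fM (a \<odot>\<^bsub>Q\<^esub> x, w) = a \<odot>\<^bsub>M\<^esub> fM (x, w)"
    "a \<in> carrier K \<Longrightarrow> fM (w, a \<odot>\<^bsub>Q\<^esub> x) = a \<odot>\<^bsub>M\<^esub> fM (w, x)"
    "fM (w, w) = \<zero>\<^bsub>M\<^esub>"
    if "w \<in> carrier Q" "x \<in> carrier Q" for x y w a
    using fD(2)[of x y w] fD(3)[of w x y] fD(4)[of a x w] fD(5)[of a w x] fD(6)[of w] that
    by (simp_all add: f)
  have f_alt: "fM (w, w) = \<zero>\<^bsub>M\<^esub>" if "w \<in> carrier Q" for w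
    using f_lin(5) that by blast
  have t_lin: "y \<in> carrier Q \<Longrightarrow> t (x \<oplus>\<^bsub>Q\<^esub> y) = t x \<oplus>\<^bsub>G\<^esub> t y"
    "a \<in> carrier K \<Longrightarrow> t (a \<odot>\<^bsub>Q\<^esub> x) = a \<odot>\<^bsub>G\<^esub> t x"
    and e_lin: "y \<in> carrier Q \<Longrightarrow> z \<in> H \<Longrightarrow> e (x \<oplus>\<^bsub>Q\<^esub> y) z = e x z \<oplus>\<^bsub>M\<^esub> e y z"
    "a \<in> carrier K \<Longrightarrow> z \<in> H \<Longrightarrow> e (a \<odot>\<^bsub>Q\<^esub> x) z = a \<odot>\<^bsub>M\<^esub> e x z"
    if "x \<in> carrier Q" for x y a z
    using \<sigma>D(2)[of x y] \<sigma>D(3)[of a x] that by (auto simp: \<sigma> fun_eq_iff restrict_def split: if_splits)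
  have e_rules [simp]: "z \<in> H \<Longrightarrow> e x z \<in> carrier M" "e x \<zero>\<^bsub>G\<^esub> = \<zero>\<^bsub>M\<^esub>"
    "z \<in> H \<Longrightarrow> w \<in> H \<Longrightarrow> e x (z \<oplus>\<^bsub>G\<^esub> w) = e x z \<oplus>\<^bsub>M\<^esub> e x w"
    "z \<in> H \<Longrightarrow> w \<in> H \<Longrightarrow> e x (z \<ominus>\<^bsub>G\<^esub> w) = e x z \<ominus>\<^bsub>M\<^esub> e x w"
    "a \<in> carrier K \<Longrightarrow> z \<in> H \<Longrightarrow> e x (a \<odot>\<^bsub>G\<^esub> z) = a \<odot>\<^bsub>M\<^esub> e x z"
    if "x \<in> carrier Q" for x z w a
    using that DerH_rules[OF eD[OF that(1)]] by simp_all
  have e_br: "e x \<lblot>z, w\<rblot>\<^bsub>G\<^esub> = act z (e x w) \<ominus>\<^bsub>M\<^esub> act w (e x z)" if "x \<in> carrier Q" "z \<in> H" "w \<in> H" for x z w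
    using DerH_bracket[OF eD] that by simp
  have t_zero [simp]: "t \<zero>\<^bsub>Q\<^esub> = \<zero>\<^bsub>G\<^esub>" and e_zero [simp]: "z \<in> H \<Longrightarrow> e \<zero>\<^bsub>Q\<^esub> z = \<zero>\<^bsub>M\<^esub>" for z
    using lin_hom_additive(1)[OF quot.module_quot X.P.module_axioms[simplified] dD(1)]
    by (simp_all add: \<sigma>)
  \<comment> \<open>Written as a sum, because \<open>PD_simps\<close> evaluates sums in
    \<open>PD\<close> componentwise while its subtraction has no such rule.\<close>
  have curv: "f' \<oplus>\<^bsub>PD\<^esub> \<sigma> \<lblot>x, y\<rblot>\<^bsub>Q\<^esub> = \<lblot>\<sigma> x, \<sigma> y\<rblot>\<^bsub>PD\<^esub>"
    if "x \<in> carrier Q" "y \<in> carrier Q" "f' = x_bnd (X_ext \<Delta>) (f (x, y))" for x y f'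
  proof -
    have c: "f' \<in> carrier PD" using bnd_closed fD(1) that by simp
    show ?thesis
      using dD(4)[OF that(1,2)] that(1,2) c \<sigma>D(1) X.P.bracket_closed[of "\<sigma> x" "\<sigma> y"]
        X.P.M.eq_minus_iff[of f' "\<lblot>\<sigma> x, \<sigma> y\<rblot>\<^bsub>PD\<^esub>" "\<sigma> \<lblot>x, y\<rblot>\<^bsub>Q\<^esub>"]
      unfolding that(3)[symmetric] by (simp del: PD_simps)
  qed
  have fH: "fH (x, y) = \<lblot>t x, t y\<rblot>\<^bsub>G\<^esub> \<ominus>\<^bsub>G\<^esub> t \<lblot>x, y\<rblot>\<^bsub>Q\<^esub>" if [simp]: "x \<in> carrier Q" "y \<in> carrier Q" for x y
  proof -
    have "fH (x, y) \<oplus>\<^bsub>G\<^esub> t \<lblot>x, y\<rblot>\<^bsub>Q\<^esub> = \<lblot>t x, t y\<rblot>\<^bsub>G\<^esub>"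
      using curv[OF that refl] by (simp add: \<sigma> f)
    then show ?thesis by (simp add: M.eq_minus_iff)
  qed
  have e_bracket: "e \<lblot>x, y\<rblot>\<^bsub>Q\<^esub> w = act (t x) (e y w) \<ominus>\<^bsub>M\<^esub> e y \<lblot>t x, w\<rblot>\<^bsub>G\<^esub> \<ominus>\<^bsub>M\<^esub>
      (act (t y) (e x w) \<ominus>\<^bsub>M\<^esub> e x \<lblot>t y, w\<rblot>\<^bsub>G\<^esub>) \<oplus>\<^bsub>M\<^esub> act w (fM (x, y))"
    if [simp]: "x \<in> carrier Q" "y \<in> carrier Q" and w [simp]: "w \<in> H" for x y w
  proof -
    have "(\<lambda>w\<in>H. (\<lambda>w\<in>H. \<ominus>\<^bsub>M\<^esub> act w (fM (x, y))) w \<oplus>\<^bsub>M\<^esub> e \<lblot>x, y\<rblot>\<^bsub>Q\<^esub> w) =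
        dact (t x) (e y) \<ominus>\<^bsub>DER\<^esub> dact (t y) (e x)"
      using curv[OF that(1,2) refl] by (simp add: \<sigma> f)
    from fun_cong[OF this, of w]
    have eq: "\<ominus>\<^bsub>M\<^esub> act w (fM (x, y)) \<oplus>\<^bsub>M\<^esub> e \<lblot>x, y\<rblot>\<^bsub>Q\<^esub> w = act (t x) (e y w) \<ominus>\<^bsub>M\<^esub> e y \<lblot>t x, w\<rblot>\<^bsub>G\<^esub> \<ominus>\<^bsub>M\<^esub>
      (act (t y) (e x w) \<ominus>\<^bsub>M\<^esub> e x \<lblot>t y, w\<rblot>\<^bsub>G\<^esub>)"
      by (simp add: DER_minus der_action_closed eD der_action_apply)
    have "e \<lblot>x, y\<rblot>\<^bsub>Q\<^esub> w = (\<ominus>\<^bsub>M\<^esub> act w (fM (x, y)) \<oplus>\<^bsub>M\<^esub> e \<lblot>x, y\<rblot>\<^bsub>Q\<^esub> w) \<oplus>\<^bsub>M\<^esub> act w (fM (x, y))"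
      by (rule N.M.formal_sum_eqI, (rule N.M.formal_sum_intros | (rule N.M.formal_sum_atom, simp))+, simp add: algebra_simps)
    then show ?thesis unfolding eq .
  qed
  have fM_cocycle: "act (t x) (fM (y, w)) \<oplus>\<^bsub>M\<^esub> e x (fH (y, w)) \<ominus>\<^bsub>M\<^esub> (act (t y) (fM (x, w)) \<oplus>\<^bsub>M\<^esub> e y (fH (x, w)))
      \<oplus>\<^bsub>M\<^esub> (act (t w) (fM (x, y)) \<oplus>\<^bsub>M\<^esub> e w (fH (x, y))) \<ominus>\<^bsub>M\<^esub> fM (\<lblot>x, y\<rblot>\<^bsub>Q\<^esub>, w) \<oplus>\<^bsub>M\<^esub> fM (\<lblot>x, w\<rblot>\<^bsub>Q\<^esub>, y)
      \<ominus>\<^bsub>M\<^esub> fM (\<lblot>y, w\<rblot>\<^bsub>Q\<^esub>, x) = \<zero>\<^bsub>M\<^esub>"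
    if [simp]: "x \<in> carrier Q" "y \<in> carrier Q" "w \<in> carrier Q" for x y w
    using dD(5)[of "(x, y, w)"] by (simp add: ce_diff2_apply \<sigma> f)
  \<comment> \<open>The part of \<open>g\<close> in \<open>H\<close> for the decomposition of
    \<open>G\<close> into \<open>H\<close> and the image of \<open>t\<close>.\<close>
  define \<zeta> where "\<zeta> g = g \<ominus>\<^bsub>G\<^esub> t (q g)" for g
  have \<zeta>_closed [simp]: "\<zeta> g \<in> H" if "g \<in> carrier G" for g
    using that quot.coset_eq_iff[of g "t (q g)"] by (simp add: \<zeta>_def)
  have \<zeta>_eq: "\<zeta> g \<oplus>\<^bsub>G\<^esub> t (q g) = g" if [simp]: "g \<in> carrier G" for g
    unfolding \<zeta>_def
    by (rule M.formal_sum_eqI, (rule M.formal_sum_intros | (rule M.formal_sum_atom, simp))+, simp add: algebra_simps)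
  have \<zeta>_lin: "g' \<in> carrier G \<Longrightarrow> \<zeta> (g \<oplus>\<^bsub>G\<^esub> g') = \<zeta> g \<oplus>\<^bsub>G\<^esub> \<zeta> g'" "a \<in> carrier K \<Longrightarrow> \<zeta> (a \<odot>\<^bsub>G\<^esub> g) = a \<odot>\<^bsub>G\<^esub> \<zeta> g"
    if [simp]: "g \<in> carrier G" for g g' a
  proof -
    show "\<zeta> (g \<oplus>\<^bsub>G\<^esub> g') = \<zeta> g \<oplus>\<^bsub>G\<^esub> \<zeta> g'" if [simp]: "g' \<in> carrier G"
      apply (simp add: \<zeta>_def quot.coset_add[symmetric] t_lin)
      by (rule M.formal_sum_eqI, (rule M.formal_sum_intros | (rule M.formal_sum_atom, simp))+, simp add: algebra_simps)
    show "\<zeta> (a \<odot>\<^bsub>G\<^esub> g) = a \<odot>\<^bsub>G\<^esub> \<zeta> g" if "a \<in> carrier K"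
      using that by (simp add: \<zeta>_def quot.coset_smult[symmetric] t_lin a_minus_def smult_r_distr smult_r_minus)
  qed
  have \<zeta>_H: "\<zeta> z = z" if "z \<in> H" for z using that by (simp add: \<zeta>_def q_zero)
  \<comment> \<open>The \<open>M\<close>-component of the twisted bracket of
    \<open>((0, \<zeta> g), q g)\<close> and \<open>((0, \<zeta> g'), q g')\<close>: two terms from
    the operators along \<open>\<sigma>\<close>, and one from the lift of its curvature.\<close>
  define F where "F = (\<lambda>(g, g')\<in>carrier G \<times> carrier G.
    e (q g) (\<zeta> g') \<ominus>\<^bsub>M\<^esub> e (q g') (\<zeta> g) \<oplus>\<^bsub>M\<^esub> fM (q g, q g'))"
  have F: "F \<in> alt_bilinear K G M"
  proof (rule alt_bilinearI)
    fix x y z assume [simp]: "x \<in> carrier G" "y \<in> carrier G" "z \<in> carrier G"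
    show "F (x \<oplus>\<^bsub>G\<^esub> y, z) = F (x, z) \<oplus>\<^bsub>M\<^esub> F (y, z)"
      apply (simp add: F_def quot.coset_add[symmetric] e_lin \<zeta>_lin f_lin)
      by (rule N.M.formal_sum_eqI, (rule N.M.formal_sum_intros | (rule N.M.formal_sum_atom, simp))+, simp add: algebra_simps)
    show "F (x, y \<oplus>\<^bsub>G\<^esub> z) = F (x, y) \<oplus>\<^bsub>M\<^esub> F (x, z)"
      apply (simp add: F_def quot.coset_add[symmetric] e_lin \<zeta>_lin f_lin)
      by (rule N.M.formal_sum_eqI, (rule N.M.formal_sum_intros | (rule N.M.formal_sum_atom, simp))+, simp add: algebra_simps)
  qed (auto simp: F_def quot.coset_smult[symmetric] e_lin \<zeta>_lin f_lin f_alt a_minus_def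
      N.smult_r_distr N.smult_r_minus N.M.r_neg)
  have dF: "ce_diff2 G M act F u = \<zero>\<^bsub>M\<^esub>" if u: "u \<in> carrier G \<times> carrier G \<times> carrier G" for u
  proof -
    obtain g1 g2 g3 where u': "u = (g1, g2, g3)" and [simp]: "g1 \<in> carrier G" "g2 \<in> carrier G" "g3 \<in> carrier G"
      using u by auto
    \<comment> \<open>Writing \<open>g\<close> as \<open>\<zeta> g + t (q g)\<close> expresses the
      coboundary by \<open>e\<close>, \<open>t\<close>, \<open>\<zeta>\<close>, \<open>fM\<close>
      and \<open>fH\<close>; what remains follows from \<open>e_bracket\<close>, \<open>e_br\<close>
      and \<open>coc\<close>.\<close>
    have act_split: "act g m = act (\<zeta> g) m \<oplus>\<^bsub>M\<^esub> act (t (q g)) m" if "g \<in> carrier G" "m \<in> carrier M" for g m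
      using that act_add_left[of "\<zeta> g" "t (q g)" m] by (simp add: \<zeta>_eq)
    \<comment> \<open>This is the \<open>H\<close>-component of the same twisted bracket, so
      \<open>\<zeta>\<close> and \<open>q\<close> together match the bracket of \<open>G\<close>
      with it.\<close>
    have \<zeta>_bracket: "\<zeta> \<lblot>g, g'\<rblot>\<^bsub>G\<^esub> = \<lblot>\<zeta> g, \<zeta> g'\<rblot>\<^bsub>G\<^esub> \<ominus>\<^bsub>G\<^esub> \<lblot>t (q g'), \<zeta> g\<rblot>\<^bsub>G\<^esub> \<oplus>\<^bsub>G\<^esub> \<lblot>t (q g), \<zeta> g'\<rblot>\<^bsub>G\<^esub> \<oplus>\<^bsub>G\<^esub> fH (q g, q g')"
      if [simp]: "g \<in> carrier G" "g' \<in> carrier G" for g g'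
    proof -
      have "\<lblot>\<zeta> g, t (q g')\<rblot>\<^bsub>G\<^esub> = \<ominus>\<^bsub>G\<^esub> \<lblot>t (q g'), \<zeta> g\<rblot>\<^bsub>G\<^esub>" by (rule bracket_antisym) simp_all
      then have "\<lblot>\<zeta> g \<oplus>\<^bsub>G\<^esub> t (q g), \<zeta> g' \<oplus>\<^bsub>G\<^esub> t (q g')\<rblot>\<^bsub>G\<^esub> = \<lblot>\<zeta> g, \<zeta> g'\<rblot>\<^bsub>G\<^esub> \<oplus>\<^bsub>G\<^esub> \<lblot>t (q g), \<zeta> g'\<rblot>\<^bsub>G\<^esub> \<oplus>\<^bsub>G\<^esub>
          (\<ominus>\<^bsub>G\<^esub> \<lblot>t (q g'), \<zeta> g\<rblot>\<^bsub>G\<^esub> \<oplus>\<^bsub>G\<^esub> \<lblot>t (q g), t (q g')\<rblot>\<^bsub>G\<^esub>)"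
        by (simp add: bracket_add_left bracket_add_right)
      then have A: "\<lblot>g, g'\<rblot>\<^bsub>G\<^esub> = \<lblot>\<zeta> g, \<zeta> g'\<rblot>\<^bsub>G\<^esub> \<oplus>\<^bsub>G\<^esub> \<lblot>t (q g), \<zeta> g'\<rblot>\<^bsub>G\<^esub> \<oplus>\<^bsub>G\<^esub>
          (\<ominus>\<^bsub>G\<^esub> \<lblot>t (q g'), \<zeta> g\<rblot>\<^bsub>G\<^esub> \<oplus>\<^bsub>G\<^esub> \<lblot>t (q g), t (q g')\<rblot>\<^bsub>G\<^esub>)"
        by (simp only: \<zeta>_eq that)
      have "\<zeta> \<lblot>g, g'\<rblot>\<^bsub>G\<^esub> = \<lblot>g, g'\<rblot>\<^bsub>G\<^esub> \<ominus>\<^bsub>G\<^esub> t \<lblot>q g, q g'\<rblot>\<^bsub>Q\<^esub>"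
        by (simp add: \<zeta>_def coset_bracket)
      then show ?thesis
        unfolding A fH[OF quot.coset_closed[OF that(1)] quot.coset_closed[OF that(2)]]
        apply (rule ssubst)
        by (rule M.formal_sum_eqI, (rule M.formal_sum_intros | (rule M.formal_sum_atom, simp))+, simp add: algebra_simps)
    qed
    define x where "x = q g1" define y where "y = q g2" define w where "w = q g3"
    have [simp]: "x \<in> carrier Q" "y \<in> carrier Q" "w \<in> carrier Q" by (simp_all add: x_def y_def w_def)
    have F_app: "F (g, g') = e (q g) (\<zeta> g') \<ominus>\<^bsub>M\<^esub> e (q g') (\<zeta> g) \<oplus>\<^bsub>M\<^esub> fM (q g, q g')"
      if "g \<in> carrier G" "g' \<in> carrier G" for g g'
      using that by (simp add: F_def)
    \<comment> \<open>\<open>fM_cocycle\<close> solved for one term, as a rewrite rule.\<close>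
    have coc: "act (t x) (fM (y, w)) = act (t y) (fM (x, w)) \<oplus>\<^bsub>M\<^esub> e y (fH (x, w)) \<ominus>\<^bsub>M\<^esub> e x (fH (y, w))
      \<ominus>\<^bsub>M\<^esub> (act (t w) (fM (x, y)) \<oplus>\<^bsub>M\<^esub> e w (fH (x, y))) \<oplus>\<^bsub>M\<^esub> fM (\<lblot>x, y\<rblot>\<^bsub>Q\<^esub>, w) \<ominus>\<^bsub>M\<^esub> fM (\<lblot>x, w\<rblot>\<^bsub>Q\<^esub>, y)
      \<oplus>\<^bsub>M\<^esub> fM (\<lblot>y, w\<rblot>\<^bsub>Q\<^esub>, x)"
    proof -
      have "act (t x) (fM (y, w)) = (act (t x) (fM (y, w)) \<oplus>\<^bsub>M\<^esub> e x (fH (y, w)) \<ominus>\<^bsub>M\<^esub> (act (t y) (fM (x, w)) \<oplus>\<^bsub>M\<^esub> e y (fH (x, w)))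
      \<oplus>\<^bsub>M\<^esub> (act (t w) (fM (x, y)) \<oplus>\<^bsub>M\<^esub> e w (fH (x, y))) \<ominus>\<^bsub>M\<^esub> fM (\<lblot>x, y\<rblot>\<^bsub>Q\<^esub>, w) \<oplus>\<^bsub>M\<^esub> fM (\<lblot>x, w\<rblot>\<^bsub>Q\<^esub>, y)
      \<ominus>\<^bsub>M\<^esub> fM (\<lblot>y, w\<rblot>\<^bsub>Q\<^esub>, x)) \<oplus>\<^bsub>M\<^esub> (act (t y) (fM (x, w)) \<oplus>\<^bsub>M\<^esub> e y (fH (x, w)) \<ominus>\<^bsub>M\<^esub> e x (fH (y, w))
      \<ominus>\<^bsub>M\<^esub> (act (t w) (fM (x, y)) \<oplus>\<^bsub>M\<^esub> e w (fH (x, y))) \<oplus>\<^bsub>M\<^esub> fM (\<lblot>x, y\<rblot>\<^bsub>Q\<^esub>, w) \<ominus>\<^bsub>M\<^esub> fM (\<lblot>x, w\<rblot>\<^bsub>Q\<^esub>, y)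
      \<oplus>\<^bsub>M\<^esub> fM (\<lblot>y, w\<rblot>\<^bsub>Q\<^esub>, x))"
        by (rule N.M.formal_sum_eqI, (rule N.M.formal_sum_intros | (rule N.M.formal_sum_atom, simp del: fH))+, simp add: algebra_simps)
      then show ?thesis by (simp add: fM_cocycle del: fH)
    qed
    have [simp]: "z \<ominus>\<^bsub>G\<^esub> z' \<in> H" if "z \<in> H" "z' \<in> H" for z z' using that by (simp add: a_minus_def)
    show ?thesis
      unfolding u'
      apply (simp add: ce_diff2_apply act_split[of g1] act_split[of g2] act_split[of g3] F_app coset_bracket[symmetric] \<zeta>_bracket flip: x_def y_def w_def)
      apply (simp add: act_rules e_bracket e_br coc)
      by (rule N.M.formal_sum_eqI, (rule N.M.formal_sum_intros | (rule N.M.formal_sum_atom, simp))+, simp add: algebra_simps)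
  qed
  let ?E = "cocycle_ext G M act F"
  have ext: "lie_extension K G M act ?E"
    by (rule lie_extension_cocycle_ext[OF F dF])
  \<comment> \<open>On \<open>H\<close> the map \<open>q\<close> is zero and \<open>\<zeta>\<close>
    the identity, so only one term of \<open>F\<close> survives. In particular \<open>F\<close>
    vanishes on pairs from \<open>H\<close>, which makes \<open>z \<mapsto> (0, z)\<close> a
    homomorphism.\<close>
  have F_H: "F (g, z) = e (q g) z" if "g \<in> carrier G" "z \<in> H" for g z
  proof -
    have "fM (q g, \<zero>\<^bsub>Q\<^esub>) = \<zero>\<^bsub>M\<^esub>"
      using f_lin(4)[of "q g" "\<zero>\<^bsub>Q\<^esub>" "\<zero>\<^bsub>K\<^esub>"] that by simp
    then show ?thesis using that by (simp add: F_def q_zero \<zeta>_H)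
  qed
  have s: "(\<lambda>z. (\<zero>\<^bsub>M\<^esub>, z)) \<in> lie_hom K G_H (ext_alg ?E)"
    by (auto simp: lie_hom_def lin_hom_def act_rules F_H q_zero)
  interpret S: rho_setup K G M act H ?E "\<lambda>z. (\<zero>\<^bsub>M\<^esub>, z)"
    by (rule rho_setup_intro[OF ext s]) simp
  have "rho_derivation K G H M act ?E (\<lambda>z. (\<zero>\<^bsub>M\<^esub>, z)) = \<Delta>"
  proof (rule extensionalityI)
    fix Y assume "Y \<in> carrier Q"
    then obtain g where g: "g \<in> carrier G" "Y = q g" by (rule quot.quot_cases)
    \<comment> \<open>Bracketing \<open>(0, g)\<close> with \<open>(0, z)\<close> leaves
      \<open>F (g, z) = e (q g) z\<close> in \<open>M\<close>, and \<open>e (q g)\<close> has class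
      \<open>\<Delta> (q g)\<close> because \<open>q (t x) = x\<close>.\<close>
    have "S.\<theta> (\<zero>\<^bsub>M\<^esub>, g) = e (q g)"
    proof (rule DerH_eqI)
      fix z assume [simp]: "z \<in> H"
      have "ext_incl ?E (S.\<theta> (\<zero>\<^bsub>M\<^esub>, g) z) = ext_incl ?E (e (q g) z)"
        using g S.i_\<theta>[of "(\<zero>\<^bsub>M\<^esub>, g)" z] by (simp add: cocycle_ext_minus act_rules F_H)
      then show "S.\<theta> (\<zero>\<^bsub>M\<^esub>, g) z = e (q g) z" by simp
    qed (use g eD DerH_ext in auto)
    then show "rho_derivation K G H M act ?E (\<lambda>z. (\<zero>\<^bsub>M\<^esub>, z)) Y = \<Delta> Y"
      using S.\<Delta>_apply[of "(\<zero>\<^bsub>M\<^esub>, g)"] g cls_e[of "q g"] by simp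
  qed (use \<Delta> in \<open>auto simp: rho_derivation_def derivations_def PiE_def\<close>)
  then show thesis using that S.rho_setup_axioms by blast
qed

theorem lemma8p5:
  fixes K :: "'k ring" and G :: "('k, 'g) lie_algebra" and H :: "'g set"
    and M :: "('k, 'm) module" and act :: "'g \<Rightarrow> 'm \<Rightarrow> 'm"
  assumes "field K"
    and "lie_algebra K G"
    and "lie_ideal K G H"
    and "lie_module K G M act"
  shows "rho K G H M act \<in> H2_1 K G H M act \<rightarrow> carrier (H1_H1 K G H M act) \<and>
    lam K G H M act \<in> carrier (H1_H1 K G H M act) \<rightarrow> carrier (H3_inv K G H M act) \<and>
    rho K G H M act ` H2_1 K G H M act =
      {X \<in> carrier (H1_H1 K G H M act). lam K G H M act X = \<zero>\<^bsub>H3_inv K G H M act\<^esub>}"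
proof -
  interpret lie_ideal_module K G M act H
    by (intro lie_ideal_module.intro lie_quotient.intro lie_quotient_axioms.intro assms)
  have zero: "\<zero>\<^bsub>H3_inv K G H M act\<^esub> = B3 K Q M_H (inv_action act)"
    by (simp add: H3_def quot_module_def)
  have "lam K G H M act (rho K G H M act X) = \<zero>\<^bsub>H3_inv K G H M act\<^esub>" if X: "X \<in> H2_1 K G H M act" for X
  proof -
    obtain E s where S: "rho_setup K G M act H E s" and X': "X = ext_equiv K G M act `` {E}"
      using X by (auto simp: H2_1_iff)
    interpret S: rho_setup K G M act H E s by fact
    show ?thesis
      unfolding X' rho_class[OF S] zero lam_class[OF S.\<Delta>_derivation S.crossed_cocycle_zero]
      using I.H3_class_zero by simp
  qed
  moreover have "\<exists>Y\<in>H2_1 K G H M act. X = rho K G H M act Y"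
    if X: "X \<in> carrier (H1_H1 K G H M act)" and lam: "lam K G H M act X = \<zero>\<^bsub>H3_inv K G H M act\<^esub>" for X
  proof -
    obtain \<Delta> where \<Delta>: "\<Delta> \<in> DerQ"
      "X = Cls \<Delta>" using H1_H1_cases[OF X] .
    interpret L: lam_setup K G M act H \<Delta> by unfold_locales (rule \<Delta>)
    obtain c where c: "X_cocycle \<Delta> c"
      using L.X.crossed_cocycle_exists by blast
    then obtain \<sigma> f where d: "L.X.datum \<sigma> f c" and cN: "c \<in> carrier Q \<times> carrier Q \<times> carrier Q \<rightarrow>\<^sub>E carrier M_H"
      by (auto simp: L.X.crossed_cocycle_iff)
    have "H3_class K Q M_H (inv_action act) c = B3 K Q M_H (inv_action act)"
      using lam lam_class[OF \<Delta>(1) c] \<Delta>(2) zero by simp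
    then obtain b where b: "b \<in> alt_bilinear K Q M_H" "c = ce_diff2 Q M_H (inv_action act) b"
      using I.H3_class_zeroD[OF cN] by blast
    note nb = I.ce_diff2_uminus[OF b(1)]
    \<comment> \<open>As \<open>c\<close> is the coboundary of \<open>b\<close>, shifting the lift
      by \<open>- b\<close> gives a datum with cocycle zero.\<close>
    have "(\<lambda>t\<in>carrier Q \<times> carrier Q \<times> carrier Q. ce_diff2 Q M_H (inv_action act)
        (\<lambda>t\<in>carrier Q \<times> carrier Q. \<ominus>\<^bsub>M_H\<^esub> b t) t \<oplus>\<^bsub>M_H\<^esub> c t) = (\<lambda>t\<in>carrier Q \<times> carrier Q \<times> carrier Q. \<zero>\<^bsub>M\<^esub>)"
    proof (rule restrict_ext)
      fix t assume t: "t \<in> carrier Q \<times> carrier Q \<times> carrier Q"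
      have "\<ominus>\<^bsub>M_H\<^esub> c t \<oplus>\<^bsub>M_H\<^esub> c t = \<zero>\<^bsub>M_H\<^esub>" using I.N.M.l_neg PiE_mem[OF cN t] by blast
      then show "ce_diff2 Q M_H (inv_action act) (\<lambda>t\<in>carrier Q \<times> carrier Q. \<ominus>\<^bsub>M_H\<^esub> b t) t \<oplus>\<^bsub>M_H\<^esub> c t = \<zero>\<^bsub>M\<^esub>"
        using nb(2)[OF t] b(2) by simp
    qed
    with L.X.datum_shift[OF d nb(1) cN] obtain f' where
      "L.X.datum \<sigma> f' (\<lambda>t\<in>carrier Q \<times> carrier Q \<times> carrier Q. \<zero>\<^bsub>M\<^esub>)" by auto
    then obtain F s where S: "rho_setup K G M act H (cocycle_ext G M act F) s"
      "rho_derivation K G H M act (cocycle_ext G M act F) s = \<Delta>"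
      by (rule L.extension_of_zero_cocycle)
    then show ?thesis using rho_class[OF S(1)] \<Delta>(2) H2_1_iff by metis
  qed
  ultimately show ?thesis using rho_closed lam_closed by blast
qed

end
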